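(* Let $\alpha,\beta>0$ and $\phi\in L^2(\mathbb{R})$, and let $\{\psi_{j,m}\}_{j\in\mathbb{Z},m\in\mathbb{N}_0}=\mathcal{W}(\phi,\alpha,\beta)$ be the associated Wilson system. The following statements are equivalent: (a) $\mathcal{W}(\phi,\alpha,\beta)$ is a Parseval frame for $L^2(\mathbb{R})$. (b) For each $k\in\mathbb{Z}$, $\Phi_k(\xi)=\delta_{k,0}$ for a.e. $\xi \in \mathbb{R}$ and $\Delta_k(\xi)=0$ for a.e. $\xi \in \mathbb{R}$, where $$\Phi_k(\xi)=\sum_{m\in\mathbb{Z}}\hat\phi(\xi-\alpha m)\overline{\hat\phi(\xi+\beta^{-1}k-\alpha m)},$$ $$\Delta_k(\xi)=\sum_{m\in\mathbb{Z}}(-1)^m\hat\phi(\xi+\alpha m)\overline{\hat\phi(\xi+\beta^{-1}(k+1/2)-\alpha m)}.$$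
   Context: The Fourier transform is $\hat f(w)=\int_{\mathbb{R}} f(t)e^{-2\pi i t w}\,dt$ (extended unitarily to $L^2(\mathbb{R})$). $\mathbb{N}=\{1,2,\dots\}$, $\mathbb{N}_0=\mathbb{N}\cup\{0\}$; $\delta_{k,0}$ is the Kronecker delta. For $\phi\in L^2(\mathbb{R})$ and $\alpha,\beta>0$, put $\phi_{j,m}(x)=\phi(x-\beta j)e^{2\pi i\alpha m x}$ for $j,m\in\mathbb{Z}$. The (bimodal) Wilson system is $\mathcal{W}(\phi,\alpha,\beta)=\{\psi_{j,m}: j\in\mathbb{Z}, m\in\mathbb{N}_0\}$ with $$\psi_{j,0}(x)=\sqrt{2\beta}\,\phi_{2j,0}(x)=\sqrt{2\beta}\,\phi(x-2\beta j)\quad (j\in\mathbb{Z}),$$ $$\psi_{j,m}(x)=\sqrt{\beta}\left[e^{-2\pi i\beta j\alpha m}\phi_{j,m}(x)+(-1)^{j+m}e^{2\pi i\beta j\alpha m}\phi_{j,-m}(x)\right]\quad (j\in\mathbb{Z},\ m\in\mathbb{N}).$$ A countable indexed family $\{e_i\}$ in $L^2(\mathbb{R})$ is a Parseval frame if $\sum_i|\langle f,e_i\rangle|^2=\|f\|_{L^2}^2$ for all $f\in L^2(\mathbb{R})$. *)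

theory Defs
  imports "HOL-Analysis.Analysis"
begin

text \<open>
  Elements of \<open>L\<^sup>2(\<real>)\<close> are represented by Borel measurable functions; every class of Lebesgue
  measurable functions modulo null sets has such a representative. Everything below is invariant
  under changing a function on a null set.
\<close>

definition L2 :: "(real \<Rightarrow> complex) set" where
  "L2 = {f. f \<in> borel_measurable lborel \<and> integrable lborel (\<lambda>x. (cmod (f x))\<^sup>2)}"

definition L2_inner :: "(real \<Rightarrow> complex) \<Rightarrow> (real \<Rightarrow> complex) \<Rightarrow> complex" where
  "L2_inner f g = (LINT x|lborel. f x * cnj (g x))"

definition L2_norm :: "(real \<Rightarrow> complex) \<Rightarrow> real" where
  "L2_norm f = sqrt (LINT x|lborel. (cmod (f x))\<^sup>2)"

definition fourier_L1 :: "(real \<Rightarrow> complex) \<Rightarrow> real \<Rightarrow> complex" where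
  "fourier_L1 f w = (LINT t|lborel. f t * cis (- 2 * pi * t * w))"

text \<open>
  The extension of the Fourier transform from \<open>L\<^sup>1 \<inter> L\<^sup>2\<close> to \<open>L\<^sup>2\<close> by continuity: \<open>g\<close> is the
  transform of \<open>f\<close> if the transforms of every sequence in \<open>L\<^sup>1 \<inter> L\<^sup>2\<close> converging to \<open>f\<close> in
  \<open>L\<^sup>2\<close> converge to \<open>g\<close> in \<open>L\<^sup>2\<close>. By Plancherel's theorem such a \<open>g\<close> exists and is unique up to
  null sets; \<open>fourier f\<close> is an arbitrary choice of representative.
\<close>

definition is_fourier_L2 :: "(real \<Rightarrow> complex) \<Rightarrow> (real \<Rightarrow> complex) \<Rightarrow> bool" where
  "is_fourier_L2 f g \<longleftrightarrow> g \<in> L2 \<and>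
     (\<forall>h :: nat \<Rightarrow> real \<Rightarrow> complex.
        (\<forall>n. h n \<in> L2 \<and> integrable lborel (h n)) \<longrightarrow>
        (\<lambda>n. L2_norm (\<lambda>x. h n x - f x)) \<longlonglongrightarrow> 0 \<longrightarrow>
        (\<forall>n. fourier_L1 (h n) \<in> L2) \<and>
        (\<lambda>n. L2_norm (\<lambda>w. fourier_L1 (h n) w - g w)) \<longlonglongrightarrow> 0)"

definition fourier :: "(real \<Rightarrow> complex) \<Rightarrow> real \<Rightarrow> complex" where
  "fourier f = (SOME g. is_fourier_L2 f g)"

definition tf_shift :: "(real \<Rightarrow> complex) \<Rightarrow> real \<Rightarrow> real \<Rightarrow> int \<Rightarrow> int \<Rightarrow> real \<Rightarrow> complex" where
  "tf_shift \<phi> \<alpha> \<beta> j m x = \<phi> (x - \<beta> * of_int j) * cis (2 * pi * \<alpha> * of_int m * x)"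

definition wilson :: "(real \<Rightarrow> complex) \<Rightarrow> real \<Rightarrow> real \<Rightarrow> int \<times> nat \<Rightarrow> real \<Rightarrow> complex" where
  "wilson \<phi> \<alpha> \<beta> = (\<lambda>(j, m) x.
     if m = 0 then of_real (sqrt (2 * \<beta>)) * tf_shift \<phi> \<alpha> \<beta> (2 * j) 0 x
     else of_real (sqrt \<beta>) *
       (cis (- 2 * pi * \<beta> * of_int j * \<alpha> * of_nat m) * tf_shift \<phi> \<alpha> \<beta> j (int m) x
        + (- 1) powi (j + int m) *
          cis (2 * pi * \<beta> * of_int j * \<alpha> * of_nat m) * tf_shift \<phi> \<alpha> \<beta> j (- int m) x))"

definition parseval_frame :: "'i set \<Rightarrow> ('i \<Rightarrow> real \<Rightarrow> complex) \<Rightarrow> bool" where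
  "parseval_frame I e \<longleftrightarrow> countable I \<and> (\<forall>i\<in>I. e i \<in> L2) \<and>
     (\<forall>f\<in>L2. ((\<lambda>i. (cmod (L2_inner f (e i)))\<^sup>2) has_sum (L2_norm f)\<^sup>2) I)"

text \<open>
  For \<open>\<phi> \<in> L\<^sup>2\<close> both series converge absolutely for almost every \<open>\<xi>\<close>, so the default value
  of the infinite sum is irrelevant.
\<close>

definition Phi :: "(real \<Rightarrow> complex) \<Rightarrow> real \<Rightarrow> real \<Rightarrow> int \<Rightarrow> real \<Rightarrow> complex" where
  "Phi \<phi> \<alpha> \<beta> k \<xi> = (\<Sum>\<^sub>\<infinity>m::int.
     fourier \<phi> (\<xi> - \<alpha> * of_int m) *
     cnj (fourier \<phi> (\<xi> + inverse \<beta> * of_int k - \<alpha> * of_int m)))"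

definition Delta :: "(real \<Rightarrow> complex) \<Rightarrow> real \<Rightarrow> real \<Rightarrow> int \<Rightarrow> real \<Rightarrow> complex" where
  "Delta \<phi> \<alpha> \<beta> k \<xi> = (\<Sum>\<^sub>\<infinity>m::int.
     (- 1) powi m * fourier \<phi> (\<xi> + \<alpha> * of_int m) *
     cnj (fourier \<phi> (\<xi> + inverse \<beta> * (of_int k + 1 / 2) - \<alpha> * of_int m)))"

end

theory Submission
  imports Defs
begin

text \<open>
  Put \<open>g = fourier \<phi>\<close> and \<open>P = 1 / (2 * \<beta>)\<close>. On the Fourier side the coefficient of \<open>f\<close> with
  respect to \<open>\<psi>\<^sub>j\<^sub>,\<^sub>m\<close> is a Fourier coefficient of a \<open>P\<close>-periodization built from the transform \<open>F\<close>
  of \<open>f\<close>. Summing over \<open>j\<close> by Parseval's identity for Fourier series, and separating \<open>m\<close> from \<open>-m\<close>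
  by the parallelogram law, gives
  \<open>\<Sum>\<^sub>j\<^sub>,\<^sub>m \<bar>\<langle>f, \<psi>\<^sub>j\<^sub>,\<^sub>m\<rangle>\<bar>\<^sup>2 = \<integral>\<^sub>0\<^sup>P \<Sum>\<^sub>m \<bar>\<Sum>\<^sub>k F (w + k * P) * cnj (G m k w)\<bar>\<^sup>2 dw\<close>,
  where \<open>G m k w\<close> is \<open>g (w + k * P - \<alpha> * m)\<close> for even \<open>k\<close> and \<open>(-1)\<^sup>m * g (w + k * P + \<alpha> * m)\<close> for
  odd \<open>k\<close>. Hence the system is a Parseval frame iff for almost every \<open>w\<close> the vectors \<open>(G m k w)\<^sub>m\<close> are
  orthonormal, and the entries of their Gram matrix are the values of \<open>Phi\<close> (even index
  difference) and \<open>Delta\<close> (odd index difference) at \<open>w + k * P\<close>.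

  Plancherel's theorem is obtained from Parseval's identity for Fourier series, whose
  completeness part rests on the Stone-Weierstrass theorem.
\<close>

section \<open>The space \<open>L\<^sup>2(\<real>)\<close>\<close>

text \<open>For a general \<open>\<phi>\<close> no Bessel bound is available beforehand, so sums and
  integrals are exchanged in the extended nonnegative reals, with sums read as integrals over
  counting measures; there Tonelli's theorem asks only for measurability. The sum over
  \<open>k\<close> has complex terms and sits inside the modulus, where this device does not help.
  It is made finite by testing only with transforms \<open>F\<close> that are bounded and of bounded
  support; such functions suffice because a Parseval identity extends from a dense set.

  The period is \<open>1 / (2 * \<beta>)\<close> because even \<open>j\<close> produce modulations
  by multiples of \<open>2 * \<beta>\<close>. Odd \<open>j\<close> leave a factor that changes sign
  from one cell to the next, and this alternation is the reason why \<open>G\<close> treats even and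
  odd \<open>k\<close> differently.

  In the converse direction an exceptional null set arises for each test vector, so only countably
  many vectors may be used. In the other direction the sums in \<open>Phi\<close> and
  \<open>Delta\<close> could a priori be default values of divergent series; the value 1 on the
  diagonal rules this out.\<close>

lemma L2_borel_measurable [measurable_dest]: "f \<in> L2 \<Longrightarrow> f \<in> borel_measurable borel"
  by (simp add: L2_def)

lemma L2_integrable_norm_square: "f \<in> L2 \<Longrightarrow> integrable lborel (\<lambda>x. (cmod (f x))\<^sup>2)"
  by (simp add: L2_def)

lemma L2_norm_nonneg [simp]: "0 \<le> L2_norm f"
  by (simp add: L2_norm_def)

lemma L2_norm_square: "(L2_norm f)\<^sup>2 = (LINT x|lborel. (cmod (f x))\<^sup>2)"
  by (simp add: L2_norm_def)

lemma L2I_nn_integral: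
  assumes "f \<in> borel_measurable borel" "(\<integral>\<^sup>+x. ennreal ((cmod (f x))\<^sup>2) \<partial>lborel) < \<infinity>"
  shows "f \<in> L2"
  using assms unfolding L2_def by (auto intro!: integrableI_bounded)

lemma L2_norm_square_nn_integral:
  "f \<in> L2 \<Longrightarrow> ennreal ((L2_norm f)\<^sup>2) = (\<integral>\<^sup>+x. ennreal ((cmod (f x))\<^sup>2) \<partial>lborel)"
  by (simp add: L2_norm_square nn_integral_eq_integral L2_integrable_norm_square)

lemma L2_dominated:
  assumes "f \<in> L2" "g \<in> borel_measurable borel" "\<And>x. cmod (g x) \<le> C * cmod (f x)"
  shows "g \<in> L2"
proof -
  have "integrable lborel (\<lambda>x. (cmod (g x))\<^sup>2)"
  proof (rule Bochner_Integration.integrable_bound)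
    show "integrable lborel (\<lambda>x. C\<^sup>2 * (cmod (f x))\<^sup>2)"
      using L2_integrable_norm_square[OF assms(1)] by simp
    show "(\<lambda>x. (cmod (g x))\<^sup>2) \<in> borel_measurable lborel"
      using assms(2) by simp
    show "AE x in lborel. norm ((cmod (g x))\<^sup>2) \<le> norm (C\<^sup>2 * (cmod (f x))\<^sup>2)"
      using power_mono[OF assms(3) norm_ge_zero, where n = 2] by (simp add: power_mult_distrib)
  qed
  then show ?thesis using assms(2) by (simp add: L2_def)
qed

lemma L2_zero [simp]: "(\<lambda>x. 0) \<in> L2"
  by (simp add: L2_def)

lemma L2_cmult: "f \<in> L2 \<Longrightarrow> (\<lambda>x. c * f x) \<in> L2"
  by (rule L2_dominated[where C = "cmod c" and f = f]) (auto simp: norm_mult)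

lemma L2_mult_bounded:
  assumes "f \<in> L2" "b \<in> borel_measurable borel" "\<And>x. cmod (b x) \<le> C"
  shows "(\<lambda>x. b x * f x) \<in> L2"
proof (rule L2_dominated[OF assms(1), where C = C])
  show "(\<lambda>x. b x * f x) \<in> borel_measurable borel"
    using assms(1,2) by measurable
  show "cmod (b x * f x) \<le> C * cmod (f x)" for x
    unfolding norm_mult by (intro mult_right_mono assms(3)) simp
qed

lemma L2_cnj: "f \<in> L2 \<Longrightarrow> (\<lambda>x. cnj (f x)) \<in> L2"
  by (rule L2_dominated[where C = 1 and f = f]) (auto intro: borel_measurable_continuous_on continuous_intros)

lemma L2_add:
  assumes "f \<in> L2" "g \<in> L2"
  shows "(\<lambda>x. f x + g x) \<in> L2"
proof -
  have "integrable lborel (\<lambda>x. (cmod (f x + g x))\<^sup>2)"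
  proof (rule Bochner_Integration.integrable_bound)
    show "integrable lborel (\<lambda>x. 2 * (cmod (f x))\<^sup>2 + 2 * (cmod (g x))\<^sup>2)"
      using assms[THEN L2_integrable_norm_square] by simp
    show "(\<lambda>x. (cmod (f x + g x))\<^sup>2) \<in> borel_measurable lborel"
      using assms by measurable
    have "(cmod (a + b))\<^sup>2 \<le> 2 * (cmod a)\<^sup>2 + 2 * (cmod b)\<^sup>2" for a b
    proof -
      have "(cmod (a + b))\<^sup>2 \<le> (cmod a + cmod b)\<^sup>2"
        by (intro power_mono norm_triangle_ineq) auto
      also have "\<dots> \<le> 2 * (cmod a)\<^sup>2 + 2 * (cmod b)\<^sup>2"
        using sum_squares_bound[of "cmod a" "cmod b"] by (simp add: power2_sum)
      finally show ?thesis .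
    qed
    then show "AE x in lborel. norm ((cmod (f x + g x))\<^sup>2)
        \<le> norm (2 * (cmod (f x))\<^sup>2 + 2 * (cmod (g x))\<^sup>2)"
      by simp
  qed
  then show ?thesis
    using assms by (auto simp: L2_def)
qed

lemma L2_diff: "f \<in> L2 \<Longrightarrow> g \<in> L2 \<Longrightarrow> (\<lambda>x. f x - g x) \<in> L2"
  using L2_add[of f "\<lambda>x. (-1) * g x"] L2_cmult[of g "-1"] by simp

lemma L2_sum: "(\<And>i. i \<in> I \<Longrightarrow> f i \<in> L2) \<Longrightarrow> (\<lambda>x. \<Sum>i\<in>I. f i x) \<in> L2"
  by (induction I rule: infinite_finite_induct) (auto intro: L2_add)

lemma L2_translate: "f \<in> L2 \<Longrightarrow> (\<lambda>x. f (x + a)) \<in> L2"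
  using lborel_integrable_real_affine[of "\<lambda>x. (cmod (f x))\<^sup>2" 1 a]
  by (auto simp: L2_def add.commute)

lemma L2_norm_translate: "L2_norm (\<lambda>x. f (x + a)) = L2_norm f"
  unfolding L2_norm_def
  using lborel_integral_real_affine[of 1 "\<lambda>x. (cmod (f x))\<^sup>2" a] by (simp add: add.commute)

lemma L2_reflect: "f \<in> L2 \<Longrightarrow> (\<lambda>x. f (- x)) \<in> L2"
  using lborel_integrable_real_affine[of "\<lambda>x. (cmod (f x))\<^sup>2" "-1" 0]
  by (auto simp: L2_def)

lemma L2_norm_reflect: "L2_norm (\<lambda>x. f (- x)) = L2_norm f"
  unfolding L2_norm_def
  using lborel_integral_real_affine[of "-1" "\<lambda>x. (cmod (f x))\<^sup>2" 0] by simp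

section \<open>Inner product, Cauchy-Schwarz and the triangle inequality\<close>

lemma L2_integrable_mult:
  assumes "f \<in> L2" "g \<in> L2"
  shows "integrable lborel (\<lambda>x. f x * g x)"
proof (rule Bochner_Integration.integrable_bound)
  show "integrable lborel (\<lambda>x. (cmod (f x))\<^sup>2 + (cmod (g x))\<^sup>2)"
    using assms[THEN L2_integrable_norm_square] by simp
  show "(\<lambda>x. f x * g x) \<in> borel_measurable lborel"
    using assms by measurable
  have "a * b \<le> a\<^sup>2 + b\<^sup>2" if "a \<ge> 0" "b \<ge> 0" for a b :: real
    using sum_squares_bound[of a b] mult_nonneg_nonneg[OF that] by simp
  then show "AE x in lborel. norm (f x * g x) \<le> norm ((cmod (f x))\<^sup>2 + (cmod (g x))\<^sup>2)"
    by (simp add: norm_mult)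
qed

lemma L2_integrable_inner: "f \<in> L2 \<Longrightarrow> g \<in> L2 \<Longrightarrow> integrable lborel (\<lambda>x. f x * cnj (g x))"
  by (intro L2_integrable_mult L2_cnj)

lemma L2_inner_add_left:
  "f \<in> L2 \<Longrightarrow> g \<in> L2 \<Longrightarrow> h \<in> L2 \<Longrightarrow> L2_inner (\<lambda>x. f x + g x) h = L2_inner f h + L2_inner g h"
  by (simp add: L2_inner_def ring_distribs L2_integrable_inner)

lemma L2_inner_diff_left:
  "f \<in> L2 \<Longrightarrow> g \<in> L2 \<Longrightarrow> h \<in> L2 \<Longrightarrow> L2_inner (\<lambda>x. f x - g x) h = L2_inner f h - L2_inner g h"
  by (simp add: L2_inner_def ring_distribs L2_integrable_inner)

lemma L2_inner_add_right:
  "f \<in> L2 \<Longrightarrow> g \<in> L2 \<Longrightarrow> h \<in> L2 \<Longrightarrow> L2_inner f (\<lambda>x. g x + h x) = L2_inner f g + L2_inner f h"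
  by (simp add: L2_inner_def ring_distribs L2_integrable_inner)

lemma L2_inner_cmult_left: "L2_inner (\<lambda>x. c * f x) g = c * L2_inner f g"
  by (simp add: L2_inner_def mult.assoc)

lemma L2_inner_cmult_right: "L2_inner f (\<lambda>x. c * g x) = cnj c * L2_inner f g"
  by (simp add: L2_inner_def mult.left_commute)

lemma L2_inner_commute: "L2_inner g f = cnj (L2_inner f g)"
  by (simp add: L2_inner_def mult.commute flip: Bochner_Integration.integral_cnj)

lemma L2_inner_self: "L2_inner f f = of_real ((L2_norm f)\<^sup>2)"
  by (simp add: L2_inner_def L2_norm_square complex_norm_square[symmetric]
      flip: integral_complex_of_real)

lemma L2_norm_square_add:
  assumes "f \<in> L2" "g \<in> L2"
  shows "(L2_norm (\<lambda>x. f x + g x))\<^sup>2 = (L2_norm f)\<^sup>2 + 2 * Re (L2_inner f g) + (L2_norm g)\<^sup>2"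
proof -
  have "L2_inner (\<lambda>x. f x + g x) (\<lambda>x. f x + g x)
      = L2_inner f f + (L2_inner f g + cnj (L2_inner f g)) + L2_inner g g"
    using assms
    by (simp add: L2_inner_add_left L2_inner_add_right L2_add L2_inner_commute[of g f])
  also have "L2_inner f g + cnj (L2_inner f g) = of_real (2 * Re (L2_inner f g))"
    by (simp add: complex_eq_iff)
  finally show ?thesis
    unfolding L2_inner_self of_real_add[symmetric] of_real_eq_iff .
qed

lemma L2_norm_cmult: "L2_norm (\<lambda>x. c * f x) = cmod c * L2_norm f"
  by (simp add: L2_norm_def norm_mult power_mult_distrib real_sqrt_mult)

lemma L2_norm_square_diff:
  assumes "f \<in> L2" "g \<in> L2"
  shows "(L2_norm (\<lambda>x. f x - g x))\<^sup>2 = (L2_norm f)\<^sup>2 - 2 * Re (L2_inner f g) + (L2_norm g)\<^sup>2"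
  using L2_norm_square_add[OF assms(1) L2_cmult[OF assms(2), of "-1"]]
    L2_norm_cmult[of "-1" g] L2_inner_cmult_right[of f "-1" g] by simp

lemma L2_norm_minus_commute: "L2_norm (\<lambda>x. f x - g x) = L2_norm (\<lambda>x. g x - f x)"
  by (simp add: L2_norm_def norm_minus_commute)

lemma L2_Cauchy_Schwarz:
  assumes "f \<in> L2" "g \<in> L2"
  shows "cmod (L2_inner f g) \<le> L2_norm f * L2_norm g"
proof -
  define c where "c = L2_inner f g"
  define n where "n = (L2_norm g)\<^sup>2"
  define m where "m = (L2_norm f)\<^sup>2"
  \<comment> \<open>The factor \<open>c\<close> makes the cross term real, leaving a real quadratic
    in \<open>t\<close>. Its minimum at \<open>t = 1 / n\<close> gives the claim; for
    \<open>n = 0\<close> it is affine, and the value of \<open>t\<close> chosen below would make it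
    equal to -1 unless \<open>c\<close> vanishes.\<close>
  have q: "0 \<le> m - 2 * t * (cmod c)\<^sup>2 + t\<^sup>2 * (cmod c)\<^sup>2 * n" for t :: real
  proof -
    have "0 \<le> (L2_norm (\<lambda>x. f x - (of_real t * c) * g x))\<^sup>2"
      by simp
    also have "\<dots> = m - 2 * Re (cnj (of_real t * c) * c) + (cmod (of_real t * c) * L2_norm g)\<^sup>2"
      unfolding L2_norm_square_diff[OF assms(1) L2_cmult[OF assms(2)]]
      by (simp only: L2_inner_cmult_right L2_norm_cmult m_def c_def)
    also have "cnj (of_real t * c) * c = of_real (t * (cmod c)\<^sup>2)"
      by (simp add: complex_norm_square mult.commute flip: of_real_power)
    also have "(cmod (of_real t * c) * L2_norm g)\<^sup>2 = t\<^sup>2 * (cmod c)\<^sup>2 * n"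
      by (simp add: norm_mult power_mult_distrib n_def)
    finally show ?thesis by simp
  qed
  have "(cmod c)\<^sup>2 \<le> m * n"
  proof (cases "n = 0")
    case True
    show ?thesis
    proof (rule ccontr)
      assume "\<not> ?thesis"
      then have "(cmod c)\<^sup>2 > 0" by (simp add: True)
      then show False
        using q[of "(m + 1) / (2 * (cmod c)\<^sup>2)"] by (simp add: True field_simps)
    qed
  next
    case False
    then have "n > 0" by (simp add: n_def)
    then show ?thesis
      using q[of "1 / n"] by (simp add: field_simps power2_eq_square)
  qed
  then have "(cmod c)\<^sup>2 \<le> (L2_norm f * L2_norm g)\<^sup>2"
    by (simp add: m_def n_def power_mult_distrib)
  then show ?thesis
    unfolding c_def by (rule power2_le_imp_le) simp
qed

lemma L2_norm_triangle:
  assumes "f \<in> L2" "g \<in> L2"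
  shows "L2_norm (\<lambda>x. f x + g x) \<le> L2_norm f + L2_norm g"
proof -
  have "Re (L2_inner f g) \<le> L2_norm f * L2_norm g"
    using L2_Cauchy_Schwarz[OF assms] complex_Re_le_cmod order_trans by blast
  then have "(L2_norm (\<lambda>x. f x + g x))\<^sup>2 \<le> (L2_norm f + L2_norm g)\<^sup>2"
    by (simp add: L2_norm_square_add[OF assms] power2_sum)
  then show ?thesis by (rule power2_le_imp_le) simp
qed

lemma L2_norm_triangle_diff:
  assumes "f \<in> L2" "g \<in> L2" "h \<in> L2"
  shows "L2_norm (\<lambda>x. f x - h x) \<le> L2_norm (\<lambda>x. f x - g x) + L2_norm (\<lambda>x. g x - h x)"
  using L2_norm_triangle[OF L2_diff[OF assms(1,2)] L2_diff[OF assms(2,3)]] by simp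

lemma L2_norm_le_add_diff:
  assumes "f \<in> L2" "g \<in> L2"
  shows "L2_norm f \<le> L2_norm g + L2_norm (\<lambda>x. f x - g x)"
  using L2_norm_triangle[OF assms(2) L2_diff[OF assms]] by simp

section \<open>Limits and completeness in the mean-square norm\<close>

lemma L2_tendsto_dominated:
  assumes w: "w \<in> L2" and f: "f \<in> borel_measurable borel" "\<And>x. cmod (f x) \<le> cmod (w x)"
    and s: "\<And>n. s n \<in> borel_measurable borel" "\<And>n x. cmod (s n x) \<le> cmod (w x)"
    and lim: "AE x in lborel. (\<lambda>n. s n x) \<longlonglongrightarrow> f x"
  shows "(\<lambda>n. L2_norm (\<lambda>x. s n x - f x)) \<longlonglongrightarrow> 0"
proof -
  have "(\<lambda>n. LINT x|lborel. (cmod (s n x - f x))\<^sup>2) \<longlonglongrightarrow> (LINT x|(lborel :: real measure). (0::real))"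
  proof (rule integral_dominated_convergence)
    show "integrable lborel (\<lambda>x. 4 * (cmod (w x))\<^sup>2)"
      using L2_integrable_norm_square[OF w] by simp
    show "AE x in lborel. (\<lambda>n. (cmod (s n x - f x))\<^sup>2) \<longlonglongrightarrow> 0"
      using lim
    proof eventually_elim
      case (elim x)
      then have "(\<lambda>n. (cmod (s n x - f x))\<^sup>2) \<longlonglongrightarrow> (cmod (f x - f x))\<^sup>2"
        by (intro tendsto_intros)
      then show ?case by simp
    qed
    show "AE x in lborel. norm ((cmod (s n x - f x))\<^sup>2) \<le> 4 * (cmod (w x))\<^sup>2" for n
    proof (rule AE_I2)
      fix x
      have "cmod (s n x - f x) \<le> cmod (s n x) + cmod (f x)"
        by (rule norm_triangle_ineq4)
      also have "\<dots> \<le> 2 * cmod (w x)"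
        using s(2)[of n x] f(2)[of x] by simp
      finally have "(cmod (s n x - f x))\<^sup>2 \<le> (2 * cmod (w x))\<^sup>2"
        by (intro power_mono) auto
      then show "norm ((cmod (s n x - f x))\<^sup>2) \<le> 4 * (cmod (w x))\<^sup>2"
        by (simp add: power_mult_distrib)
    qed
  qed (use f s in measurable)
  then have "(\<lambda>n. sqrt (LINT x|lborel. (cmod (s n x - f x))\<^sup>2)) \<longlonglongrightarrow> sqrt 0"
    by (intro tendsto_real_sqrt) simp
  then show ?thesis by (simp add: L2_norm_def)
qed

text \<open>Fatou's lemma for the squared moduli. Membership of the limit in \<open>L2\<close>
  belongs to the conclusion, which is what completeness and the contraction half of Plancherel's
  theorem draw on.\<close>

lemma L2_Fatou:
  assumes s: "\<And>n. s n \<in> L2" and g [measurable]: "g \<in> borel_measurable borel"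
    and lim: "AE x in lborel. (\<lambda>n. s n x) \<longlonglongrightarrow> g x"
    and bound: "\<forall>\<^sub>F n in sequentially. L2_norm (s n) \<le> B"
  shows "g \<in> L2" "L2_norm g \<le> B"
proof -
  have [measurable]: "s n \<in> borel_measurable borel" for n
    using s by measurable
  have "B \<ge> 0"
    using eventually_happens[OF bound] by (auto intro: order_trans[OF L2_norm_nonneg])
  have "(\<integral>\<^sup>+x. ennreal ((cmod (g x))\<^sup>2) \<partial>lborel)
      = (\<integral>\<^sup>+x. liminf (\<lambda>n. ennreal ((cmod (s n x))\<^sup>2)) \<partial>lborel)"
  proof (rule nn_integral_cong_AE, use lim in eventually_elim)
    case (elim x)
    then have "(\<lambda>n. ennreal ((cmod (s n x))\<^sup>2)) \<longlonglongrightarrow> ennreal ((cmod (g x))\<^sup>2)"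
      by (intro tendsto_intros tendsto_ennrealI)
    then show ?case by (metis lim_imp_Liminf trivial_limit_sequentially)
  qed
  also have "\<dots> \<le> liminf (\<lambda>n. \<integral>\<^sup>+x. ennreal ((cmod (s n x))\<^sup>2) \<partial>lborel)"
    by (rule nn_integral_liminf) simp
  also have "\<dots> = liminf (\<lambda>n. ennreal ((L2_norm (s n))\<^sup>2))"
    by (simp add: L2_norm_square_nn_integral s)
  also have "\<dots> \<le> liminf (\<lambda>n. ennreal (B\<^sup>2))"
    by (rule Liminf_mono) (use bound in eventually_elim, auto intro!: ennreal_leI power_mono)
  also have "\<dots> = ennreal (B\<^sup>2)"
    by (simp add: Liminf_const)
  finally have le: "(\<integral>\<^sup>+x. ennreal ((cmod (g x))\<^sup>2) \<partial>lborel) \<le> ennreal (B\<^sup>2)" .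
  also have "\<dots> < \<infinity>" by simp
  finally show "g \<in> L2" by (intro L2I_nn_integral g)
  then have "(L2_norm g)\<^sup>2 \<le> B\<^sup>2"
    using le by (simp flip: L2_norm_square_nn_integral)
  then show "L2_norm g \<le> B" using \<open>B \<ge> 0\<close> by (rule power2_le_imp_le)
qed

text \<open>
  Along a subsequence with \<open>\<parallel>s (n + 1) - s n\<parallel>\<^sup>2 \<le> 8\<^sup>-\<^sup>n\<close> the function
  \<open>\<Sum>n. 2\<^sup>n * \<bar>s (n + 1) - s n\<bar>\<^sup>2\<close> is integrable, so almost everywhere the increments are
  \<open>O(2\<^sup>-\<^sup>n\<^sup>/\<^sup>2)\<close> and the subsequence converges.
\<close>

lemma L2_fast_Cauchy_AE_convergent:
  assumes s: "\<And>n. s n \<in> L2" and fast: "\<And>n. (L2_norm (\<lambda>x. s (Suc n) x - s n x))\<^sup>2 \<le> (1/8) ^ n"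
  shows "AE x in lborel. convergent (\<lambda>n. s n x)"
proof -
  have [measurable]: "s n \<in> borel_measurable borel" for n
    using s by measurable
  have "(\<integral>\<^sup>+x. (\<Sum>n. ennreal (2 ^ n * (cmod (s (Suc n) x - s n x))\<^sup>2)) \<partial>lborel)
      = (\<Sum>n. \<integral>\<^sup>+x. ennreal (2 ^ n * (cmod (s (Suc n) x - s n x))\<^sup>2) \<partial>lborel)"
    by (rule nn_integral_suminf) simp
  also have "\<dots> = (\<Sum>n. ennreal (2 ^ n * (L2_norm (\<lambda>x. s (Suc n) x - s n x))\<^sup>2))"
    by (simp add: ennreal_mult nn_integral_cmult L2_norm_square_nn_integral s L2_diff)
  also have "\<dots> \<le> (\<Sum>n. ennreal ((1/4) ^ n))"
  proof (intro suminf_le ennreal_leI)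
    fix n
    have "2 ^ n * (L2_norm (\<lambda>x. s (Suc n) x - s n x))\<^sup>2 \<le> 2 ^ n * (1/8) ^ n"
      using fast by (intro mult_left_mono) auto
    also have "\<dots> = (1/4::real) ^ n"
      by (simp flip: power_mult_distrib)
    finally show "2 ^ n * (L2_norm (\<lambda>x. s (Suc n) x - s n x))\<^sup>2 \<le> (1/4) ^ n" .
  qed auto
  also have "\<dots> = ennreal (\<Sum>n. (1/4) ^ n)"
    by (rule suminf_ennreal2) (auto intro: summable_geometric)
  also have "\<dots> < \<infinity>" by simp
  finally have fin: "(\<integral>\<^sup>+x. (\<Sum>n. ennreal (2 ^ n * (cmod (s (Suc n) x - s n x))\<^sup>2)) \<partial>lborel) < \<infinity>" .
  have "AE x in lborel. (\<Sum>n. ennreal (2 ^ n * (cmod (s (Suc n) x - s n x))\<^sup>2)) \<noteq> \<infinity>"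
    by (rule nn_integral_PInf_AE[OF _ order.strict_implies_not_eq[OF fin]]) measurable
  then show ?thesis
  proof eventually_elim
    case (elim x)
    define a where "a n = ennreal (2 ^ n * (cmod (s (Suc n) x - s n x))\<^sup>2)" for n
    define C where "C = enn2real (\<Sum>n. a n)"
    have "(\<Sum>n. a n) \<noteq> \<infinity>"
      using elim by (simp only: a_def not_False_eq_True)
    then have C: "(\<Sum>n. a n) = ennreal C"
      by (simp add: C_def top.not_eq_extremum)
    have "cmod (s (Suc n) x - s n x) \<le> sqrt C * (sqrt (1/2)) ^ n" for n
    proof -
      have "a n \<le> ennreal C"
        using sum_le_suminf[OF summableI, of "{n}" a] by (simp add: C)
      then have "2 ^ n * (cmod (s (Suc n) x - s n x))\<^sup>2 \<le> C"
        unfolding a_def by (rule ennreal_le_iff[THEN iffD1, rotated]) (simp add: C_def)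
      then have "(cmod (s (Suc n) x - s n x))\<^sup>2 \<le> C * (1/2) ^ n"
        by (simp add: field_simps)
      then have "cmod (s (Suc n) x - s n x) \<le> sqrt (C * (1/2) ^ n)"
        using real_le_rsqrt by blast
      then show ?thesis by (simp add: real_sqrt_mult real_sqrt_power)
    qed
    moreover have "summable (\<lambda>n. sqrt C * (sqrt (1/2)) ^ n)"
      by (intro summable_mult summable_geometric) (simp add: real_sqrt_lt_1_iff)
    ultimately have "summable (\<lambda>n. s (Suc n) x - s n x)"
      by (rule summable_comparison_test'[where N = 0, rotated])
    then have "convergent (\<lambda>n. \<Sum>i<n. s (Suc i) x - s i x)"
      by (simp add: summable_iff_convergent)
    then have "convergent (\<lambda>n. s n x - s 0 x)"
      by (simp only: sum_lessThan_telescope[of "\<lambda>n. s n x"])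
    then have "convergent (\<lambda>n. (s n x - s 0 x) + s 0 x)"
      by (intro convergent_add convergent_const)
    then show ?case by simp
  qed
qed

lemma L2_complete:
  assumes s: "\<And>n. s n \<in> L2"
    and Cauchy: "\<And>e. e > 0 \<Longrightarrow> \<exists>N. \<forall>m\<ge>N. \<forall>n\<ge>N. L2_norm (\<lambda>x. s m x - s n x) < e"
  shows "\<exists>g\<in>L2. (\<lambda>n. L2_norm (\<lambda>x. s n x - g x)) \<longlonglongrightarrow> 0"
proof -
  have [measurable]: "s n \<in> borel_measurable borel" for n
    using s by measurable
  obtain N where N: "\<And>e m n. e > 0 \<Longrightarrow> m \<ge> N e \<Longrightarrow> n \<ge> N e \<Longrightarrow> L2_norm (\<lambda>x. s m x - s n x) < e"
    using Cauchy by metis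
  define e where "e k = sqrt ((1/8) ^ k)" for k :: nat
  have e: "e k > 0" for k by (simp add: e_def)
  \<comment> \<open>Each index exceeds its predecessor and the threshold for accuracy
    \<open>e k\<close>, whose square is the rate required by
    \<open>L2_fast_Cauchy_AE_convergent\<close>.\<close>
  define r where "r = rec_nat (N (e 0)) (\<lambda>k i. max (Suc i) (N (e (Suc k))))"
  have r_Suc: "r (Suc k) = max (Suc (r k)) (N (e (Suc k)))" for k
    by (simp add: r_def)
  have "r k \<ge> N (e k)" for k
    by (cases k) (auto simp: r_def)
  moreover have "r k < r (Suc k)" for k
    unfolding r_Suc by simp
  ultimately have r: "strict_mono r" "\<And>k. r k \<ge> N (e k)" "\<And>k. r (Suc k) \<ge> N (e k)"
    by (auto simp: strict_mono_Suc_iff intro: order_trans[OF _ less_imp_le])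
  \<comment> \<open>\<open>lim\<close> is total, so \<open>g\<close> is measurable on the whole
    line; its values on the null set of divergence are immaterial.\<close>
  define g where "g x = lim (\<lambda>k. s (r k) x)" for x
  have [measurable]: "g \<in> borel_measurable borel"
    unfolding g_def by measurable
  have "AE x in lborel. convergent (\<lambda>k. s (r k) x)"
  proof (rule L2_fast_Cauchy_AE_convergent)
    fix k
    have "(L2_norm (\<lambda>x. s (r (Suc k)) x - s (r k) x))\<^sup>2 \<le> (e k)\<^sup>2"
      using N[OF e[of k] r(3)[of k] r(2)[of k]] by (intro power_mono) auto
    then show "(L2_norm (\<lambda>x. s (r (Suc k)) x - s (r k) x))\<^sup>2 \<le> (1/8) ^ k"
      by (simp add: e_def)
  qed (rule s)
  then have lim: "AE x in lborel. (\<lambda>k. s (r k) x) \<longlonglongrightarrow> g x"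
    by eventually_elim (simp add: g_def convergent_LIMSEQ_iff)
  \<comment> \<open>With \<open>m\<close> fixed, Fatou along the subsequence carries the Cauchy
    bound over to the limit, so the whole sequence converges and not only the subsequence.\<close>
  have fatou: "(\<lambda>x. s m x - g x) \<in> L2 \<and> L2_norm (\<lambda>x. s m x - g x) \<le> d" if d: "d > 0" "m \<ge> N d" for m d
  proof -
    have "\<forall>\<^sub>F k in sequentially. L2_norm (\<lambda>x. s m x - s (r k) x) \<le> d"
    proof (rule eventually_sequentiallyI[of "N d"])
      fix k assume "N d \<le> k"
      with seq_suble[OF r(1), of k] have "N d \<le> r k" by simp
      then show "L2_norm (\<lambda>x. s m x - s (r k) x) \<le> d"
        using N[OF d(1,2)] by fastforce
    qed
    moreover have "AE x in lborel. (\<lambda>k. s m x - s (r k) x) \<longlonglongrightarrow> s m x - g x"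
      using lim by eventually_elim (intro tendsto_intros)
    ultimately show ?thesis
      using L2_Fatou[of "\<lambda>k x. s m x - s (r k) x" "\<lambda>x. s m x - g x" d] L2_diff[OF s s] by simp
  qed
  have "g \<in> L2"
    using L2_diff[OF s, of "\<lambda>x. s (N 1) x - g x" "N 1"] fatou[of 1 "N 1"] by simp
  moreover have "(\<lambda>n. L2_norm (\<lambda>x. s n x - g x)) \<longlonglongrightarrow> 0"
  proof (rule LIMSEQ_I)
    fix d :: real assume "d > 0"
    then have "\<forall>n\<ge>N (d/2). norm (L2_norm (\<lambda>x. s n x - g x) - 0) < d"
      using fatou[of "d/2"] by fastforce
    then show "\<exists>no. \<forall>n\<ge>no. norm (L2_norm (\<lambda>x. s n x - g x) - 0) < d" by blast
  qed
  ultimately show ?thesis by blast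
qed

lemma L2_inner_tendsto_left:
  assumes "\<And>n. s n \<in> L2" "f \<in> L2" "g \<in> L2" "(\<lambda>n. L2_norm (\<lambda>x. s n x - f x)) \<longlonglongrightarrow> 0"
  shows "(\<lambda>n. L2_inner (s n) g) \<longlonglongrightarrow> L2_inner f g"
proof -
  have lim: "(\<lambda>n. L2_norm (\<lambda>x. s n x - f x) * L2_norm g) \<longlonglongrightarrow> 0"
    using tendsto_mult_right[OF assms(4), of "L2_norm g"] by simp
  have le: "norm (L2_inner (s n) g - L2_inner f g) \<le> L2_norm (\<lambda>x. s n x - f x) * L2_norm g" for n
    using L2_Cauchy_Schwarz[OF L2_diff[OF assms(1,2)] assms(3)] assms(1-3)
    by (simp add: L2_inner_diff_left)
  have "(\<lambda>n. L2_inner (s n) g - L2_inner f g) \<longlonglongrightarrow> 0"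
    by (rule Lim_null_comparison[OF always_eventually[OF allI[OF le]] lim])
  then show ?thesis by (simp add: LIM_zero_iff)
qed

lemma L2_inner_tendsto_right:
  assumes "\<And>n. s n \<in> L2" "f \<in> L2" "g \<in> L2" "(\<lambda>n. L2_norm (\<lambda>x. s n x - f x)) \<longlonglongrightarrow> 0"
  shows "(\<lambda>n. L2_inner g (s n)) \<longlonglongrightarrow> L2_inner g f"
  using tendsto_cnj[OF L2_inner_tendsto_left[OF assms]] by (simp flip: L2_inner_commute)

lemma L2_norm_tendsto:
  assumes "\<And>n. s n \<in> L2" "f \<in> L2" "(\<lambda>n. L2_norm (\<lambda>x. s n x - f x)) \<longlonglongrightarrow> 0"
  shows "(\<lambda>n. L2_norm (s n)) \<longlonglongrightarrow> L2_norm f"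
proof -
  have le: "norm (L2_norm (s n) - L2_norm f) \<le> L2_norm (\<lambda>x. s n x - f x)" for n
    using L2_norm_le_add_diff[OF assms(1,2), of n] L2_norm_le_add_diff[OF assms(2,1), of n]
    by (simp add: L2_norm_minus_commute[of f] abs_le_iff)
  have "(\<lambda>n. L2_norm (s n) - L2_norm f) \<longlonglongrightarrow> 0"
    by (rule Lim_null_comparison[OF always_eventually[OF allI[OF le]] assms(3)])
  then show ?thesis by (simp add: LIM_zero_iff)
qed

lemma L2_norm_mono:
  assumes "f \<in> L2" "g \<in> borel_measurable borel" "\<And>x. cmod (g x) \<le> cmod (f x)"
  shows "g \<in> L2" "L2_norm g \<le> L2_norm f"
proof -
  show g: "g \<in> L2"
    using assms(3) by (intro L2_dominated[OF assms(1,2), where C = 1]) simp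
  show "L2_norm g \<le> L2_norm f"
    unfolding L2_norm_def using assms g
    by (intro real_sqrt_le_mono integral_mono L2_integrable_norm_square power_mono) auto
qed

text \<open>Cutting the domain and the values at once gives functions that are bounded with bounded
  support, hence integrable and in \<open>L2\<close>, and that stay dominated by \<open>f\<close>.
  Strictness places the support inside a half-open interval and makes \<open>clip f 0\<close>
  vanish.\<close>

definition clip :: "(real \<Rightarrow> complex) \<Rightarrow> nat \<Rightarrow> real \<Rightarrow> complex" where
  "clip f n x = (if \<bar>x\<bar> < real n \<and> cmod (f x) < real n then f x else 0)"

lemma borel_measurable_clip [measurable]:
  assumes [measurable]: "f \<in> borel_measurable borel"
  shows "clip f n \<in> borel_measurable borel"
  unfolding clip_def by measurable

lemma cmod_clip_le: "cmod (clip f n x) \<le> cmod (f x)"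
  by (simp add: clip_def)

lemma clip_eq_0: "x \<notin> {- real n..<real n} \<Longrightarrow> clip f n x = 0"
  by (auto simp: clip_def)

lemma clip_L2:
  assumes "f \<in> L2"
  shows "clip f n \<in> L2" "L2_norm (clip f n) \<le> L2_norm f"
  using L2_norm_mono[OF assms, of "clip f n"] assms by (auto simp: cmod_clip_le)

lemma clip_tendsto: "(\<lambda>n. clip f n x) \<longlonglongrightarrow> f x"
proof (rule tendsto_eventually)
  obtain N where N: "max \<bar>x\<bar> (cmod (f x)) < real N" using reals_Archimedean2 by blast
  show "\<forall>\<^sub>F n in sequentially. clip f n x = f x"
    by (rule eventually_sequentiallyI[of N]) (use N in \<open>auto simp: clip_def\<close>)
qed

lemma clip_tendsto_L2: "f \<in> L2 \<Longrightarrow> (\<lambda>n. L2_norm (\<lambda>x. clip f n x - f x)) \<longlonglongrightarrow> 0"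
  by (rule L2_tendsto_dominated[where w = f]) (auto simp: cmod_clip_le clip_tendsto)

text \<open>
  Bessel's inequality passes from \<open>D\<close> to \<open>V\<close> by taking limits; it makes the coefficient map a
  contraction into \<open>\<ell>\<^sup>2\<close>, and so Parseval's identity extends from \<open>D\<close> to \<open>V\<close> too.
\<close>

lemma Parseval_from_dense:
  assumes e: "\<And>i. i \<in> I \<Longrightarrow> e i \<in> L2" and V: "V \<subseteq> L2" "D \<subseteq> V"
    and V_diff: "\<And>f g. f \<in> V \<Longrightarrow> g \<in> V \<Longrightarrow> (\<lambda>x. f x - g x) \<in> V"
    and dense: "\<And>f d. f \<in> V \<Longrightarrow> d > 0 \<Longrightarrow> \<exists>g\<in>D. L2_norm (\<lambda>x. f x - g x) < d"
    and Parseval: "\<And>g. g \<in> D \<Longrightarrow> ((\<lambda>i. (cmod (L2_inner g (e i)))\<^sup>2) has_sum (L2_norm g)\<^sup>2) I"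
    and f: "f \<in> V"
  shows "((\<lambda>i. (cmod (L2_inner f (e i)))\<^sup>2) has_sum (L2_norm f)\<^sup>2) I"
proof -
  define q where "q S h = L2_set (\<lambda>i. cmod (L2_inner h (e i))) S" for S h
  have q_square: "(q S h)\<^sup>2 = (\<Sum>i\<in>S. (cmod (L2_inner h (e i)))\<^sup>2)" for S h
    by (simp add: q_def L2_set_def sum_nonneg)
  have q_nonneg: "q S h \<ge> 0" for S h by (simp add: q_def)
  have in_L2: "h \<in> V \<Longrightarrow> h \<in> L2" for h using V by auto
  have q_triangle: "q S h \<le> q S k + q S (\<lambda>x. h x - k x)" if "S \<subseteq> I" "h \<in> V" "k \<in> V" for S h k
  proof -
    have "q S h \<le> L2_set (\<lambda>i. cmod (L2_inner k (e i)) + cmod (L2_inner (\<lambda>x. h x - k x) (e i))) S"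
      unfolding q_def
    proof (rule L2_set_mono)
      fix i assume "i \<in> S"
      then have "L2_inner h (e i) = L2_inner k (e i) + L2_inner (\<lambda>x. h x - k x) (e i)"
        using that in_L2 e by (subst L2_inner_diff_left) auto
      then show "cmod (L2_inner h (e i))
          \<le> cmod (L2_inner k (e i)) + cmod (L2_inner (\<lambda>x. h x - k x) (e i))"
        using norm_triangle_ineq by metis
    qed simp
    also have "\<dots> \<le> q S k + q S (\<lambda>x. h x - k x)"
      unfolding q_def by (rule L2_set_triangle_ineq)
    finally show ?thesis .
  qed
  have Bessel_D: "q S h \<le> L2_norm h" if "finite S" "S \<subseteq> I" "h \<in> D" for S h
  proof (rule power2_le_imp_le)
    show "(q S h)\<^sup>2 \<le> (L2_norm h)\<^sup>2"
      unfolding q_square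
      by (rule finite_sum_le_has_sum[OF Parseval[OF that(3)]]) (use that in auto)
  qed simp
  have Bessel: "q S h \<le> L2_norm h" if S: "finite S" "S \<subseteq> I" and h: "h \<in> V" for S h
  proof -
    have "\<exists>g\<in>D. L2_norm (\<lambda>x. h x - g x) < 1 / real (Suc n)" for n
      by (rule dense[OF h]) simp
    then obtain s where s: "\<And>n. s n \<in> D" "\<And>n. L2_norm (\<lambda>x. h x - s n x) < 1 / real (Suc n)"
      by metis
    have sV: "s n \<in> L2" for n using s(1) V by auto
    have le: "norm (L2_norm (\<lambda>x. s n x - h x)) \<le> 1 / real (Suc n)" for n
      using s(2)[of n] by (simp add: L2_norm_minus_commute[of _ h])
    have "(\<lambda>n. L2_norm (\<lambda>x. s n x - h x)) \<longlonglongrightarrow> 0"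
      by (rule Lim_null_comparison[OF always_eventually[OF allI[OF le]] LIMSEQ_Suc[OF lim_1_over_n]])
    then have lim: "(\<lambda>n. L2_inner (s n) (e i)) \<longlonglongrightarrow> L2_inner h (e i)" if "i \<in> S" for i
      using that S h in_L2 e sV by (intro L2_inner_tendsto_left) auto
    have "(\<lambda>n. q S (s n)) \<longlonglongrightarrow> q S h"
      unfolding q_def L2_set_def by (intro tendsto_intros lim)
    moreover have "(\<lambda>n. L2_norm (s n)) \<longlonglongrightarrow> L2_norm h"
      using \<open>(\<lambda>n. L2_norm (\<lambda>x. s n x - h x)) \<longlonglongrightarrow> 0\<close> sV in_L2 h by (intro L2_norm_tendsto) auto
    ultimately show ?thesis
      using Bessel_D[OF S s(1)] by (intro LIMSEQ_le) auto
  qed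
  have summable: "(\<lambda>i. (cmod (L2_inner f (e i)))\<^sup>2) summable_on I"
  proof (rule nonneg_bounded_partial_sums_imp_summable_on[where C = "(L2_norm f)\<^sup>2"])
    show "\<forall>\<^sub>F S in finite_subsets_at_top I. (\<Sum>i\<in>S. (cmod (L2_inner f (e i)))\<^sup>2) \<le> (L2_norm f)\<^sup>2"
      using Bessel[OF _ _ f] q_nonneg
      by (auto simp: eventually_finite_subsets_at_top_weakI simp flip: q_square intro!: power_mono)
  qed simp
  have "infsum (\<lambda>i. (cmod (L2_inner f (e i)))\<^sup>2) I = (L2_norm f)\<^sup>2"
  proof (rule antisym)
    show "infsum (\<lambda>i. (cmod (L2_inner f (e i)))\<^sup>2) I \<le> (L2_norm f)\<^sup>2"
      using Bessel[OF _ _ f] q_nonneg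
      by (intro infsum_le_finite_sums[OF summable]) (auto simp flip: q_square intro!: power_mono)
    \<comment> \<open>For the lower bound \<open>f\<close> is replaced by a nearby \<open>g\<close>
      in \<open>D\<close>: finitely many coefficients recover the norm of \<open>g\<close> up to
      \<open>d / 3\<close>, and Bessel's inequality for the difference controls the change of these
      coefficients.\<close>
    define s where "s = sqrt (infsum (\<lambda>i. (cmod (L2_inner f (e i)))\<^sup>2) I)"
    have s_square: "s\<^sup>2 = infsum (\<lambda>i. (cmod (L2_inner f (e i)))\<^sup>2) I"
      unfolding s_def by (simp add: infsum_nonneg)
    have "s \<ge> 0" by (simp add: s_def infsum_nonneg)
    have "L2_norm f \<le> s + d" if "d > 0" for d
    proof -
      have "d / 3 > 0" using that by simp
      obtain g where g: "g \<in> D" "L2_norm (\<lambda>x. f x - g x) < d / 3"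
        using dense[OF f \<open>d / 3 > 0\<close>] by blast
      have gV: "g \<in> V" using g V by auto
      have "((\<lambda>S. q S g) \<longlongrightarrow> L2_norm g) (finite_subsets_at_top I)"
        using tendsto_real_sqrt[OF Parseval[OF g(1), unfolded has_sum_def]]
        by (simp add: q_def L2_set_def)
      then have "\<forall>\<^sub>F S in finite_subsets_at_top I. L2_norm g - d / 3 < q S g"
        using \<open>d / 3 > 0\<close> by (intro order_tendstoD) auto
      then obtain S where S: "finite S" "S \<subseteq> I" "L2_norm g - d / 3 < q S g"
        unfolding eventually_finite_subsets_at_top by blast
      have "q S g \<le> q S f + q S (\<lambda>x. g x - f x)"
        using S f gV by (intro q_triangle)
      also have "q S (\<lambda>x. g x - f x) \<le> L2_norm (\<lambda>x. f x - g x)"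
        using Bessel[OF S(1,2) V_diff[OF gV f]] by (simp add: L2_norm_minus_commute[of f])
      also have "q S f \<le> s"
      proof (rule power2_le_imp_le[OF _ \<open>s \<ge> 0\<close>])
        show "(q S f)\<^sup>2 \<le> s\<^sup>2"
          unfolding q_square s_square by (rule finite_sum_le_infsum[OF summable]) (use S in auto)
      qed
      finally have "q S g \<le> s + L2_norm (\<lambda>x. f x - g x)" by simp
      moreover have "L2_norm f \<le> L2_norm g + L2_norm (\<lambda>x. f x - g x)"
        using f gV in_L2 by (intro L2_norm_le_add_diff) auto
      ultimately show ?thesis using S(3) g(2) by simp
    qed
    then have "L2_norm f \<le> s" by (rule field_le_epsilon)
    then have "(L2_norm f)\<^sup>2 \<le> s\<^sup>2" by (intro power_mono) auto
    then show "(L2_norm f)\<^sup>2 \<le> infsum (\<lambda>i. (cmod (L2_inner f (e i)))\<^sup>2) I"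
      by (simp add: s_square)
  qed
  then show ?thesis using summable by (metis has_sum_infsum)
qed

section \<open>Fourier series\<close>

lemma borel_measurable_cis [measurable]: "cis \<in> borel_measurable borel"
  by (intro borel_measurable_continuous_onI continuous_intros)

lemma emeasure_lborel_Ico_lt_top [simp]: "emeasure lborel {a..<b::real} < top"
  by (cases "a \<le> b") auto

text \<open>A continuous map from a compact interval onto the circle is closed, hence a quotient
  map, so a continuous function constant on its fibers descends. The only fiber with more than one
  point consists of the two endpoints.\<close>

lemma continuous_circle_lift:
  fixes h :: "real \<Rightarrow> complex"
  assumes P: "P > 0" and h: "continuous_on {0..P} h" "h 0 = h P"
  obtains q where "continuous_on (sphere 0 1) q" "\<And>x. x \<in> {0..P} \<Longrightarrow> q (cis (2 * pi * x / P)) = h x"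
proof -
  let ?c = "\<lambda>x. cis (2 * pi * x / P)"
  have image: "?c ` {0..P} = sphere 0 1"
  proof (intro subset_antisym subsetI)
    fix z :: complex assume "z \<in> sphere 0 1"
    then have "z = cis (Arg2pi z)"
      using Arg2pi_eq[of z] by (simp add: cis_conv_exp)
    moreover have "0 \<le> Arg2pi z" "Arg2pi z < 2 * pi"
      by (rule Arg2pi_ge_0, rule Arg2pi_lt_2pi)
    ultimately show "z \<in> ?c ` {0..P}"
      using P by (intro image_eqI[of _ _ "P * Arg2pi z / (2 * pi)"]) (auto simp: field_simps)
  qed auto
  have cont: "continuous_on {0..P} ?c"
    using P by (intro continuous_intros) auto
  have "quotient_map (top_of_set {0..P}) (top_of_set (sphere 0 1)) ?c"
  proof (rule continuous_closed_imp_quotient_map)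
    show "continuous_map (top_of_set {0..P}) (top_of_set (sphere 0 1)) ?c"
      using cont image by auto
    show "closed_map (top_of_set {0..P}) (top_of_set (sphere 0 1)) ?c"
      unfolding closed_map_def using Abstract_Topology_2.continuous_imp_closed_map[OF _ cont image] by auto
    show "?c ` topspace (top_of_set {0..P}) = topspace (top_of_set (sphere 0 1))"
      using image by simp
  qed
  moreover have "continuous_map (top_of_set {0..P}) euclidean h"
    using h(1) by simp
  moreover have "h x = h y" if xy: "x \<in> {0..P}" "y \<in> {0..P}" "?c x = ?c y" for x y
  proof -
    obtain n :: int where n: "2 * pi * x / P = 2 * pi * y / P + 2 * pi * of_int n"
      using xy(3) sin_cos_eq_iff[of "2 * pi * x / P" "2 * pi * y / P"]
      by (auto simp: complex_eq_iff)
    then have "2 * pi * (x / P) = 2 * pi * (y / P + n)"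
      by (simp add: ring_distribs)
    then have "x / P = y / P + n"
      by (subst (asm) mult_cancel_left) auto
    then have "x = y + n * P"
      using P by (simp add: field_simps)
    moreover from this have "n * P \<le> 1 * P" "(-1) * P \<le> n * P"
      using xy(1,2) by auto
    then have "real_of_int n \<le> 1" "-1 \<le> real_of_int n"
      using P mult_le_cancel_right_pos by blast+
    then have "n = -1 \<or> n = 0 \<or> n = 1"
      by linarith
    ultimately have "x = y \<or> x = 0 \<and> y = P \<or> x = P \<and> y = 0"
      using xy(1,2) by auto
    then show ?thesis using h(2) by auto
  qed
  ultimately obtain q where "continuous_map (top_of_set (sphere 0 1)) euclidean q"
    "\<And>x. x \<in> {0..P} \<Longrightarrow> q (?c x) = h x"
    by (rule quotient_map_lift_exists) auto
  then show ?thesis using that by simp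
qed

text \<open>Only monomials and sums are constructors; closure under products follows by induction on
  each factor and is what the passage from polynomials on the circle requires.\<close>

inductive trig_polynomial :: "real \<Rightarrow> (real \<Rightarrow> complex) \<Rightarrow> bool" for P where
  monom: "trig_polynomial P (\<lambda>x. c * cis (2 * pi * of_int k * x / P))"
| add: "trig_polynomial P s \<Longrightarrow> trig_polynomial P t \<Longrightarrow> trig_polynomial P (\<lambda>x. s x + t x)"

lemma trig_polynomial_const: "trig_polynomial P (\<lambda>x. c)"
  using trig_polynomial.monom[of P c 0] by simp

lemma trig_polynomial_monom_mult:
  "trig_polynomial P t \<Longrightarrow> trig_polynomial P (\<lambda>x. c * cis (2 * pi * of_int k * x / P) * t x)"
proof (induction rule: trig_polynomial.induct)
  case (monom d l)
  have "c * cis (2 * pi * of_int k * x / P) * (d * cis (2 * pi * of_int l * x / P))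
      = (c * d) * cis (2 * pi * of_int (k + l) * x / P)" for x
    by (simp add: cis_mult[symmetric] ring_distribs add_divide_distrib)
  then show ?case
    by (simp only: trig_polynomial.monom)
next
  case (add s t)
  then show ?case
    using trig_polynomial.add[OF add.IH] by (simp add: ring_distribs)
qed

lemma trig_polynomial_mult:
  "trig_polynomial P s \<Longrightarrow> trig_polynomial P t \<Longrightarrow> trig_polynomial P (\<lambda>x. s x * t x)"
proof (induction rule: trig_polynomial.induct)
  case (monom c k)
  then show ?case by (rule trig_polynomial_monom_mult)
next
  case (add s s')
  then show ?case
    using trig_polynomial.add[of P "\<lambda>x. s x * t x" "\<lambda>x. s' x * t x"] by (simp add: ring_distribs)
qed

text \<open>By Euler's formulas a real-linear functional of \<open>cis t\<close> is a combination of
  \<open>cis t\<close> and \<open>cis (- t)\<close>; sums and products then follow the structure of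
  the polynomial.\<close>

lemma trig_polynomial_real_polynomial_function:
  fixes r :: "complex \<Rightarrow> real"
  assumes "real_polynomial_function r"
  shows "trig_polynomial P (\<lambda>x. complex_of_real (r (cis (2 * pi * x / P))))"
  using assms
proof (induction rule: real_polynomial_function.induct)
  case (linear f)
  interpret bounded_linear f by fact
  have "complex_of_real (f (cis (2 * pi * x / P)))
      = (f 1 / 2 + f \<i> / (2 * \<i>)) * cis (2 * pi * of_int 1 * x / P)
      + (f 1 / 2 - f \<i> / (2 * \<i>)) * cis (2 * pi * of_int (-1) * x / P)" for x
  proof -
    define t where "t = 2 * pi * x / P"
    have "cis t = cos t *\<^sub>R 1 + sin t *\<^sub>R \<i>"
      by (simp add: complex_eq_iff)
    then have "f (cis t) = cos t * f 1 + sin t * f \<i>"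
      by (simp only: add scaleR) simp
    moreover have "2 * pi * of_int 1 * x / P = t" "2 * pi * of_int (-1) * x / P = - t"
      by (simp_all add: t_def)
    ultimately show ?thesis
      unfolding t_def[symmetric] by (simp add: complex_eq_iff field_simps)
  qed
  then show ?case
    using trig_polynomial.add[OF trig_polynomial.monom[of P _ 1] trig_polynomial.monom[of P _ "-1"]]
    by simp
next
  case (const c)
  show ?case by (rule trig_polynomial_const)
next
  case (add f g)
  then show ?case using trig_polynomial.add[OF add.IH] by simp
next
  case (mult f g)
  then show ?case using trig_polynomial_mult[OF mult.IH] by simp
qed

text \<open>After lifting to the circle, Stone-Weierstrass supplies a polynomial in the two real
  coordinates of the plane with complex values; its real and imaginary parts are handled
  separately.\<close>

lemma trig_polynomial_dense_continuous:
  fixes h :: "real \<Rightarrow> complex"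
  assumes P: "P > 0" and h: "continuous_on {0..P} h" "h 0 = h P" and e: "e > 0"
  obtains t where "trig_polynomial P t" "\<And>x. x \<in> {0..P} \<Longrightarrow> cmod (h x - t x) < e"
proof -
  obtain q where q: "continuous_on (sphere 0 1) q"
    "\<And>x. x \<in> {0..P} \<Longrightarrow> q (cis (2 * pi * x / P)) = h x"
    using continuous_circle_lift[OF P h] by blast
  obtain p :: "complex \<Rightarrow> complex" where p: "polynomial_function p"
    "\<And>z. z \<in> sphere 0 1 \<Longrightarrow> norm (q z - p z) < e"
    using Stone_Weierstrass_polynomial_function[OF compact_sphere q(1) e] by blast
  let ?c = "\<lambda>x. cis (2 * pi * x / P)"
  have "real_polynomial_function (\<lambda>z. Re (p z))" "real_polynomial_function (\<lambda>z. Im (p z))"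
    using p(1) bounded_linear_Re bounded_linear_Im by (auto simp: polynomial_function_def o_def)
  then have "trig_polynomial P (\<lambda>x. of_real (Re (p (?c x))) + \<i> * of_real (Im (p (?c x))))"
    by (intro trig_polynomial.add trig_polynomial_mult trig_polynomial_const
        trig_polynomial_real_polynomial_function)
  then have "trig_polynomial P (\<lambda>x. p (?c x))"
    by (simp flip: complex_eq)
  moreover have "cmod (h x - p (?c x)) < e" if "x \<in> {0..P}" for x
    using p(2)[of "?c x"] q(2)[OF that] by simp
  ultimately show ?thesis using that by blast
qed

section \<open>The orthonormal system of characters on one period\<close>

lemma integral_character:
  assumes P: "P > 0"
  shows "(LINT x|lborel. indicator {0..<P} x * cis (2 * pi * of_int n * x / P)) = (if n = 0 then of_real P else 0)"
proof -
  have "(LINT x|lborel. indicator {0..<P} x * cis (2 * pi * of_int n * x / P))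
      = (LINT x|lborel. indicator {0..P} x *\<^sub>R cis (2 * pi * of_int n * x / P))"
  proof (rule integral_cong_AE)
    show "AE x in lborel. indicator {0..<P} x * cis (2 * pi * of_int n * x / P)
        = indicator {0..P} x *\<^sub>R cis (2 * pi * of_int n * x / P)"
      using AE_lborel_singleton[of P] by eventually_elim (auto simp: indicator_def)
  qed measurable
  also have "\<dots> = (if n = 0 then of_real P else 0)"
  proof (cases "n = 0")
    case True
    have "(LINT x|lborel. indicator {0..P} x *\<^sub>R (1 :: complex)) = of_real P - of_real 0"
      using P by (intro integral_FTC_Icc) (auto intro!: derivative_eq_intros continuous_intros)
    then show ?thesis by (simp add: True)
  next
    case False
    define w where "w = 2 * pi * of_int n / P"
    have w: "w \<noteq> 0" using False P by (simp add: w_def)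
    have "(LINT x|lborel. indicator {0..P} x *\<^sub>R cis (w * x)) = cis (w * P) / (\<i> * w) - cis (w * 0) / (\<i> * w)"
    proof (rule integral_FTC_Icc)
      show "((\<lambda>x. cis (w * x) / (\<i> * w)) has_vector_derivative cis (w * x)) (at x within {0..P})" for x
      proof -
        have "((\<lambda>z. exp (\<i> * (complex_of_real w * z)) / (\<i> * complex_of_real w)) has_field_derivative exp (\<i> * (complex_of_real w * complex_of_real x))) (at (complex_of_real x))"
          using w by (auto intro!: derivative_eq_intros simp: mult_ac)
        then have "((\<lambda>x. exp (\<i> * (complex_of_real w * complex_of_real x)) / (\<i> * w)) has_vector_derivative
            exp (\<i> * (complex_of_real w * complex_of_real x))) (at x within {0..P})"
          by (rule has_vector_derivative_real_field)
        then show ?thesis by (simp add: cis_conv_exp)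
      qed
      show "continuous_on {0..P} (\<lambda>x. cis (w * x))"
        by (intro continuous_intros)
    qed (use P in simp)
    also have "w * P = 2 * pi * of_int n"
      using P by (simp add: w_def)
    also have "cis (2 * pi * of_int n) = 1"
      by (simp add: cis_multiple_2pi)
    finally show ?thesis
      using False by (simp add: w_def)
  qed
  finally show ?thesis .
qed

lemma L2_indicator_bounded:
  assumes "S \<in> sets borel" "emeasure lborel S < \<infinity>" "b \<in> borel_measurable borel" "\<And>x. cmod (b x) \<le> C"
  shows "(\<lambda>x. indicator S x * b x) \<in> L2"
proof -
  have "(cmod (indicator S x))\<^sup>2 = indicator S x" for x
    by (simp add: indicator_def)
  then have "(\<lambda>x. indicator S x :: complex) \<in> L2"
    using assms(1,2) by (auto simp: L2_def)
  then have "(\<lambda>x. b x * indicator S x) \<in> L2"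
    by (rule L2_mult_bounded) (use assms in auto)
  then show ?thesis by (simp add: mult.commute)
qed

text \<open>The cell is half-open because its translates by multiples of \<open>P\<close> tile the
  line without overlap, which the later foldings exploit.\<close>

definition fourier_basis :: "real \<Rightarrow> int \<Rightarrow> real \<Rightarrow> complex" where
  "fourier_basis P k x = indicator {0..<P} x * (cis (2 * pi * of_int k * x / P) / of_real (sqrt P))"

lemma fourier_basis_L2: "fourier_basis P k \<in> L2"
  unfolding fourier_basis_def
  by (rule L2_indicator_bounded[where C = "1 / \<bar>sqrt P\<bar>"])
    (auto simp: norm_divide)

lemma fourier_basis_orthonormal:
  assumes "P > 0"
  shows "L2_inner (fourier_basis P k) (fourier_basis P l) = (if k = l then 1 else 0)"
proof -
  have "L2_inner (fourier_basis P k) (fourier_basis P l)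
      = (LINT x|lborel. (indicator {0..<P} x * cis (2 * pi * of_int (k - l) * x / P)) / of_real P)"
    unfolding L2_inner_def
  proof (rule Bochner_Integration.integral_cong[OF refl])
    fix x
    have "cis (2 * pi * of_int k * x / P) * cnj (cis (2 * pi * of_int l * x / P))
        = cis (2 * pi * of_int (k - l) * x / P)"
      by (simp add: cis_cnj cis_divide cis_mult ring_distribs diff_divide_distrib)
    moreover have "complex_of_real (sqrt P) * complex_of_real (sqrt P) = of_real P"
      using assms by (simp flip: of_real_mult)
    ultimately show "fourier_basis P k x * cnj (fourier_basis P l x)
        = (indicator {0..<P} x * cis (2 * pi * of_int (k - l) * x / P)) / of_real P"
      by (simp add: fourier_basis_def indicator_def)
  qed
  also have "\<dots> = (if k = l then 1 else 0)"
    using assms integral_character[of P "k - l"] by (simp del: of_int_diff)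
  finally show ?thesis .
qed

definition fourier_span :: "real \<Rightarrow> (real \<Rightarrow> complex) set" where
  "fourier_span P = {t. \<exists>K c. finite K \<and> t = (\<lambda>x. \<Sum>k\<in>K. c k * fourier_basis P k x)}"

lemma fourier_spanI: "finite K \<Longrightarrow> (\<lambda>x. \<Sum>k\<in>K. c k * fourier_basis P k x) \<in> fourier_span P"
  unfolding fourier_span_def by blast

lemma trig_polynomial_in_span:
  assumes "P > 0" "trig_polynomial P t"
  shows "(\<lambda>x. indicator {0..<P} x * t x) \<in> fourier_span P"
  using assms(2)
proof (induction rule: trig_polynomial.induct)
  case (monom c k)
  have eq: "(\<lambda>x. indicator {0..<P} x * (c * cis (2 * pi * of_int k * x / P)))
      = (\<lambda>x. \<Sum>k\<in>{k}. (c * of_real (sqrt P)) * fourier_basis P k x)"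
    using assms(1) by (auto simp: fourier_basis_def indicator_def)
  show ?case unfolding eq by (rule fourier_spanI) simp
next
  case (add s t)
  obtain K c where K: "finite K" "(\<lambda>x. indicator {0..<P} x * s x) = (\<lambda>x. \<Sum>k\<in>K. c k * fourier_basis P k x)"
    using add.IH(1) unfolding fourier_span_def by blast
  obtain L d where L: "finite L" "(\<lambda>x. indicator {0..<P} x * t x) = (\<lambda>x. \<Sum>k\<in>L. d k * fourier_basis P k x)"
    using add.IH(2) unfolding fourier_span_def by blast
  \<comment> \<open>The two frequency sets may overlap, so the coefficients are merged on their
    union.\<close>
  define b where "b k = (if k \<in> K then c k else 0) + (if k \<in> L then d k else 0)" for k
  have "indicator {0..<P} x * (s x + t x) = (\<Sum>k\<in>K \<union> L. b k * fourier_basis P k x)" for x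
  proof -
    have "(\<Sum>k\<in>K \<union> L. b k * fourier_basis P k x)
        = (\<Sum>k\<in>K \<union> L. if k \<in> K then c k * fourier_basis P k x else 0)
          + (\<Sum>k\<in>K \<union> L. if k \<in> L then d k * fourier_basis P k x else 0)"
      unfolding sum.distrib[symmetric] by (rule sum.cong) (auto simp: b_def ring_distribs)
    also have "(\<Sum>k\<in>K \<union> L. if k \<in> K then c k * fourier_basis P k x else 0) = (\<Sum>k\<in>K. c k * fourier_basis P k x)"
      using K(1) L(1) by (intro sum.mono_neutral_cong_right) auto
    also have "(\<Sum>k\<in>K \<union> L. if k \<in> L then d k * fourier_basis P k x else 0) = (\<Sum>k\<in>L. d k * fourier_basis P k x)"
      using K(1) L(1) by (intro sum.mono_neutral_cong_right) auto
    finally show ?thesis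
      using fun_cong[OF K(2), of x] fun_cong[OF L(2), of x] by (simp add: ring_distribs)
  qed
  then have eq: "(\<lambda>x. indicator {0..<P} x * (s x + t x)) = (\<lambda>x. \<Sum>k\<in>K \<union> L. b k * fourier_basis P k x)"
    by blast
  show ?case unfolding eq by (rule fourier_spanI) (simp add: K(1) L(1))
qed

lemma L2_inner_sum_left:
  assumes "\<And>i. i \<in> I \<Longrightarrow> f i \<in> L2" "g \<in> L2"
  shows "L2_inner (\<lambda>x. \<Sum>i\<in>I. f i x) g = (\<Sum>i\<in>I. L2_inner (f i) g)"
  unfolding L2_inner_def sum_distrib_right
  using assms by (intro Bochner_Integration.integral_sum L2_integrable_inner)

lemma L2_inner_sum_right:
  assumes "\<And>i. i \<in> I \<Longrightarrow> f i \<in> L2" "g \<in> L2"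
  shows "L2_inner g (\<lambda>x. \<Sum>i\<in>I. f i x) = (\<Sum>i\<in>I. L2_inner g (f i))"
  using L2_inner_sum_left[OF assms, THEN arg_cong[where f = cnj]]
  by (simp flip: L2_inner_commute)

lemma Parseval_fourier_span:
  assumes P: "P > 0" and t: "t \<in> fourier_span P"
  shows "((\<lambda>l. (cmod (L2_inner t (fourier_basis P l)))\<^sup>2) has_sum (L2_norm t)\<^sup>2) UNIV"
proof -
  obtain K c where K: "finite K" and t_eq: "t = (\<lambda>x. \<Sum>k\<in>K. c k * fourier_basis P k x)"
    using t by (auto simp: fourier_span_def)
  have tL2: "t \<in> L2"
    unfolding t_eq by (intro L2_sum L2_cmult fourier_basis_L2)
  have coeff: "L2_inner t (fourier_basis P l) = (if l \<in> K then c l else 0)" for l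
    unfolding t_eq
    by (subst L2_inner_sum_left)
      (auto simp: L2_cmult fourier_basis_L2 L2_inner_cmult_left fourier_basis_orthonormal[OF P] K if_distrib
        cong: if_cong)
  have "L2_inner t t = (\<Sum>k\<in>K. cnj (c k) * L2_inner t (fourier_basis P k))"
  proof -
    have "L2_inner t (\<lambda>x. \<Sum>k\<in>K. c k * fourier_basis P k x)
        = (\<Sum>k\<in>K. L2_inner t (\<lambda>x. c k * fourier_basis P k x))"
      by (rule L2_inner_sum_right) (auto simp: tL2 L2_cmult fourier_basis_L2)
    then show ?thesis by (simp add: L2_inner_cmult_right flip: t_eq)
  qed
  also have "\<dots> = of_real (\<Sum>k\<in>K. (cmod (c k))\<^sup>2)"
    by (simp add: coeff mult.commute complex_norm_square del: of_real_power)
  finally have "(L2_norm t)\<^sup>2 = (\<Sum>k\<in>K. (cmod (c k))\<^sup>2)"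
    unfolding L2_inner_self of_real_eq_iff .
  moreover have "((\<lambda>l. (cmod (L2_inner t (fourier_basis P l)))\<^sup>2) has_sum (\<Sum>k\<in>K. (cmod (c k))\<^sup>2)) UNIV"
    by (rule has_sum_finite_neutralI[OF K]) (auto simp: coeff)
  ultimately show ?thesis by simp
qed

section \<open>Mean-square density of the characters on one period\<close>

lemma AE_continuous_approximation:
  fixes f :: "real \<Rightarrow> complex"
  assumes "f \<in> borel_measurable borel"
  obtains g where "\<And>n::nat. continuous_on UNIV (g n)" "AE x in lborel. (\<lambda>n. g n x) \<longlonglongrightarrow> f x"
proof -
  have "f \<in> borel_measurable lebesgue"
    using assms by (simp add: measurable_completion)
  then have "f measurable_on UNIV"
    by (rule lebesgue_measurable_imp_measurable_on) simp
  then obtain N g where N: "negligible N" and g: "\<And>n. continuous_on UNIV (g n)"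
    "\<And>x. x \<notin> N \<Longrightarrow> (\<lambda>n. g n x) \<longlonglongrightarrow> f x"
    by (auto simp: measurable_on_def)
  have "AE x in lebesgue. x \<notin> N"
    using N by (simp add: negligible_iff_null_sets AE_not_in)
  then have "AE x in lborel. x \<notin> N"
    by (simp add: AE_completion_iff)
  then have "AE x in lborel. (\<lambda>n. g n x) \<longlonglongrightarrow> f x"
    by eventually_elim (rule g)
  with g(1) show ?thesis by (rule that)
qed

text \<open>Continuous functions converging to \<open>f\<close> almost everywhere need neither be
  dominated nor vanish at the ends of the period. A plateau factor and a radial truncation repair
  both, so dominated convergence applies. Vanishing at both ends later provides equal boundary
  values.\<close>

lemma continuous_dense_bounded:
  fixes f :: "real \<Rightarrow> complex"
  assumes P: "P > 0" and f: "f \<in> borel_measurable borel" "\<And>x. cmod (f x) \<le> B" "\<And>x. x \<notin> {0..<P} \<Longrightarrow> f x = 0"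
    and d: "d > 0"
  obtains h where "continuous_on UNIV h" "\<And>x. x \<notin> {0<..<P} \<Longrightarrow> h x = 0" "L2_norm (\<lambda>x. h x - f x) < d"
proof -
  obtain g where g: "\<And>n::nat. continuous_on UNIV (g n)" "AE x in lborel. (\<lambda>n. g n x) \<longlonglongrightarrow> f x"
    using AE_continuous_approximation[OF f(1)] by blast
  \<comment> \<open>Strictly above the bound of \<open>f\<close>, so truncation at height
    \<open>C\<close> leaves the limit untouched; \<open>C\<close> is also positive, as the quotient
    in \<open>h\<close> requires.\<close>
  define C where "C = \<bar>B\<bar> + 1"
  have C: "C > 0" "cmod (f x) < C" for x
    using f(2)[of x] by (auto simp: C_def)
  \<comment> \<open>A trapezoid: zero outside the open cell, of slope \<open>n\<close> at both ends,
    and eventually 1 at each interior point.\<close>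
  define u where "u n x = max 0 (min 1 (real n * min x (P - x)))" for n x
  define h where "h n x = of_real (u n x * (C / max C (cmod (g n x)))) * g n x" for n x
  have cont: "continuous_on UNIV (h n)" for n
    unfolding h_def u_def using C(1) by (intro continuous_intros g(1)) auto
  have zero: "h n x = 0" if "x \<notin> {0<..<P}" for n x
  proof -
    have "min x (P - x) \<le> 0" using that by auto
    then have "real n * min x (P - x) \<le> 0" by (simp add: mult_nonneg_nonpos)
    then show ?thesis by (simp add: h_def u_def)
  qed
  have "(\<lambda>n. L2_norm (\<lambda>x. h n x - f x)) \<longlonglongrightarrow> 0"
  proof (rule L2_tendsto_dominated)
    show "(\<lambda>x. indicator {0..<P} x * of_real C) \<in> L2"
      by (rule L2_indicator_bounded[where C = "C"]) (use C in auto)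
    show "f \<in> borel_measurable borel" by (rule f(1))
    show "cmod (f x) \<le> cmod (indicator {0..<P} x * of_real C)" for x
      using C(2)[of x] f(3)[of x] C(1) by (cases "x \<in> {0..<P}") (auto simp: norm_mult)
    show "h n \<in> borel_measurable borel" for n
      using cont by (rule borel_measurable_continuous_onI)
    show "cmod (h n x) \<le> cmod (indicator {0..<P} x * of_real C)" for n x
    proof (cases "x \<in> {0..<P}")
      case True
      have "cmod (h n x) = u n x * (C / max C (cmod (g n x)) * cmod (g n x))"
        using C(1) by (simp add: h_def norm_mult norm_divide u_def)
      also have "\<dots> \<le> 1 * C"
        using C(1) by (intro mult_mono) (auto simp: u_def field_simps max_def)
      finally show ?thesis using True C(1) by simp
    next
      case False
      then show ?thesis using zero[of x n] by auto
    qed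
    show "AE x in lborel. (\<lambda>n. h n x) \<longlonglongrightarrow> f x"
      using g(2) AE_lborel_singleton[of 0]
    proof eventually_elim
      case (elim x)
      show ?case
      proof (cases "x \<in> {0<..<P}")
        case True
        then have m: "min x (P - x) > 0" by auto
        obtain N where N: "1 / min x (P - x) < real N" using reals_Archimedean2 by blast
        have "u n x = 1" if "n \<ge> N" for n
        proof -
          have "1 / min x (P - x) < real n" using N that by simp
          then have "1 < real n * min x (P - x)" using m by (simp add: divide_less_eq)
          then show ?thesis by (simp add: u_def)
        qed
        then have "(\<lambda>n. u n x) \<longlonglongrightarrow> 1"
          by (intro tendsto_eventually eventually_sequentiallyI[of N]) auto
        then have "(\<lambda>n. h n x) \<longlonglongrightarrow> of_real (1 * (C / max C (cmod (f x)))) * f x"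
          unfolding h_def using C(1) elim by (intro tendsto_intros) auto
        then show ?thesis using C(2)[of x] C(1) by (simp add: max_def)
      next
        case False
        then show ?thesis using zero[of x] f(3)[of x] elim by auto
      qed
    qed
  qed
  then have "\<forall>\<^sub>F n in sequentially. L2_norm (\<lambda>x. h n x - f x) < d"
    using d by (rule order_tendstoD)
  then obtain n where "L2_norm (\<lambda>x. h n x - f x) < d"
    by (auto simp: eventually_sequentially)
  with cont zero show ?thesis using that by blast
qed

lemma L2_norm_le_bounded_support:
  assumes "P > 0" "f \<in> borel_measurable borel" "\<And>x. cmod (f x) \<le> e" "\<And>x. x \<notin> {0..<P} \<Longrightarrow> f x = 0"
  shows "L2_norm f \<le> e * sqrt P"
proof -
  have e: "e \<ge> 0" using assms(3)[of 0] norm_ge_zero order_trans by blast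
  have "(LINT x|lborel. (cmod (f x))\<^sup>2) \<le> (LINT x|lborel. e\<^sup>2 * indicator {0..<P} x)"
  proof (rule integral_mono')
    show "integrable lborel (\<lambda>x. e\<^sup>2 * indicator {0..<P} x)"
      by (intro integrable_mult_right integrable_real_indicator) auto
    show "(cmod (f x))\<^sup>2 \<le> e\<^sup>2 * indicator {0..<P} x" for x
      using assms(3)[of x] assms(4)[of x] by (cases "x \<in> {0..<P}") (auto intro: power_mono)
  qed auto
  also have "\<dots> = e\<^sup>2 * P"
    using assms(1) by simp
  finally show ?thesis
    unfolding L2_norm_def using e by (intro real_le_lsqrt) (auto simp: power_mult_distrib assms(1) less_imp_le)
qed

definition L2_supported :: "real \<Rightarrow> (real \<Rightarrow> complex) set" where
  "L2_supported P = {f \<in> L2. \<forall>x. x \<notin> {0..<P} \<longrightarrow> f x = 0}"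

lemma fourier_span_dense:
  assumes P: "P > 0" and f: "f \<in> L2_supported P" and d: "d > 0"
  shows "\<exists>t\<in>fourier_span P. L2_norm (\<lambda>x. f x - t x) < d"
proof -
  have fL2: "f \<in> L2" and [measurable]: "f \<in> borel_measurable borel"
    and supp: "\<And>x. x \<notin> {0..<P} \<Longrightarrow> f x = 0"
    using f by (auto simp: L2_supported_def)
  let ?b = "clip f"
  have bL2: "?b n \<in> L2" for n
    by (rule clip_L2(1)[OF fL2])
  have "\<forall>\<^sub>F n in sequentially. L2_norm (\<lambda>x. ?b n x - f x) < d / 3"
    using d by (intro order_tendstoD(2)[OF clip_tendsto_L2[OF fL2]]) simp
  then obtain n where n: "L2_norm (\<lambda>x. ?b n x - f x) < d / 3"
    by (auto simp: eventually_sequentially)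
  obtain h where h: "continuous_on UNIV h" "\<And>x. x \<notin> {0<..<P} \<Longrightarrow> h x = 0"
    "L2_norm (\<lambda>x. h x - ?b n x) < d / 3"
  proof (rule continuous_dense_bounded[OF P])
    show "cmod (?b n x) \<le> real n" for x by (simp add: clip_def)
    show "?b n x = 0" if "x \<notin> {0..<P}" for x using supp[OF that] by (simp add: clip_def)
    show "?b n \<in> borel_measurable borel" "d / 3 > 0" using d by auto
  qed blast
  have [measurable]: "h \<in> borel_measurable borel"
    using h(1) by (rule borel_measurable_continuous_onI)
  \<comment> \<open>A uniform error \<open>e\<close> on an interval of length \<open>P\<close> costs
    at most \<open>e * sqrt P = d / 6\<close> in norm, less than the third allotted to this
    approximation.\<close>
  define e where "e = d / (6 * sqrt P)"
  have "e > 0" using d P by (simp add: e_def)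
  moreover have "continuous_on {0..P} h" using h(1) continuous_on_subset by blast
  moreover have "h 0 = h P" using h(2)[of 0] h(2)[of P] by simp
  ultimately obtain t where t: "trig_polynomial P t" "\<And>x. x \<in> {0..P} \<Longrightarrow> cmod (h x - t x) < e"
    using trig_polynomial_dense_continuous[OF P] by metis
  define u where "u x = indicator {0..<P} x * t x" for x
  have u: "u \<in> fourier_span P"
    unfolding u_def by (rule trig_polynomial_in_span[OF P t(1)])
  then have uL2: "u \<in> L2"
    unfolding fourier_span_def by (auto intro!: L2_sum L2_cmult fourier_basis_L2)
  have hL2: "h \<in> L2"
  proof -
    have "compact (h ` {0..P})"
      using \<open>continuous_on {0..P} h\<close> by (intro compact_continuous_image) auto
    then obtain B where B: "\<And>x. x \<in> {0..P} \<Longrightarrow> cmod (h x) \<le> B"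
      using bounded_iff compact_imp_bounded by (metis imageI)
    have "cmod (h x) \<le> \<bar>B\<bar>" for x
      using B[of x] h(2)[of x] by (cases "x \<in> {0..P}") auto
    then have "(\<lambda>x. indicator {0..<P} x * h x) \<in> L2"
      by (intro L2_indicator_bounded) auto
    moreover have "(\<lambda>x. indicator {0..<P} x * h x) = h"
    proof
      fix x show "indicator {0..<P} x * h x = h x"
        using h(2)[of x] by (cases "x \<in> {0..<P}") auto
    qed
    ultimately show ?thesis by simp
  qed
  have "L2_norm (\<lambda>x. h x - u x) \<le> e * sqrt P"
  proof (rule L2_norm_le_bounded_support[OF P])
    show "(\<lambda>x. h x - u x) \<in> borel_measurable borel"
      using uL2 by measurable
    show "h x - u x = 0" if "x \<notin> {0..<P}" for x
      using that h(2)[of x] by (simp add: u_def)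
    then show "cmod (h x - u x) \<le> e" for x
      using t(2)[of x] \<open>e > 0\<close> by (cases "x \<in> {0..<P}") (auto simp: u_def intro: less_imp_le)
  qed
  also have "\<dots> < d / 3"
    using P d by (simp add: e_def)
  finally have "L2_norm (\<lambda>x. h x - u x) < d / 3" .
  moreover have "L2_norm (\<lambda>x. f x - u x) \<le> L2_norm (\<lambda>x. f x - ?b n x) + L2_norm (\<lambda>x. ?b n x - u x)"
    by (rule L2_norm_triangle_diff[OF fL2 bL2 uL2])
  moreover have "L2_norm (\<lambda>x. ?b n x - u x) \<le> L2_norm (\<lambda>x. ?b n x - h x) + L2_norm (\<lambda>x. h x - u x)"
    by (rule L2_norm_triangle_diff[OF bL2 hL2 uL2])
  ultimately have "L2_norm (\<lambda>x. f x - u x) < d"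
    using n h(3) by (simp add: L2_norm_minus_commute[of f] L2_norm_minus_commute[of "?b n" h])
  with u show ?thesis by blast
qed

theorem Fourier_series_Parseval:
  assumes P: "P > 0" and f: "f \<in> L2" "\<And>x. x \<notin> {0..<P} \<Longrightarrow> f x = 0"
  shows "((\<lambda>l::int. (cmod (LINT x|lborel. f x * cis (2 * pi * of_int l * x / P)))\<^sup>2) has_sum P * (L2_norm f)\<^sup>2) UNIV"
proof -
  have "((\<lambda>l. (cmod (L2_inner f (fourier_basis P l)))\<^sup>2) has_sum (L2_norm f)\<^sup>2) UNIV"
  proof (rule Parseval_from_dense[where V = "L2_supported P" and D = "fourier_span P"])
    show "fourier_span P \<subseteq> L2_supported P"
    proof
      fix t assume "t \<in> fourier_span P"
      then obtain K c where t: "t = (\<lambda>x. \<Sum>k\<in>K. c k * fourier_basis P k x)"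
        by (auto simp: fourier_span_def)
      have "t \<in> L2"
        unfolding t by (intro L2_sum L2_cmult fourier_basis_L2)
      moreover have "t x = 0" if "x \<notin> {0..<P}" for x
        using that by (simp add: t fourier_basis_def)
      ultimately show "t \<in> L2_supported P" by (simp add: L2_supported_def)
    qed
  qed (use f in \<open>auto simp: fourier_basis_L2 L2_supported_def L2_diff
      intro: fourier_span_dense[OF P, unfolded L2_supported_def] Parseval_fourier_span[OF P]\<close>)
  \<comment> \<open>The inner product conjugates the basis function, so the index is negated to
    reach the positive exponent of the claim; the factor \<open>P\<close> undoes the normalisation
    by \<open>sqrt P\<close>.\<close>
  then have "((\<lambda>l. P * (cmod (L2_inner f (fourier_basis P (- l))))\<^sup>2) has_sum P * (L2_norm f)\<^sup>2) UNIV"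
    by (intro has_sum_cmult_right) (simp add: has_sum_reindex_bij_witness[of UNIV uminus uminus UNIV])
  moreover have "P * (cmod (L2_inner f (fourier_basis P (- l))))\<^sup>2
      = (cmod (LINT x|lborel. f x * cis (2 * pi * of_int l * x / P)))\<^sup>2" for l
  proof -
    have "L2_inner f (fourier_basis P (- l)) = (LINT x|lborel. f x * cis (2 * pi * of_int l * x / P) / of_real (sqrt P))"
      unfolding L2_inner_def
      by (rule Bochner_Integration.integral_cong) (use f(2) in \<open>auto simp: fourier_basis_def cis_cnj indicator_def\<close>)
    then show ?thesis using P by (simp add: norm_divide power_divide)
  qed
  ultimately show ?thesis by simp
qed

text \<open>The bridge between real sums and counting measures: on the right-hand side sums may be
  exchanged with integrals before convergence is known, and finiteness of the result gives
  summability back.\<close>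

lemma has_sum_iff_nn_integral:
  fixes f :: "'a \<Rightarrow> real"
  assumes "\<And>x. x \<in> A \<Longrightarrow> f x \<ge> 0" "s \<ge> 0"
  shows "(f has_sum s) A \<longleftrightarrow> (\<integral>\<^sup>+x. ennreal (f x) \<partial>count_space A) = ennreal s"
proof
  assume s: "(f has_sum s) A"
  then have "f summable_on A" by (rule has_sum_imp_summable)
  then have "(\<lambda>x. norm (f x)) summable_on A"
    by (subst summable_on_cong[of _ _ f]) (use assms in auto)
  then have f: "Infinite_Set_Sum.abs_summable_on f A"
    by (simp flip: abs_summable_equivalent)
  have "(\<integral>\<^sup>+x. ennreal (f x) \<partial>count_space A) = ennreal (infsetsum f A)"
    by (rule nn_integral_conv_infsetsum[OF f assms(1)])
  also have "infsetsum f A = s"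
    using infsetsum_infsum[OF f] infsumI[OF s] by simp
  finally show "(\<integral>\<^sup>+x. ennreal (f x) \<partial>count_space A) = ennreal s" .
next
  assume s: "(\<integral>\<^sup>+x. ennreal (f x) \<partial>count_space A) = ennreal s"
  have "integrable (count_space A) f"
  proof (rule integrableI_nonneg)
    show "AE x in count_space A. 0 \<le> f x" using assms(1) by (auto simp: AE_count_space)
  qed (use s in auto)
  then have f: "Infinite_Set_Sum.abs_summable_on f A"
    by (simp add: Infinite_Set_Sum.abs_summable_on_def)
  then have "(\<lambda>x. norm (f x)) summable_on A"
    by (simp only: abs_summable_equivalent)
  then have "f summable_on A"
    by (subst summable_on_cong[of _ _ "\<lambda>x. norm (f x)"]) (use assms in auto)
  moreover have "infsum f A = s"
    using nn_integral_conv_infsetsum[OF f assms(1)] s assms infsetsum_nonneg[of A f]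
    by (simp flip: infsetsum_infsum[OF f])
  ultimately show "(f has_sum s) A"
    by (simp add: has_sum_iff)
qed

lemma floor_div_eq_iff:
  fixes P x :: real
  assumes "P > 0"
  shows "\<lfloor>x / P\<rfloor> = k \<longleftrightarrow> x - of_int k * P \<in> {0..<P}"
  using assms by (auto simp: floor_eq_iff field_simps)

text \<open>A character of period \<open>P\<close> takes the same values on all cells, so
  integrating \<open>f\<close> against it over the line amounts to integrating the folded function
  over one cell, where Parseval's identity applies. Finiteness of \<open>K\<close> makes the folded
  function a finite sum in \<open>L2\<close>.\<close>

lemma Fourier_series_Parseval_periodization:
  assumes P: "P > 0" and f: "f \<in> L2" and K: "finite K" "\<And>x. f x \<noteq> 0 \<Longrightarrow> \<lfloor>x / P\<rfloor> \<in> K"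
  shows "(\<integral>\<^sup>+l. ennreal ((cmod (LINT x|lborel. f x * cis (2 * pi * of_int l * x / P)))\<^sup>2) \<partial>count_space (UNIV :: int set))
    = ennreal P * (\<integral>\<^sup>+x. ennreal ((cmod (\<Sum>k\<in>K. f (x + of_int k * P)))\<^sup>2) * indicator {0..<P} x \<partial>lborel)"
proof -
  define h where "h x = (\<Sum>k\<in>K. indicator {0..<P} x * f (x + of_int k * P))" for x
  have [measurable]: "f \<in> borel_measurable borel" using f by measurable
  have pieces: "(\<lambda>x. indicator {0..<P} x * f (x + of_int k * P)) \<in> L2" for k
    by (rule L2_mult_bounded[OF L2_translate[OF f], where C = 1]) (auto simp: indicator_def)
  have h: "h \<in> L2"
    unfolding h_def by (intro L2_sum pieces)
  have h_eq: "h x = indicator {0..<P} x * (\<Sum>k\<in>K. f (x + of_int k * P))" for x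
    by (simp add: h_def sum_distrib_left)
  have coeff: "(LINT x|lborel. h x * cis (2 * pi * of_int l * x / P))
      = (LINT x|lborel. f x * cis (2 * pi * of_int l * x / P))" for l :: int
  proof -
    define c where "c x = cis (2 * pi * of_int l * x / P)" for x
    have c: "c (x + of_int k * P) = c x" for k :: int and x
    proof -
      have "c (x + of_int k * P) = cis (2 * pi * of_int l * x / P + 2 * pi * of_int (l * k))"
        unfolding c_def using P by (intro arg_cong[of _ _ cis]) (simp add: field_simps)
      then show ?thesis
        by (simp only: cis_mult[symmetric] cis_multiple_2pi Ints_of_int c_def mult_1_right)
    qed
    have [measurable]: "c \<in> borel_measurable borel"
      unfolding c_def by measurable
    \<comment> \<open>The integrand restricted to cell \<open>k\<close>, in its original place; at
      each point only the cell containing that point contributes.\<close>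
    define I where "I k x = indicator {0..<P} (x - of_int k * P) * (f x * c x)" for k :: int and x
    have gL2: "(\<lambda>x. indicator {0..<P} x * f (x + of_int k * P) * c x) = (\<lambda>x. I k (of_int k * P + 1 * x))" for k :: int
      by (auto simp: I_def fun_eq_iff c add.commute[of "of_int k * P"])
    have int: "integrable lborel (\<lambda>x. indicator {0..<P} x * f (x + of_int k * P) * c x)" for k
    proof -
      have "integrable lborel (\<lambda>x. (indicator {0..<P} x * f (x + of_int k * P)) * (indicator {0..<P} x * c x))"
        by (intro L2_integrable_mult pieces L2_indicator_bounded[where C = 1]) (auto simp: c_def)
      then show ?thesis
        by (rule back_subst[of "integrable lborel"]) (auto simp: indicator_def)
    qed
    have int_I: "integrable lborel (I k)" for k
      using int[of k] unfolding gL2 by (subst (asm) lborel_integrable_real_affine_iff) auto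
    have "(LINT x|lborel. h x * c x) = (LINT x|lborel. (\<Sum>k\<in>K. indicator {0..<P} x * f (x + of_int k * P) * c x))"
      by (simp add: h_def sum_distrib_right)
    also have "\<dots> = (\<Sum>k\<in>K. LINT x|lborel. indicator {0..<P} x * f (x + of_int k * P) * c x)"
      by (intro Bochner_Integration.integral_sum int)
    also have "\<dots> = (\<Sum>k\<in>K. LINT x|lborel. I k x)"
      unfolding gL2 using lborel_integral_real_affine[of 1 "I _"] by simp
    also have "\<dots> = (LINT x|lborel. (\<Sum>k\<in>K. I k x))"
      by (intro Bochner_Integration.integral_sum[symmetric] int_I)
    also have "\<dots> = (LINT x|lborel. f x * c x)"
    proof (rule Bochner_Integration.integral_cong[OF refl])
      fix x
      have "(\<Sum>k\<in>K. I k x) = (\<Sum>k\<in>K. if k = \<lfloor>x / P\<rfloor> then f x * c x else 0)"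
      proof (rule sum.cong[OF refl])
        fix k
        show "I k x = (if k = \<lfloor>x / P\<rfloor> then f x * c x else 0)"
          using floor_div_eq_iff[OF P, of x k] unfolding I_def indicator_def
          by (cases "k = \<lfloor>x / P\<rfloor>") auto
      qed
      also have "\<dots> = f x * c x"
        using K by (auto simp: sum.delta)
      finally show "(\<Sum>k\<in>K. I k x) = f x * c x" .
    qed
    finally show ?thesis by (simp add: c_def)
  qed
  have "((\<lambda>l::int. (cmod (LINT x|lborel. h x * cis (2 * pi * of_int l * x / P)))\<^sup>2) has_sum P * (L2_norm h)\<^sup>2) UNIV"
    by (rule Fourier_series_Parseval[OF P h]) (simp add: h_eq)
  then have "(\<integral>\<^sup>+l. ennreal ((cmod (LINT x|lborel. f x * cis (2 * pi * of_int l * x / P)))\<^sup>2) \<partial>count_space (UNIV :: int set))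
      = ennreal (P * (L2_norm h)\<^sup>2)"
    using P by (subst (asm) has_sum_iff_nn_integral) (auto simp: coeff)
  also have "\<dots> = ennreal P * (\<integral>\<^sup>+x. ennreal ((cmod (h x))\<^sup>2) \<partial>lborel)"
    using P by (simp add: ennreal_mult L2_norm_square_nn_integral[OF h])
  also have "(\<integral>\<^sup>+x. ennreal ((cmod (h x))\<^sup>2) \<partial>lborel)
      = (\<integral>\<^sup>+x. ennreal ((cmod (\<Sum>k\<in>K. f (x + of_int k * P)))\<^sup>2) * indicator {0..<P} x \<partial>lborel)"
    by (intro nn_integral_cong) (simp add: h_eq indicator_def)
  finally show ?thesis .
qed

section \<open>The Plancherel theorem\<close>

text \<open>Every real number lies in exactly one translate of the cell; the rest is Tonelli and
  translation invariance.\<close>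

lemma nn_integral_periodization:
  fixes f :: "real \<Rightarrow> ennreal"
  assumes P: "P > 0" and [measurable]: "f \<in> borel_measurable borel"
  shows "(\<integral>\<^sup>+x. f x \<partial>lborel)
    = (\<integral>\<^sup>+x. (\<integral>\<^sup>+k. f (x + of_int k * P) \<partial>count_space (UNIV :: int set)) * indicator {0..<P} x \<partial>lborel)"
proof -
  have "(\<integral>\<^sup>+x. (\<integral>\<^sup>+k. f (x + of_int k * P) \<partial>count_space (UNIV :: int set)) * indicator {0..<P} x \<partial>lborel)
      = (\<integral>\<^sup>+x. (\<integral>\<^sup>+k. f (x + of_int k * P) * indicator {0..<P} x \<partial>count_space (UNIV :: int set)) \<partial>lborel)"
    by (simp add: nn_integral_multc)
  also have "\<dots> = (\<integral>\<^sup>+k. (\<integral>\<^sup>+x. f (x + of_int k * P) * indicator {0..<P} x \<partial>lborel) \<partial>count_space (UNIV :: int set))"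
    by (rule nn_integral_count_space_nn_integral) auto
  also have "\<dots> = (\<integral>\<^sup>+k. (\<integral>\<^sup>+x. f x * indicator {0..<P} (x - of_int k * P) \<partial>lborel) \<partial>count_space (UNIV :: int set))"
  proof (rule nn_integral_cong)
    fix k :: int
    show "(\<integral>\<^sup>+x. f (x + of_int k * P) * indicator {0..<P} x \<partial>lborel)
        = (\<integral>\<^sup>+x. f x * indicator {0..<P} (x - of_int k * P) \<partial>lborel)"
      by (subst nn_integral_real_affine[where c = 1 and t = "of_int k * P"]) (simp_all add: add.commute)
  qed
  also have "\<dots> = (\<integral>\<^sup>+x. (\<integral>\<^sup>+k. f x * indicator {0..<P} (x - of_int k * P) \<partial>count_space (UNIV :: int set)) \<partial>lborel)"
    by (rule nn_integral_count_space_nn_integral[symmetric]) auto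
  also have "\<dots> = (\<integral>\<^sup>+x. f x \<partial>lborel)"
  proof (rule nn_integral_cong)
    fix x
    have "(\<integral>\<^sup>+k. f x * indicator {0..<P} (x - of_int k * P) \<partial>count_space (UNIV :: int set))
        = (\<integral>\<^sup>+k. f x * indicator {\<lfloor>x / P\<rfloor>} k \<partial>count_space (UNIV :: int set))"
      by (intro nn_integral_cong) (auto simp: indicator_def floor_div_eq_iff[OF P, of x, symmetric] simp del: atLeastLessThan_iff)
    then show "(\<integral>\<^sup>+k. f x * indicator {0..<P} (x - of_int k * P) \<partial>count_space (UNIV :: int set)) = f x"
      by (simp add: nn_integral_cmult)
  qed
  finally show ?thesis ..
qed

section \<open>Plancherel's identity for integrable functions in L2\<close>

lemma borel_measurable_fourier_L1 [measurable]:
  assumes [measurable]: "f \<in> borel_measurable borel"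
  shows "fourier_L1 f \<in> borel_measurable borel"
  unfolding fourier_L1_def by measurable

lemma integrable_mult_cis:
  assumes "integrable lborel f" and [measurable]: "h \<in> borel_measurable borel"
  shows "integrable lborel (\<lambda>x. f x * cis (h x))"
proof (rule Bochner_Integration.integrable_bound[OF assms(1)])
  have [measurable]: "f \<in> borel_measurable borel" using assms(1) by measurable
  show "(\<lambda>x. f x * cis (h x)) \<in> borel_measurable lborel" by measurable
qed (simp add: norm_mult)

lemma fourier_L1_diff:
  "integrable lborel f \<Longrightarrow> integrable lborel g \<Longrightarrow> fourier_L1 (\<lambda>x. f x - g x) w = fourier_L1 f w - fourier_L1 g w"
  by (simp add: fourier_L1_def ring_distribs integrable_mult_cis)

lemma fourier_L1_time_frequency_shift:
  "fourier_L1 (\<lambda>x. f (x - a) * cis (2 * pi * b * x)) w = cis (2 * pi * (b - w) * a) * fourier_L1 f (w - b)"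
proof -
  have "fourier_L1 (\<lambda>x. f (x - a) * cis (2 * pi * b * x)) w
      = (LINT x|lborel. f (a + 1 * x - a) * cis (2 * pi * b * (a + 1 * x)) * cis (- 2 * pi * (a + 1 * x) * w))"
    unfolding fourier_L1_def by (subst lborel_integral_real_affine[where c = 1 and t = a]) simp_all
  also have "\<dots> = (LINT x|lborel. cis (2 * pi * (b - w) * a) * (f x * cis (- 2 * pi * x * (w - b))))"
  proof (rule Bochner_Integration.integral_cong[OF refl])
    fix x
    have "cis (2 * pi * b * (a + 1 * x)) * cis (- 2 * pi * (a + 1 * x) * w)
        = cis (2 * pi * (b - w) * a) * cis (- 2 * pi * x * (w - b))"
      unfolding cis_mult by (rule arg_cong[of _ _ cis]) (simp add: algebra_simps)
    then show "f (a + 1 * x - a) * cis (2 * pi * b * (a + 1 * x)) * cis (- 2 * pi * (a + 1 * x) * w)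
        = cis (2 * pi * (b - w) * a) * (f x * cis (- 2 * pi * x * (w - b)))"
      by (simp add: mult.assoc mult.left_commute)
  qed
  finally show ?thesis by (simp add: fourier_L1_def)
qed

lemma L2_time_frequency_shift: "f \<in> L2 \<Longrightarrow> (\<lambda>x. f (x - a) * cis (b * x)) \<in> L2"
  using L2_mult_bounded[OF L2_translate[of f "- a"], of "\<lambda>x. cis (b * x)" 1] by (simp add: mult.commute)

lemma L2_norm_mult_cis: "L2_norm (\<lambda>x. f x * cis (h x)) = L2_norm f"
  by (simp add: L2_norm_def norm_mult)

lemma L2_bounded_support_integrable:
  assumes "f \<in> L2" "\<And>x. x \<notin> {a..<b} \<Longrightarrow> f x = 0"
  shows "integrable lborel f"
proof -
  have "(\<lambda>x. indicator {a..<b} x * 1) \<in> L2"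
    by (rule L2_indicator_bounded[where C = 1]) auto
  then have "integrable lborel (\<lambda>x. f x * (indicator {a..<b} x * 1))"
    by (rule L2_integrable_mult[OF assms(1)])
  moreover have "(\<lambda>x. f x * (indicator {a..<b} x * 1)) = f"
    using assms(2) by (auto simp: fun_eq_iff indicator_def)
  ultimately show ?thesis by simp
qed

text \<open>
  On \<open>[0, T)\<close> Parseval's identity for the series of \<open>x \<mapsto> f x * cis (2 * pi * s * x)\<close> expresses
  the norm of \<open>f\<close> by the values of its transform on a translate of the lattice \<open>\<int>/T\<close>; integrating
  over the translation parameter gives Plancherel's identity.
\<close>

lemma Plancherel_nn_integral_interval:
  assumes T: "T > 0" and f: "f \<in> L2" "\<And>x. x \<notin> {0..<T} \<Longrightarrow> f x = 0"
  shows "(\<integral>\<^sup>+w. ennreal ((cmod (fourier_L1 f w))\<^sup>2) \<partial>lborel) = ennreal ((L2_norm f)\<^sup>2)"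
proof -
  have [measurable]: "f \<in> borel_measurable borel" using f by measurable
  \<comment> \<open>The argument is negated because the series has a positive exponent and the
    transform a negative one.\<close>
  define G where "G w = ennreal ((cmod (fourier_L1 f (- w)))\<^sup>2)" for w
  have [measurable]: "G \<in> borel_measurable borel"
    unfolding G_def by measurable
  have fiber: "(\<integral>\<^sup>+l. G (s + of_int l * (1 / T)) \<partial>count_space (UNIV :: int set)) = ennreal (T * (L2_norm f)\<^sup>2)" for s
  proof -
    define fs where "fs x = f x * cis (2 * pi * s * x)" for x
    have "fs \<in> L2"
      unfolding fs_def using L2_time_frequency_shift[OF f(1), of 0 "2 * pi * s"] by simp
    then have "((\<lambda>l::int. (cmod (LINT x|lborel. fs x * cis (2 * pi * of_int l * x / T)))\<^sup>2) has_sum T * (L2_norm fs)\<^sup>2) UNIV"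
      by (rule Fourier_series_Parseval[OF T]) (simp add: fs_def f(2))
    moreover have "(LINT x|lborel. fs x * cis (2 * pi * of_int l * x / T)) = fourier_L1 f (- (s + of_int l * (1 / T)))" for l :: int
    proof -
      have "cis (2 * pi * s * x) * cis (2 * pi * of_int l * x / T) = cis (- 2 * pi * x * (- (s + of_int l * (1 / T))))" for x
        unfolding cis_mult by (rule arg_cong[of _ _ cis]) (simp add: algebra_simps)
      then show ?thesis by (simp only: fourier_L1_def fs_def mult.assoc)
    qed
    ultimately have "((\<lambda>l::int. (cmod (fourier_L1 f (- (s + of_int l * (1 / T)))))\<^sup>2) has_sum T * (L2_norm fs)\<^sup>2) UNIV"
      by simp
    then show ?thesis
      using T by (subst (asm) has_sum_iff_nn_integral) (auto simp: G_def fs_def[abs_def] L2_norm_mult_cis)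
  qed
  have "(\<integral>\<^sup>+w. ennreal ((cmod (fourier_L1 f w))\<^sup>2) \<partial>lborel) = (\<integral>\<^sup>+w. G w \<partial>lborel)"
    unfolding G_def by (subst nn_integral_real_affine[where c = "-1" and t = 0]) simp_all
  \<comment> \<open>The lattice dual to the period \<open>T\<close> has cells of length
    \<open>1 / T\<close>, which will cancel the factor \<open>T\<close> from the series.\<close>
  also have "\<dots> = (\<integral>\<^sup>+s. ennreal (T * (L2_norm f)\<^sup>2) * indicator {0..<1 / T} s \<partial>lborel)"
    using T by (subst nn_integral_periodization[where P = "1 / T"]) (simp_all only: fiber, simp_all)
  also have "\<dots> = ennreal (T * (L2_norm f)\<^sup>2) * ennreal (1 / T)"
    using T by (simp add: nn_integral_cmult)
  also have "\<dots> = ennreal ((L2_norm f)\<^sup>2)"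
    using T by (subst ennreal_mult[symmetric]) auto
  finally show ?thesis .
qed

text \<open>Translating the support into \<open>{0..<2 * T}\<close> multiplies the transform by a
  unimodular factor, so neither norm changes.\<close>

lemma Plancherel_bounded_support:
  assumes T: "T > 0" and f: "f \<in> L2" "\<And>x. x \<notin> {-T..<T} \<Longrightarrow> f x = 0"
  shows "fourier_L1 f \<in> L2" "L2_norm (fourier_L1 f) = L2_norm f"
proof -
  have [measurable]: "f \<in> borel_measurable borel" using f by measurable
  have shift: "(\<lambda>x. f (x - T)) \<in> L2" "L2_norm (\<lambda>x. f (x - T)) = L2_norm f"
    using L2_translate[OF f(1), of "- T"] L2_norm_translate[of f "- T"] by simp_all
  have "fourier_L1 (\<lambda>x. f (x - T)) w = cis (- (2 * pi * w * T)) * fourier_L1 f w" for w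
    using fourier_L1_time_frequency_shift[of f T 0 w] by simp
  then have eq: "cmod (fourier_L1 (\<lambda>x. f (x - T)) w) = cmod (fourier_L1 f w)" for w
    by (simp add: norm_mult)
  have "(\<integral>\<^sup>+w. ennreal ((cmod (fourier_L1 (\<lambda>x. f (x - T)) w))\<^sup>2) \<partial>lborel) = ennreal ((L2_norm (\<lambda>x. f (x - T)))\<^sup>2)"
    by (rule Plancherel_nn_integral_interval[where T = "2 * T"]) (use T f(2) shift in auto)
  then have nn: "(\<integral>\<^sup>+w. ennreal ((cmod (fourier_L1 f w))\<^sup>2) \<partial>lborel) = ennreal ((L2_norm f)\<^sup>2)"
    by (simp add: eq shift)
  then show L2: "fourier_L1 f \<in> L2"
    by (intro L2I_nn_integral) auto
  have "ennreal ((L2_norm (fourier_L1 f))\<^sup>2) = ennreal ((L2_norm f)\<^sup>2)"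
    by (simp add: L2_norm_square_nn_integral[OF L2] nn)
  then show "L2_norm (fourier_L1 f) = L2_norm f"
    by simp
qed

lemma clip_L1: "f \<in> L2 \<Longrightarrow> integrable lborel (clip f n)"
  using L2_bounded_support_integrable[OF clip_L2(1) clip_eq_0] by blast

lemma fourier_L1_clip_tendsto:
  assumes f: "integrable lborel f"
  shows "(\<lambda>n. fourier_L1 (clip f n) w) \<longlonglongrightarrow> fourier_L1 f w"
proof -
  have [measurable]: "f \<in> borel_measurable borel" using f by measurable
  show ?thesis
    unfolding fourier_L1_def
  proof (rule integral_dominated_convergence)
    show "integrable lborel (\<lambda>x. cmod (f x))" using f by simp
    show "AE x in lborel. (\<lambda>n. clip f n x * cis (- 2 * pi * x * w)) \<longlonglongrightarrow> f x * cis (- 2 * pi * x * w)"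
      by (intro AE_I2 tendsto_intros clip_tendsto)
    show "AE x in lborel. norm (clip f n x * cis (- 2 * pi * x * w)) \<le> cmod (f x)" for n
      by (intro AE_I2) (simp add: norm_mult cmod_clip_le)
  qed measurable
qed

lemma Plancherel_clip:
  assumes "f \<in> L2"
  shows "fourier_L1 (clip f n) \<in> L2" "L2_norm (fourier_L1 (clip f n)) = L2_norm (clip f n)"
proof -
  \<comment> \<open>\<open>Suc n\<close> instead of \<open>n\<close>, since the interval must have
    positive length for \<open>n = 0\<close> as well.\<close>
  have "clip f n x = 0" if "x \<notin> {- real (Suc n)..<real (Suc n)}" for x
    using that by (intro clip_eq_0) auto
  then show "fourier_L1 (clip f n) \<in> L2" "L2_norm (fourier_L1 (clip f n)) = L2_norm (clip f n)"
    using Plancherel_bounded_support[of "real (Suc n)" "clip f n"] clip_L2(1)[OF assms] by auto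
qed

text \<open>Pointwise convergence of the transforms of truncations yields only the inequality
  \<open>\<le>\<close> through Fatou. Applied to \<open>clip f n - f\<close>, this inequality bounds
  the error of the transforms by that of the truncations, which gives the reverse estimate.\<close>

theorem Plancherel_L1_L2:
  assumes f: "f \<in> L2" "integrable lborel f"
  shows "fourier_L1 f \<in> L2" "L2_norm (fourier_L1 f) = L2_norm f"
proof -
  have contraction: "fourier_L1 h \<in> L2 \<and> L2_norm (fourier_L1 h) \<le> L2_norm h"
    if h: "h \<in> L2" "integrable lborel h" for h
  proof -
    have [measurable]: "h \<in> borel_measurable borel" using h by measurable
    have "AE w in lborel. (\<lambda>n. fourier_L1 (clip h n) w) \<longlonglongrightarrow> fourier_L1 h w"
      by (intro AE_I2 fourier_L1_clip_tendsto h)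
    moreover have "\<forall>\<^sub>F n in sequentially. L2_norm (fourier_L1 (clip h n)) \<le> L2_norm h"
      by (simp add: Plancherel_clip(2)[OF h(1)] clip_L2(2)[OF h(1)])
    ultimately show ?thesis
      using L2_Fatou[of "\<lambda>n. fourier_L1 (clip h n)" "fourier_L1 h" "L2_norm h"] Plancherel_clip(1)[OF h(1)]
      by simp
  qed
  show L2: "fourier_L1 f \<in> L2" using contraction[OF f] by simp
  have le: "L2_norm (clip f n) \<le> L2_norm (fourier_L1 f) + L2_norm (\<lambda>x. clip f n x - f x)" for n
  proof -
    have "L2_norm (clip f n) \<le> L2_norm (fourier_L1 f) + L2_norm (\<lambda>w. fourier_L1 (clip f n) w - fourier_L1 f w)"
      unfolding Plancherel_clip(2)[OF f(1), symmetric]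
      by (rule L2_norm_le_add_diff[OF Plancherel_clip(1)[OF f(1)] L2])
    also have "(\<lambda>w. fourier_L1 (clip f n) w - fourier_L1 f w) = fourier_L1 (\<lambda>x. clip f n x - f x)"
      by (rule ext, rule fourier_L1_diff[symmetric]) (simp_all add: clip_L1 f)
    also have "L2_norm (fourier_L1 (\<lambda>x. clip f n x - f x)) \<le> L2_norm (\<lambda>x. clip f n x - f x)"
      using contraction[of "\<lambda>x. clip f n x - f x"] f clip_L1 clip_L2 L2_diff by simp
    finally show ?thesis by simp
  qed
  have "(\<lambda>n. L2_norm (clip f n)) \<longlonglongrightarrow> L2_norm f"
    by (rule L2_norm_tendsto[OF clip_L2(1)[OF f(1)] f(1) clip_tendsto_L2[OF f(1)]])
  moreover have "(\<lambda>n. L2_norm (fourier_L1 f) + L2_norm (\<lambda>x. clip f n x - f x)) \<longlonglongrightarrow> L2_norm (fourier_L1 f) + 0"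
    by (intro tendsto_intros clip_tendsto_L2 f)
  ultimately have "L2_norm f \<le> L2_norm (fourier_L1 f)"
    using LIMSEQ_le le by fastforce
  then show "L2_norm (fourier_L1 f) = L2_norm f"
    using contraction[OF f] by simp
qed

section \<open>Inverse transform and extension to all of L2\<close>

definition inverse_fourier_L1 :: "(real \<Rightarrow> complex) \<Rightarrow> real \<Rightarrow> complex" where
  "inverse_fourier_L1 F x = fourier_L1 F (- x)"

lemma inverse_fourier_L1_L2:
  assumes "F \<in> L2" "integrable lborel F"
  shows "inverse_fourier_L1 F \<in> L2" "L2_norm (inverse_fourier_L1 F) = L2_norm F"
  unfolding inverse_fourier_L1_def
  using L2_reflect L2_norm_reflect Plancherel_L1_L2[OF assms] by metis+

text \<open>Fubini applies because the modulus of the kernel is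
  \<open>cmod (F w) * cmod (h x)\<close>, a product of integrable functions.\<close>

lemma fourier_L1_adjoint:
  assumes h: "integrable lborel h" and F: "integrable lborel F"
  shows "L2_inner (inverse_fourier_L1 F) h = L2_inner F (fourier_L1 h)"
proof -
  have [measurable]: "h \<in> borel_measurable borel" "F \<in> borel_measurable borel"
    using h F by measurable
  define k where "k x w = F w * cis (2 * pi * w * x) * cnj (h x)" for x w
  have cnj_meas: "(\<lambda>x. cnj (h x)) \<in> borel_measurable borel"
    by (intro borel_measurable_continuous_on[OF continuous_on_cnj[OF continuous_on_id]]) measurable
  have int: "integrable (lborel \<Otimes>\<^sub>M lborel) (\<lambda>(x, w). k x w)"
  proof (rule lborel_pair.Fubini_integrable)
    show "(\<lambda>(x, w). k x w) \<in> borel_measurable (lborel \<Otimes>\<^sub>M lborel)"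
      unfolding k_def using cnj_meas by measurable
    have "(\<lambda>x. LINT w|lborel. norm (case (x, w) of (x, w) \<Rightarrow> k x w)) = (\<lambda>x. (LINT w|lborel. cmod (F w)) * cmod (h x))"
      by (simp add: k_def norm_mult)
    then show "integrable lborel (\<lambda>x. LINT w|lborel. norm (case (x, w) of (x, w) \<Rightarrow> k x w))"
      using h by simp
    show "AE x in lborel. integrable lborel (\<lambda>w. case (x, w) of (x, w) \<Rightarrow> k x w)"
      using F by (intro AE_I2) (simp add: k_def integrable_mult_cis)
  qed
  have "L2_inner (inverse_fourier_L1 F) h = (LINT x|lborel. (LINT w|lborel. k x w))"
    by (simp add: L2_inner_def inverse_fourier_L1_def fourier_L1_def k_def)
  also have "\<dots> = (LINT w|lborel. (LINT x|lborel. k x w))"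
    by (rule lborel_pair.Fubini_integral[OF int, symmetric])
  also have "\<dots> = (LINT w|lborel. F w * cnj (LINT x|lborel. h x * cis (- 2 * pi * x * w)))"
  proof (rule Bochner_Integration.integral_cong[OF refl])
    fix w
    have "(LINT x|lborel. k x w) = (LINT x|lborel. F w * cnj (h x * cis (- 2 * pi * x * w)))"
      by (rule Bochner_Integration.integral_cong[OF refl]) (simp add: k_def cis_cnj mult_ac)
    then show "(LINT x|lborel. k x w) = F w * cnj (LINT x|lborel. h x * cis (- 2 * pi * x * w))"
      by (simp only: Bochner_Integration.integral_cnj integral_mult_right_zero)
  qed
  finally show ?thesis by (simp add: L2_inner_def fourier_L1_def)
qed

text \<open>When both squares are expanded, the norms agree by Plancherel and the cross terms by
  adjointness. This is inversion in quantitative form: an \<open>F\<close> close to the transform of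
  \<open>h\<close> has an inverse transform close to \<open>h\<close>.\<close>

lemma inverse_fourier_L1_dist:
  assumes "h \<in> L2" "integrable lborel h" "F \<in> L2" "integrable lborel F"
  shows "L2_norm (\<lambda>x. inverse_fourier_L1 F x - h x) = L2_norm (\<lambda>w. F w - fourier_L1 h w)"
proof -
  have "(L2_norm (\<lambda>x. inverse_fourier_L1 F x - h x))\<^sup>2 = (L2_norm (\<lambda>w. F w - fourier_L1 h w))\<^sup>2"
    using assms
    by (simp add: L2_norm_square_diff inverse_fourier_L1_L2 Plancherel_L1_L2 fourier_L1_adjoint)
  then show ?thesis by (simp add: power2_eq_iff_nonneg)
qed

text \<open>By the isometry \<open>dist\<close> the transforms of the truncations form a Cauchy
  sequence, and completeness supplies \<open>g\<close>. Any other admissible sequence approaches the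
  truncations in norm, so its transforms have the same limit.\<close>

lemma is_fourier_L2_exists:
  assumes f: "f \<in> L2"
  shows "\<exists>g. is_fourier_L2 f g"
proof -
  have dist: "L2_norm (\<lambda>w. fourier_L1 h w - fourier_L1 k w) = L2_norm (\<lambda>x. h x - k x)"
    if "h \<in> L2" "integrable lborel h" "k \<in> L2" "integrable lborel k" for h k
  proof -
    have "(\<lambda>w. fourier_L1 h w - fourier_L1 k w) = fourier_L1 (\<lambda>x. h x - k x)"
      using that by (simp add: fourier_L1_diff fun_eq_iff)
    then show ?thesis
      using Plancherel_L1_L2(2)[of "\<lambda>x. h x - k x"] that by (simp add: L2_diff)
  qed
  define s where "s = (\<lambda>n. fourier_L1 (clip f n))"
  have s: "s n \<in> L2" for n
    unfolding s_def by (rule Plancherel_clip(1)[OF f])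
  have "\<exists>g\<in>L2. (\<lambda>n. L2_norm (\<lambda>x. s n x - g x)) \<longlonglongrightarrow> 0"
  proof (rule L2_complete[OF s])
    fix e :: real assume "e > 0"
    then have "\<forall>\<^sub>F n in sequentially. L2_norm (\<lambda>x. clip f n x - f x) < e / 2"
      by (intro order_tendstoD(2)[OF clip_tendsto_L2[OF f]]) simp
    then obtain N where N: "\<And>n. n \<ge> N \<Longrightarrow> L2_norm (\<lambda>x. clip f n x - f x) < e / 2"
      by (auto simp: eventually_sequentially)
    have "L2_norm (\<lambda>x. s m x - s n x) < e" if "m \<ge> N" "n \<ge> N" for m n
    proof -
      have "L2_norm (\<lambda>x. s m x - s n x) = L2_norm (\<lambda>x. clip f m x - clip f n x)"
        unfolding s_def by (intro dist clip_L1 clip_L2 f)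
      also have "\<dots> \<le> L2_norm (\<lambda>x. clip f m x - f x) + L2_norm (\<lambda>x. f x - clip f n x)"
        by (intro L2_norm_triangle_diff clip_L2 f)
      also have "\<dots> < e"
        using N[OF that(1)] N[OF that(2)] by (simp add: L2_norm_minus_commute[of f])
      finally show ?thesis .
    qed
    then show "\<exists>N. \<forall>m\<ge>N. \<forall>n\<ge>N. L2_norm (\<lambda>x. s m x - s n x) < e" by blast
  qed
  then obtain g where g: "g \<in> L2" "(\<lambda>n. L2_norm (\<lambda>x. s n x - g x)) \<longlonglongrightarrow> 0" by blast
  have "is_fourier_L2 f g"
    unfolding is_fourier_L2_def
  proof (intro conjI allI impI g(1))
    fix h :: "nat \<Rightarrow> real \<Rightarrow> complex"
    assume h: "\<forall>n. h n \<in> L2 \<and> integrable lborel (h n)"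
      and lim: "(\<lambda>n. L2_norm (\<lambda>x. h n x - f x)) \<longlonglongrightarrow> 0"
    show L2: "fourier_L1 (h n) \<in> L2" for n
      using h by (intro Plancherel_L1_L2) auto
    have le: "norm (L2_norm (\<lambda>w. fourier_L1 (h n) w - g w))
        \<le> L2_norm (\<lambda>x. h n x - f x) + L2_norm (\<lambda>x. clip f n x - f x) + L2_norm (\<lambda>x. s n x - g x)" for n
    proof -
      have "L2_norm (\<lambda>w. fourier_L1 (h n) w - g w)
          \<le> L2_norm (\<lambda>w. fourier_L1 (h n) w - s n w) + L2_norm (\<lambda>x. s n x - g x)"
        by (rule L2_norm_triangle_diff[OF L2 s g(1)])
      also have "L2_norm (\<lambda>w. fourier_L1 (h n) w - s n w) = L2_norm (\<lambda>x. h n x - clip f n x)"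
        unfolding s_def using h by (intro dist clip_L1 clip_L2 f) auto
      also have "\<dots> \<le> L2_norm (\<lambda>x. h n x - f x) + L2_norm (\<lambda>x. f x - clip f n x)"
        using h by (intro L2_norm_triangle_diff clip_L2 f) auto
      finally show ?thesis by (simp add: L2_norm_minus_commute[of f])
    qed
    have "(\<lambda>n. L2_norm (\<lambda>x. h n x - f x) + L2_norm (\<lambda>x. clip f n x - f x) + L2_norm (\<lambda>x. s n x - g x)) \<longlonglongrightarrow> 0 + 0 + 0"
      by (intro tendsto_intros lim g(2) clip_tendsto_L2 f)
    then have "(\<lambda>n. L2_norm (\<lambda>x. h n x - f x) + L2_norm (\<lambda>x. clip f n x - f x) + L2_norm (\<lambda>x. s n x - g x)) \<longlonglongrightarrow> 0"
      by simp
    then show "(\<lambda>n. L2_norm (\<lambda>w. fourier_L1 (h n) w - g w)) \<longlonglongrightarrow> 0"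
      by (rule Lim_null_comparison[OF always_eventually[OF allI[OF le]]])
  qed
  then show ?thesis by blast
qed

text \<open>The representative \<open>fourier f\<close> is arbitrary; it enters later arguments
  through membership in \<open>L2\<close> and through this limit along truncations.\<close>

lemma fourier_L2:
  assumes f: "f \<in> L2"
  shows "fourier f \<in> L2" "(\<lambda>n. L2_norm (\<lambda>w. fourier_L1 (clip f n) w - fourier f w)) \<longlonglongrightarrow> 0"
proof -
  have "is_fourier_L2 f (fourier f)"
    unfolding fourier_def using is_fourier_L2_exists[OF f] by (rule someI_ex)
  then show "fourier f \<in> L2" "(\<lambda>n. L2_norm (\<lambda>w. fourier_L1 (clip f n) w - fourier f w)) \<longlonglongrightarrow> 0"
    using clip_L2(1)[OF f] clip_L1[OF f] clip_tendsto_L2[OF f] unfolding is_fourier_L2_def by auto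
qed

lemma L2_norm_time_frequency_shift_diff:
  "L2_norm (\<lambda>x. f (x - a) * cis (h x) - g (x - a) * cis (h x)) = L2_norm (\<lambda>x. f x - g x)"
proof -
  have "L2_norm (\<lambda>x. f (x - a) * cis (h x) - g (x - a) * cis (h x))
      = L2_norm (\<lambda>x. (f (x - a) - g (x - a)) * cis (h x))"
    by (simp add: left_diff_distrib)
  also have "\<dots> = L2_norm (\<lambda>x. f x - g x)"
    using L2_norm_translate[of "\<lambda>x. f x - g x" "- a"] by (simp only: L2_norm_mult_cis) simp
  finally show ?thesis .
qed

text \<open>For truncations of \<open>f\<close> this is adjointness combined with the shift rule for
  integrals. Translations and modulations are isometries, so both sides are continuous in
  \<open>f\<close> and the identity survives the limit.\<close>

lemma L2_inner_time_frequency_shift: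
  assumes f: "f \<in> L2" and F: "F \<in> L2" "integrable lborel F"
  shows "L2_inner (inverse_fourier_L1 F) (\<lambda>x. f (x - a) * cis (2 * pi * b * x))
    = L2_inner F (\<lambda>w. cis (2 * pi * (b - w) * a) * fourier f (w - b))"
proof (rule LIMSEQ_unique)
  let ?S = "\<lambda>h x. h (x - a) * cis (2 * pi * b * x)"
  let ?T = "\<lambda>h w. h (w - b) * cis (2 * pi * (b - w) * a)"
  have T_L2: "?T h \<in> L2" if "h \<in> L2" for h
    using L2_mult_bounded[OF L2_translate[OF that, of "- b"], of "\<lambda>w. cis (2 * pi * (b - w) * a)" 1]
    by (simp add: mult.commute)
  show "(\<lambda>n. L2_inner (inverse_fourier_L1 F) (?S (clip f n))) \<longlonglongrightarrow> L2_inner (inverse_fourier_L1 F) (?S f)"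
    by (intro L2_inner_tendsto_right L2_time_frequency_shift clip_L2 f inverse_fourier_L1_L2 F)
      (simp only: L2_norm_time_frequency_shift_diff clip_tendsto_L2 f)
  have "(\<lambda>n. L2_inner F (?T (fourier_L1 (clip f n)))) \<longlonglongrightarrow> L2_inner F (?T (fourier f))"
    by (intro L2_inner_tendsto_right T_L2 Plancherel_clip f F fourier_L2)
      (subst L2_norm_time_frequency_shift_diff, rule fourier_L2(2)[OF f])
  moreover have "L2_inner F (?T (fourier_L1 (clip f n))) = L2_inner (inverse_fourier_L1 F) (?S (clip f n))" for n
  proof -
    have "integrable lborel (\<lambda>x. clip f n (- a + 1 * x))"
      by (intro lborel_integrable_real_affine clip_L1 f) simp
    then have "integrable lborel (?S (clip f n))"
      by (intro integrable_mult_cis) simp_all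
    then have "L2_inner (inverse_fourier_L1 F) (?S (clip f n)) = L2_inner F (fourier_L1 (?S (clip f n)))"
      by (rule fourier_L1_adjoint[OF _ F(2)])
    also have "fourier_L1 (?S (clip f n)) = ?T (fourier_L1 (clip f n))"
      by (rule ext) (subst fourier_L1_time_frequency_shift, rule mult.commute)
    finally show ?thesis ..
  qed
  moreover have "?T (fourier f) = (\<lambda>w. cis (2 * pi * (b - w) * a) * fourier f (w - b))"
    by (rule ext) (rule mult.commute)
  ultimately show "(\<lambda>n. L2_inner (inverse_fourier_L1 F) (?S (clip f n)))
      \<longlonglongrightarrow> L2_inner F (\<lambda>w. cis (2 * pi * (b - w) * a) * fourier f (w - b))"
    by (simp only:)
qed

text \<open>Truncate in time, transform, and truncate again in frequency;
  \<open>inverse_fourier_L1_dist\<close> brings the second error back to the time side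
  unchanged.\<close>

lemma inverse_fourier_L1_clip_dense:
  assumes f: "f \<in> L2" and d: "d > 0"
  shows "\<exists>F n. F \<in> L2 \<and> L2_norm (\<lambda>x. f x - inverse_fourier_L1 (clip F n) x) < d"
proof -
  have half: "d / 2 > 0" using d by simp
  obtain m where m: "L2_norm (\<lambda>x. clip f m x - f x) < d / 2"
    using order_tendstoD(2)[OF clip_tendsto_L2[OF f] half] by (auto simp: eventually_sequentially)
  define F where "F = fourier_L1 (clip f m)"
  have F: "F \<in> L2" unfolding F_def by (rule Plancherel_clip(1)[OF f])
  obtain n where n: "L2_norm (\<lambda>x. clip F n x - F x) < d / 2"
    using order_tendstoD(2)[OF clip_tendsto_L2[OF F] half] by (auto simp: eventually_sequentially)
  have "L2_norm (\<lambda>x. inverse_fourier_L1 (clip F n) x - f x)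
      \<le> L2_norm (\<lambda>x. inverse_fourier_L1 (clip F n) x - clip f m x) + L2_norm (\<lambda>x. clip f m x - f x)"
    by (intro L2_norm_triangle_diff inverse_fourier_L1_L2 clip_L1 clip_L2 F f)
  also have "L2_norm (\<lambda>x. inverse_fourier_L1 (clip F n) x - clip f m x) = L2_norm (\<lambda>x. clip F n x - F x)"
    unfolding F_def[symmetric]
    by (subst inverse_fourier_L1_dist) (simp_all add: clip_L1 clip_L2 f F F_def[symmetric])
  finally show ?thesis
    using m n F by (intro exI[of _ F] exI[of _ n]) (simp add: L2_norm_minus_commute[of f])
qed

section \<open>Sums over the integers and Gram matrices\<close>

lemma minus_one_powi: "(- 1 :: complex) powi m = (if even m then 1 else - 1)"
  by (cases m rule: int_cases2) (auto simp: minus_one_power_iff power_int_minus)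

lemma cis_pi_of_int: "cis (pi * of_int k) = (- 1) powi k"
  by (simp add: complex_eq_iff minus_one_powi cos_npi_int)

lemma nn_integral_count_space_int_parity:
  fixes f :: "int \<Rightarrow> ennreal"
  shows "(\<integral>\<^sup>+j. f j \<partial>count_space UNIV)
    = (\<integral>\<^sup>+l. f (2 * l) \<partial>count_space UNIV) + (\<integral>\<^sup>+l. f (2 * l + 1) \<partial>count_space UNIV)"
proof -
  have even: "bij_betw (\<lambda>l::int. 2 * l) UNIV {j. even j}"
    by (rule bij_betw_byWitness[where f' = "\<lambda>j. j div 2"]) auto
  have odd: "bij_betw (\<lambda>l::int. 2 * l + 1) UNIV {j. odd j}"
    by (rule bij_betw_byWitness[where f' = "\<lambda>j. j div 2"]) (auto elim!: oddE)
  have "(\<integral>\<^sup>+j. f j \<partial>count_space UNIV)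
      = (\<integral>\<^sup>+j. f j * indicator {j. even j} j + f j * indicator {j. odd j} j \<partial>count_space UNIV)"
    by (rule nn_integral_cong) (simp add: indicator_def)
  also have "\<dots> = (\<integral>\<^sup>+j. f j \<partial>count_space {j. even j}) + (\<integral>\<^sup>+j. f j \<partial>count_space {j. odd j})"
    by (subst nn_integral_add) (simp_all add: nn_integral_count_space_indicator)
  finally show ?thesis
    by (simp add: nn_integral_bij_count_space[OF even, symmetric] nn_integral_bij_count_space[OF odd, symmetric])
qed

text \<open>Pairs \<open>m\<close> with \<open>- m\<close> to match the index set of the Wilson
  system; zero is its own negative and must be counted once.\<close>

lemma nn_integral_count_space_int_nat:
  fixes f :: "int \<Rightarrow> ennreal"
  shows "(\<integral>\<^sup>+m. f m \<partial>count_space UNIV)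
    = (\<integral>\<^sup>+m. (f (int m) + (if m = 0 then 0 else f (- int m))) \<partial>count_space UNIV)"
proof -
  have nonneg: "bij_betw int UNIV {0..}"
    by (rule bij_betw_byWitness[where f' = nat]) auto
  have neg: "bij_betw (\<lambda>m. - int m) {0<..} {..<0}"
    by (rule bij_betw_byWitness[where f' = "\<lambda>j. nat (- j)"]) auto
  have "(\<integral>\<^sup>+m. f m \<partial>count_space UNIV)
      = (\<integral>\<^sup>+m. f m * indicator {0..} m + f m * indicator {..<0} m \<partial>count_space UNIV)"
    by (rule nn_integral_cong) (simp add: indicator_def)
  also have "\<dots> = (\<integral>\<^sup>+m. f m \<partial>count_space {0..}) + (\<integral>\<^sup>+m. f m \<partial>count_space {..<0})"
    by (subst nn_integral_add) (simp_all add: nn_integral_count_space_indicator)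
  also have "\<dots> = (\<integral>\<^sup>+m. f (int m) \<partial>count_space UNIV) + (\<integral>\<^sup>+m. f (- int m) \<partial>count_space {0<..})"
    by (simp add: nn_integral_bij_count_space[OF nonneg, symmetric] nn_integral_bij_count_space[OF neg, symmetric])
  also have "(\<integral>\<^sup>+m. f (- int m) \<partial>count_space {0<..})
      = (\<integral>\<^sup>+m. (if m = 0 then 0 else f (- int m)) \<partial>count_space UNIV)"
    by (auto simp: nn_integral_count_space_indicator intro!: nn_integral_cong split: split_indicator)
  finally show ?thesis
    by (subst nn_integral_add) simp_all
qed

lemma AE_lborel_translate:
  fixes a :: real
  assumes "AE x in lborel. P x"
  shows "AE x in lborel. P (x + a)"
proof -
  obtain N where N: "\<And>x. x \<in> space lborel - N \<Longrightarrow> P x" "N \<in> null_sets lborel"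
    using AE_E3[OF assms] by blast
  have [measurable]: "N \<in> sets borel" using N(2) by auto
  have "AE x in lborel. x \<notin> N" using N(2) by (rule AE_not_in)
  then have "AE x in lborel. a + 1 * x \<notin> N"
    by (intro AE_borel_affine) auto
  then show ?thesis
    by eventually_elim (use N(1) in \<open>auto simp: add.commute\<close>)
qed

section \<open>Gram matrices and polarization\<close>

lemma has_sum_finite_sum:
  fixes f :: "'i \<Rightarrow> 'a \<Rightarrow> 'b :: topological_comm_monoid_add"
  assumes "\<And>i. i \<in> I \<Longrightarrow> (f i has_sum s i) A"
  shows "((\<lambda>x. \<Sum>i\<in>I. f i x) has_sum (\<Sum>i\<in>I. s i)) A"
  using assms by (induction I rule: infinite_finite_induct) (auto intro: has_sum_add)

text \<open>Since \<open>a\<close> lives on a finite set, expanding the square leaves a finite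
  combination of Gram entries, and only finite sums of convergent families occur.\<close>

lemma Parseval_from_Gram:
  fixes G :: "'m \<Rightarrow> 'k \<Rightarrow> complex"
  assumes gram: "\<And>k l. k \<in> K \<Longrightarrow> l \<in> K \<Longrightarrow> ((\<lambda>m. G m k * cnj (G m l)) has_sum (if k = l then 1 else 0)) M"
    and K: "finite K"
  shows "((\<lambda>m. (cmod (\<Sum>k\<in>K. a k * cnj (G m k)))\<^sup>2) has_sum (\<Sum>k\<in>K. (cmod (a k))\<^sup>2)) M"
proof -
  have "((\<lambda>m. \<Sum>k\<in>K. \<Sum>l\<in>K. (a l * cnj (a k)) * (G m k * cnj (G m l)))
      has_sum (\<Sum>k\<in>K. \<Sum>l\<in>K. (a l * cnj (a k)) * (if k = l then 1 else 0))) M"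
    by (intro has_sum_finite_sum has_sum_cmult_right gram)
  moreover have "(\<Sum>k\<in>K. \<Sum>l\<in>K. (a l * cnj (a k)) * (if k = l then 1 else 0)) = of_real (\<Sum>k\<in>K. (cmod (a k))\<^sup>2)"
    using K by (simp add: if_distrib complex_norm_square del: of_real_power cong: if_cong)
  moreover have "(\<Sum>k\<in>K. \<Sum>l\<in>K. (a l * cnj (a k)) * (G m k * cnj (G m l)))
      = of_real ((cmod (\<Sum>k\<in>K. a k * cnj (G m k)))\<^sup>2)" for m
  proof -
    have "complex_of_real ((cmod (\<Sum>k\<in>K. a k * cnj (G m k)))\<^sup>2)
        = cnj (\<Sum>k\<in>K. a k * cnj (G m k)) * (\<Sum>l\<in>K. a l * cnj (G m l))"
      by (simp only: complex_norm_square mult.commute)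
    also have "\<dots> = (\<Sum>k\<in>K. \<Sum>l\<in>K. (a l * cnj (a k)) * (G m k * cnj (G m l)))"
      unfolding cnj_sum sum_product by (intro sum.cong refl) (simp add: mult_ac)
    finally show ?thesis ..
  qed
  ultimately have "((\<lambda>m. complex_of_real ((cmod (\<Sum>k\<in>K. a k * cnj (G m k)))\<^sup>2))
      has_sum of_real (\<Sum>k\<in>K. (cmod (a k))\<^sup>2)) M"
    by (simp only:)
  then show ?thesis by (simp only: has_sum_of_real_iff)
qed

text \<open>Polarization with two test vectors. Half the excess in \<open>re\<close> is the real
  part of \<open>x m * cnj (y m)\<close>; because of the conjugations half the excess in
  \<open>im\<close> is minus its imaginary part, whence the factor \<open>- \<i>\<close>.\<close>

lemma Gram_from_Parseval:
  fixes x y :: "'m \<Rightarrow> complex"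
  assumes x: "((\<lambda>m. (cmod (cnj (x m)))\<^sup>2) has_sum 1) M" and y: "((\<lambda>m. (cmod (cnj (y m)))\<^sup>2) has_sum 1) M"
    and re: "((\<lambda>m. (cmod (cnj (x m) + cnj (y m)))\<^sup>2) has_sum 2) M"
    and im: "((\<lambda>m. (cmod (cnj (x m) + \<i> * cnj (y m)))\<^sup>2) has_sum 2) M"
  shows "((\<lambda>m. x m * cnj (y m)) has_sum 0) M"
proof -
  have "((\<lambda>m. 1 / 2 * (z m + (-1) * ((cmod (cnj (x m)))\<^sup>2 + (cmod (cnj (y m)))\<^sup>2))) has_sum 1 / 2 * (2 + (-1) * (1 + 1))) M"
    if "(z has_sum 2) M" for z :: "'m \<Rightarrow> real"
    by (intro has_sum_cmult_right has_sum_add x y that)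
  from this[OF re] this[OF im]
  have "((\<lambda>m. complex_of_real (1 / 2 * ((cmod (cnj (x m) + cnj (y m)))\<^sup>2
        + (-1) * ((cmod (cnj (x m)))\<^sup>2 + (cmod (cnj (y m)))\<^sup>2)))) has_sum of_real 0) M"
    "((\<lambda>m. complex_of_real (1 / 2 * ((cmod (cnj (x m) + \<i> * cnj (y m)))\<^sup>2
        + (-1) * ((cmod (cnj (x m)))\<^sup>2 + (cmod (cnj (y m)))\<^sup>2)))) has_sum of_real 0) M"
    unfolding has_sum_of_real_iff by simp_all
  from has_sum_add[OF this(1) has_sum_cmult_right[OF this(2), of "- \<i>"]]
  have "((\<lambda>m. complex_of_real (1 / 2 * ((cmod (cnj (x m) + cnj (y m)))\<^sup>2
        + (-1) * ((cmod (cnj (x m)))\<^sup>2 + (cmod (cnj (y m)))\<^sup>2)))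
        + - \<i> * complex_of_real (1 / 2 * ((cmod (cnj (x m) + \<i> * cnj (y m)))\<^sup>2
        + (-1) * ((cmod (cnj (x m)))\<^sup>2 + (cmod (cnj (y m)))\<^sup>2)))) has_sum 0) M"
    by simp
  moreover have "complex_of_real (1 / 2 * ((cmod (cnj a + cnj b))\<^sup>2
        + (-1) * ((cmod (cnj a))\<^sup>2 + (cmod (cnj b))\<^sup>2)))
        + - \<i> * complex_of_real (1 / 2 * ((cmod (cnj a + \<i> * cnj b))\<^sup>2
        + (-1) * ((cmod (cnj a))\<^sup>2 + (cmod (cnj b))\<^sup>2))) = a * cnj b" for a b
    unfolding cmod_power2 by (simp add: complex_eq_iff power2_eq_square algebra_simps)
  ultimately show ?thesis by simp
qed

lemma infsum_eq_imp_has_sum: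
  fixes f :: "'a \<Rightarrow> 'b :: {comm_monoid_add, t2_space}"
  assumes "infsum f A = s" "f summable_on A"
  shows "(f has_sum s) A"
  using assms has_sum_infsum by blast

text \<open>A divergent \<open>infsum\<close> equals 0 by default, so a nonzero diagonal sum forces
  square summability, and the mixed products are then absolutely summable. This turns equations
  between infinite sums into genuine convergence.\<close>

lemma summable_on_product_of_square_summable:
  fixes x y :: "'m \<Rightarrow> complex"
  assumes "infsum (\<lambda>m. x m * cnj (x m)) M \<noteq> 0" "infsum (\<lambda>m. y m * cnj (y m)) M \<noteq> 0"
  shows "(\<lambda>m. x m * cnj (y m)) summable_on M"
proof -
  have "(\<lambda>m. x m * cnj (x m)) summable_on M" "(\<lambda>m. y m * cnj (y m)) summable_on M"
    using assms infsum_not_exists by blast+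
  then have "(\<lambda>m. norm (x m * x m)) summable_on M" "(\<lambda>m. norm (cnj (y m) * cnj (y m))) summable_on M"
    by (simp_all add: summable_on_iff_abs_summable_on_complex norm_mult)
  then have "(\<lambda>m. norm (x m * cnj (y m))) summable_on M"
    by (rule abs_summable_product)
  then show ?thesis by (simp add: summable_on_iff_abs_summable_on_complex)
qed

section \<open>Fiberization of the Wilson system\<close>

text \<open>On odd cells the shifts by \<open>\<alpha> * m\<close> and \<open>- \<alpha> * m\<close>
  trade places, with the sign \<open>(-1) powi m\<close>. With this choice the periodizations for
  even and for odd \<open>j\<close> become, up to phase, the sum and the difference of one and the
  same pair of functions.\<close>

definition fiber :: "(real \<Rightarrow> complex) \<Rightarrow> real \<Rightarrow> real \<Rightarrow> int \<Rightarrow> int \<Rightarrow> real \<Rightarrow> complex" where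
  "fiber g \<alpha> P m k w =
    (if even k then g (w + of_int k * P - \<alpha> * of_int m) else (- 1) powi m * g (w + of_int k * P + \<alpha> * of_int m))"

lemma borel_measurable_fiber [measurable]:
  assumes [measurable]: "g \<in> borel_measurable borel"
  shows "fiber g \<alpha> P m k \<in> borel_measurable borel"
  unfolding fiber_def by measurable

text \<open>Since \<open>2 * n * P = n / \<beta>\<close>, \<open>Phi\<close> compares cells of equal
  parity. For odd \<open>k\<close> the two signs cancel, and replacing \<open>m\<close> by
  \<open>- m\<close> undoes the reversed shift.\<close>

lemma Phi_eq_Gram:
  assumes "\<beta> > 0" "P = 1 / (2 * \<beta>)"
  shows "Phi \<phi> \<alpha> \<beta> n (w + of_int k * P)
    = (\<Sum>\<^sub>\<infinity>m. fiber (fourier \<phi>) \<alpha> P m k w * cnj (fiber (fourier \<phi>) \<alpha> P m (k + 2 * n) w))"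
proof -
  have shift: "w + of_int (k + 2 * n) * P = w + of_int k * P + inverse \<beta> * of_int n"
    using assms by (simp add: field_simps)
  show ?thesis
  proof (cases "even k")
    case True
    then show ?thesis
      unfolding Phi_def fiber_def shift by simp
  next
    case False
    have "fiber (fourier \<phi>) \<alpha> P m k w * cnj (fiber (fourier \<phi>) \<alpha> P m (k + 2 * n) w)
        = fourier \<phi> (w + of_int k * P - \<alpha> * of_int (- m))
          * cnj (fourier \<phi> (w + of_int k * P + inverse \<beta> * of_int n - \<alpha> * of_int (- m)))" for m
      using False unfolding fiber_def shift by (simp add: minus_one_powi)
    then show ?thesis
      unfolding Phi_def by (subst infsum_reindex_bij_witness[of UNIV uminus uminus UNIV]) auto
  qed
qed

text \<open>The half step in \<open>Delta\<close> is one cell, so the parities differ: one sign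
  survives and the two shifts are opposite. The series matches term by term for odd
  \<open>k\<close>, and after negating \<open>m\<close> for even \<open>k\<close>.\<close>

lemma Delta_eq_Gram:
  assumes "\<beta> > 0" "P = 1 / (2 * \<beta>)"
  shows "Delta \<phi> \<alpha> \<beta> n (w + of_int k * P)
    = (\<Sum>\<^sub>\<infinity>m. fiber (fourier \<phi>) \<alpha> P m k w * cnj (fiber (fourier \<phi>) \<alpha> P m (k + 2 * n + 1) w))"
proof -
  have shift: "w + of_int (k + 2 * n + 1) * P = w + of_int k * P + inverse \<beta> * (of_int n + 1 / 2)"
    using assms by (simp add: field_simps)
  show ?thesis
  proof (cases "even k")
    case False
    then show ?thesis
      unfolding Delta_def fiber_def shift by simp
  next
    case True
    have "fiber (fourier \<phi>) \<alpha> P m k w * cnj (fiber (fourier \<phi>) \<alpha> P m (k + 2 * n + 1) w)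
        = (- 1) powi (- m) * fourier \<phi> (w + of_int k * P + \<alpha> * of_int (- m))
          * cnj (fourier \<phi> (w + of_int k * P + inverse \<beta> * (of_int n + 1 / 2) - \<alpha> * of_int (- m)))" for m
      using True unfolding fiber_def shift by (simp add: minus_one_powi)
    then show ?thesis
      unfolding Delta_def by (subst infsum_reindex_bij_witness[of UNIV uminus uminus UNIV]) auto
  qed
qed

text \<open>
  Shifting by \<open>k * P\<close>, the conditions on \<open>Phi\<close> and \<open>Delta\<close> together say that the vectors
  \<open>(fiber g \<alpha> P m k w)\<^sub>m\<close>, \<open>k \<in> \<int>\<close>, are orthonormal; \<open>Phi\<close> covers even and \<open>Delta\<close> odd
  index differences.
\<close>

lemma Gram_from_Phi_Delta:
  assumes "\<beta> > 0" "P = 1 / (2 * \<beta>)"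
    and Phi: "\<And>n. Phi \<phi> \<alpha> \<beta> n (w + of_int k * P) = (if n = 0 then 1 else 0)"
    and Delta: "\<And>n. Delta \<phi> \<alpha> \<beta> n (w + of_int k * P) = 0"
  shows "(\<Sum>\<^sub>\<infinity>m. fiber (fourier \<phi>) \<alpha> P m k w * cnj (fiber (fourier \<phi>) \<alpha> P m l w)) = (if k = l then 1 else 0)"
proof (cases "even (l - k)")
  case True
  then obtain n where "l = k + 2 * n" by (metis add.commute diff_add_cancel evenE)
  then show ?thesis
    using Phi[of n] unfolding Phi_eq_Gram[OF assms(1,2)] by auto
next
  case False
  then obtain n where n: "l = k + 2 * n + 1" by (metis add.commute add.assoc diff_add_cancel oddE)
  then have "k \<noteq> l" by presburger
  then show ?thesis
    using Delta[of n] unfolding Delta_eq_Gram[OF assms(1,2)] by (simp add: n)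
qed

section \<open>Coefficients of the Wilson system on the Fourier side\<close>

lemma tf_shift_L2: "\<phi> \<in> L2 \<Longrightarrow> tf_shift \<phi> \<alpha> \<beta> j m \<in> L2"
  unfolding tf_shift_def[abs_def] by (rule L2_time_frequency_shift)

lemma wilson_L2:
  assumes "\<phi> \<in> L2"
  shows "wilson \<phi> \<alpha> \<beta> jm \<in> L2"
proof (cases jm)
  case (Pair j m)
  show ?thesis
    unfolding Pair wilson_def prod.case
    by (cases "m = 0") (simp_all add: assms L2_cmult L2_add tf_shift_L2)
qed

definition gabor_coeff :: "(real \<Rightarrow> complex) \<Rightarrow> (real \<Rightarrow> complex) \<Rightarrow> real \<Rightarrow> real \<Rightarrow> int \<Rightarrow> int \<Rightarrow> complex" where
  "gabor_coeff F g \<alpha> \<beta> j m = (LINT w|lborel. F w * cis (2 * pi * \<beta> * of_int j * w) * cnj (g (w - \<alpha> * of_int m)))"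

lemma L2_inner_tf_shift:
  assumes "\<phi> \<in> L2" "F \<in> L2" "integrable lborel F"
  shows "L2_inner (inverse_fourier_L1 F) (tf_shift \<phi> \<alpha> \<beta> j m)
    = cis (- 2 * pi * \<beta> * of_int j * \<alpha> * of_int m) * gabor_coeff F (fourier \<phi>) \<alpha> \<beta> j m"
proof -
  have "tf_shift \<phi> \<alpha> \<beta> j m = (\<lambda>x. \<phi> (x - \<beta> * of_int j) * cis (2 * pi * (\<alpha> * of_int m) * x))"
    by (simp add: tf_shift_def[abs_def] mult.assoc)
  then have "L2_inner (inverse_fourier_L1 F) (tf_shift \<phi> \<alpha> \<beta> j m)
      = L2_inner F (\<lambda>w. cis (2 * pi * (\<alpha> * of_int m - w) * (\<beta> * of_int j)) * fourier \<phi> (w - \<alpha> * of_int m))"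
    using L2_inner_time_frequency_shift[OF assms] by simp
  also have "\<dots> = (LINT w|lborel. cis (- 2 * pi * \<beta> * of_int j * \<alpha> * of_int m)
      * (F w * cis (2 * pi * \<beta> * of_int j * w) * cnj (fourier \<phi> (w - \<alpha> * of_int m))))"
    unfolding L2_inner_def
  proof (rule Bochner_Integration.integral_cong[OF refl])
    fix w
    have "cnj (cis (2 * pi * (\<alpha> * of_int m - w) * (\<beta> * of_int j)))
        = cis (- 2 * pi * \<beta> * of_int j * \<alpha> * of_int m) * cis (2 * pi * \<beta> * of_int j * w)"
      unfolding cis_cnj cis_mult by (rule arg_cong[of _ _ cis]) (simp add: algebra_simps)
    then show "F w * cnj (cis (2 * pi * (\<alpha> * of_int m - w) * (\<beta> * of_int j)) * fourier \<phi> (w - \<alpha> * of_int m))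
        = cis (- 2 * pi * \<beta> * of_int j * \<alpha> * of_int m)
          * (F w * cis (2 * pi * \<beta> * of_int j * w) * cnj (fourier \<phi> (w - \<alpha> * of_int m)))"
      by (simp add: mult_ac)
  qed
  finally show ?thesis by (simp add: gabor_coeff_def)
qed

text \<open>Conjugation in the inner product turns the phases in \<open>wilson\<close> into inverses
  of those from \<open>L2_inner_tf_shift\<close>. They cancel, and only the real sign
  \<open>(-1) powi (j + int m)\<close> remains.\<close>

lemma L2_inner_wilson:
  assumes \<phi>: "\<phi> \<in> L2" and F: "F \<in> L2" "integrable lborel F"
  shows "L2_inner (inverse_fourier_L1 F) (wilson \<phi> \<alpha> \<beta> (j, m)) =
    (if m = 0 then of_real (sqrt (2 * \<beta>)) * gabor_coeff F (fourier \<phi>) \<alpha> \<beta> (2 * j) 0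
     else of_real (sqrt \<beta>) * (gabor_coeff F (fourier \<phi>) \<alpha> \<beta> j (int m)
       + (- 1) powi (j + int m) * gabor_coeff F (fourier \<phi>) \<alpha> \<beta> j (- int m)))"
proof (cases "m = 0")
  case True
  then have "wilson \<phi> \<alpha> \<beta> (j, m) = (\<lambda>x. of_real (sqrt (2 * \<beta>)) * tf_shift \<phi> \<alpha> \<beta> (2 * j) 0 x)"
    by (simp add: wilson_def)
  then show ?thesis
    using True by (simp only: L2_inner_cmult_right L2_inner_tf_shift[OF assms]) simp
next
  case False
  define c where "c = cis (2 * pi * \<beta> * of_int j * \<alpha> * of_nat m)"
  have c: "cis (- 2 * pi * \<beta> * of_int j * \<alpha> * of_nat m) = cnj c"
    by (simp add: c_def cis_cnj)
  have cc: "c * cnj c = 1" by (simp add: c_def cis_cnj cis_mult)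
  define s :: complex where "s = (- 1) powi (j + int m)"
  have s: "cnj s = s" by (simp add: s_def minus_one_powi)
  let ?D = "gabor_coeff F (fourier \<phi>) \<alpha> \<beta> j"
  have inv: "inverse_fourier_L1 F \<in> L2" using F by (rule inverse_fourier_L1_L2)
  have plus: "L2_inner (inverse_fourier_L1 F) (tf_shift \<phi> \<alpha> \<beta> j (int m)) = cnj c * ?D (int m)"
    using L2_inner_tf_shift[OF assms, of \<alpha> \<beta> j "int m"] c by simp
  have minus: "L2_inner (inverse_fourier_L1 F) (tf_shift \<phi> \<alpha> \<beta> j (- int m)) = c * ?D (- int m)"
    using L2_inner_tf_shift[OF assms, of \<alpha> \<beta> j "- int m"] by (simp add: c_def)
  have "wilson \<phi> \<alpha> \<beta> (j, m) = (\<lambda>x. of_real (sqrt \<beta>) *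
      (cnj c * tf_shift \<phi> \<alpha> \<beta> j (int m) x + (s * c) * tf_shift \<phi> \<alpha> \<beta> j (- int m) x))"
    using False c by (simp add: wilson_def c_def s_def)
  then have "L2_inner (inverse_fourier_L1 F) (wilson \<phi> \<alpha> \<beta> (j, m))
      = of_real (sqrt \<beta>) * ((c * cnj c) * ?D (int m) + s * (c * cnj c) * ?D (- int m))"
    using inv tf_shift_L2[OF \<phi>]
    by (simp add: L2_inner_cmult_right L2_inner_add_right L2_cmult plus minus s mult_ac)
  then show ?thesis
    using False by (simp add: cc s_def)
qed

text \<open>
  For even \<open>j\<close> the coefficients \<open>\<langle>f, \<psi>\<^sub>j\<^sub>,\<^sub>m\<rangle>\<close> are Fourier coefficients of period \<open>P = 1 / (2 * \<beta>)\<close>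
  with periodization \<open>S m + (-1)\<^sup>m * S (-m)\<close>, for odd \<open>j\<close> with \<open>S m - (-1)\<^sup>m * S (-m)\<close> up
  to a factor of modulus 1; the parallelogram law decouples \<open>m\<close> and \<open>-m\<close>.
\<close>

lemma wilson_coefficients_fixed_frequency:
  assumes \<beta>: "\<beta> > 0" and P: "P = 1 / (2 * \<beta>)" and \<phi>: "\<phi> \<in> L2" and F: "F \<in> L2" "integrable lborel F"
    and bound: "\<And>x. cmod (F x) \<le> B" and K: "finite K" "\<And>x. F x \<noteq> 0 \<Longrightarrow> \<lfloor>x / P\<rfloor> \<in> K"
    and S: "S = (\<lambda>m w. \<Sum>k\<in>K. F (w + of_int k * P) * cnj (fiber (fourier \<phi>) \<alpha> P m k w))"
  shows "(\<integral>\<^sup>+j. ennreal ((cmod (L2_inner (inverse_fourier_L1 F) (wilson \<phi> \<alpha> \<beta> (j, m))))\<^sup>2) \<partial>count_space UNIV)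
    = (\<integral>\<^sup>+w. (ennreal ((cmod (S (int m) w))\<^sup>2) + (if m = 0 then 0 else ennreal ((cmod (S (- int m) w))\<^sup>2)))
        * indicator {0..<P} w \<partial>lborel)"
proof -
  define g where "g = fourier \<phi>"
  have g: "g \<in> L2" unfolding g_def by (rule fourier_L2[OF \<phi>])
  have [measurable]: "g \<in> borel_measurable borel" "F \<in> borel_measurable borel"
    using g F by measurable
  have [measurable]: "S m \<in> borel_measurable borel" for m
  proof -
    have [measurable]: "(\<lambda>w. cnj (fiber g \<alpha> P m k w)) \<in> borel_measurable borel" for k
      by (intro borel_measurable_continuous_on[OF continuous_on_cnj[OF continuous_on_id]]) measurable
    show ?thesis unfolding S g_def[symmetric] by measurable
  qed
  have P0: "P > 0" using \<beta> P by simp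
  have g_shift: "(\<lambda>w. cnj (g (w - a))) \<in> L2" for a
    using L2_cnj[OF L2_translate[OF g, of "- a"]] by simp
  have H_L2: "(\<lambda>w. F w * h w) \<in> L2" if "h \<in> L2" for h
    using that by (rule L2_mult_bounded[OF _ _ bound]) measurable
  have period: "(\<integral>\<^sup>+l. ennreal ((cmod (LINT w|lborel. (F w * h w) * cis (2 * pi * of_int l * w / P)))\<^sup>2) \<partial>count_space (UNIV :: int set))
      = ennreal P * (\<integral>\<^sup>+w. ennreal ((cmod (\<Sum>k\<in>K. F (w + of_int k * P) * h (w + of_int k * P)))\<^sup>2) * indicator {0..<P} w \<partial>lborel)"
    if "h \<in> L2" for h
    using K by (intro Fourier_series_Parseval_periodization P0 H_L2 that) auto
  \<comment> \<open>Since \<open>1 / P = 2 * \<beta>\<close>, the characters of period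
    \<open>P\<close> are the modulations with even \<open>j\<close>; the factor left over for odd
    \<open>j\<close> goes into \<open>h'\<close>.\<close>
  have freq: "2 * pi * of_int l * w / P = 2 * pi * \<beta> * of_int (2 * l) * w" for l :: int and w
    using \<beta> by (simp add: P)
  show ?thesis
  proof (cases "m = 0")
    case True
    define h where "h w = cnj (g (w - 0))" for w
    have h: "h \<in> L2" unfolding h_def by (rule g_shift)
    have coeff: "(LINT w|lborel. (F w * h w) * cis (2 * pi * of_int l * w / P)) = gabor_coeff F g \<alpha> \<beta> (2 * l) 0" for l
      unfolding gabor_coeff_def freq h_def by (simp add: mult_ac)
    have "(\<Sum>k\<in>K. F (w + of_int k * P) * h (w + of_int k * P)) = S 0 w" for w
      unfolding S h_def g_def[symmetric] by (intro sum.cong refl) (simp add: fiber_def)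
    then have "(\<integral>\<^sup>+l. ennreal ((cmod (gabor_coeff F g \<alpha> \<beta> (2 * l) 0))\<^sup>2) \<partial>count_space UNIV)
        = ennreal P * (\<integral>\<^sup>+w. ennreal ((cmod (S 0 w))\<^sup>2) * indicator {0..<P} w \<partial>lborel)"
      using period[OF h] by (simp only: coeff)
    moreover have "(cmod (L2_inner (inverse_fourier_L1 F) (wilson \<phi> \<alpha> \<beta> (j, m))))\<^sup>2
        = 2 * \<beta> * (cmod (gabor_coeff F g \<alpha> \<beta> (2 * j) 0))\<^sup>2" for j
      using True \<beta> by (simp add: L2_inner_wilson[OF \<phi> F] g_def norm_mult power_mult_distrib)
    ultimately have "(\<integral>\<^sup>+j. ennreal ((cmod (L2_inner (inverse_fourier_L1 F) (wilson \<phi> \<alpha> \<beta> (j, m))))\<^sup>2) \<partial>count_space UNIV)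
        = ennreal (2 * \<beta>) * (ennreal P * (\<integral>\<^sup>+w. ennreal ((cmod (S 0 w))\<^sup>2) * indicator {0..<P} w \<partial>lborel))"
      using \<beta> by (simp add: ennreal_mult nn_integral_cmult)
    also have "\<dots> = (\<integral>\<^sup>+w. ennreal ((cmod (S 0 w))\<^sup>2) * indicator {0..<P} w \<partial>lborel)"
    proof -
      \<comment> \<open>The normalisation \<open>sqrt (2 * \<beta>)\<close> of the case
        \<open>m = 0\<close> balances the cell length. For positive \<open>m\<close> the weight is
        \<open>\<beta> * P = 1 / 2\<close>, as the parallelogram law requires.\<close>
      have "ennreal (2 * \<beta>) * ennreal P = 1"
        using \<beta> by (subst ennreal_mult[symmetric]) (auto simp: P)
      then show ?thesis by (simp flip: mult.assoc)
    qed
    finally show ?thesis using True by simp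
  next
    case False
    define s :: complex where "s = (- 1) powi (int m)"
    have s_cases: "s = 1 \<or> s = - 1" unfolding s_def minus_one_powi by simp
    then have s: "s * s = 1" "cnj s = s" by auto
    have s': "(- 1) powi (- int m) = s" "(- 1) powi (2 * l + int m) = s" "(- 1) powi (2 * l + 1 + int m) = - s" for l
      unfolding s_def minus_one_powi by auto
    let ?p = "\<lambda>w. cnj (g (w - \<alpha> * of_int (int m)))"
    let ?q = "\<lambda>w. cnj (g (w - \<alpha> * of_int (- int m)))"
    let ?D = "gabor_coeff F g \<alpha> \<beta>"
    define h where "h w = ?p w + s * ?q w" for w
    define h' where "h' w = cis (2 * pi * \<beta> * w) * (?p w + (- s) * ?q w)" for w
    have pq: "?p \<in> L2" "?q \<in> L2" by (rule g_shift)+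
    have h: "h \<in> L2" unfolding h_def by (intro L2_add L2_cmult pq)
    have h': "h' \<in> L2"
      unfolding h'_def
      by (rule L2_mult_bounded[OF L2_add[OF pq(1) L2_cmult[OF pq(2)]], where C = 1]) auto
    have int: "integrable lborel (\<lambda>w. F w * cis (2 * pi * \<beta> * of_int j * w) * k w)" if "k \<in> L2" for j k
    proof -
      have "(\<lambda>w. cis (2 * pi * \<beta> * of_int j * w) * F w) \<in> L2"
        by (rule L2_mult_bounded[OF F(1), where C = 1]) auto
      then have "(\<lambda>w. F w * cis (2 * pi * \<beta> * of_int j * w)) \<in> L2"
        by (simp only: mult.commute[of "cis _"])
      then show ?thesis by (rule L2_integrable_mult[OF _ that])
    qed
    have coeff: "(LINT w|lborel. (F w * h w) * cis (2 * pi * of_int l * w / P)) = ?D (2 * l) (int m) + s * ?D (2 * l) (- int m)" for l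
    proof -
      have "(LINT w|lborel. (F w * h w) * cis (2 * pi * of_int l * w / P))
          = (LINT w|lborel. F w * cis (2 * pi * \<beta> * of_int (2 * l) * w) * ?p w
              + s * (F w * cis (2 * pi * \<beta> * of_int (2 * l) * w) * ?q w))"
        unfolding freq h_def by (intro Bochner_Integration.integral_cong refl) (simp add: algebra_simps)
      also have "\<dots> = ?D (2 * l) (int m) + s * ?D (2 * l) (- int m)"
        unfolding gabor_coeff_def using int[OF pq(1)] int[OF pq(2)]
        by (subst Bochner_Integration.integral_add) (auto simp del: of_int_minus of_int_mult)
      finally show ?thesis .
    qed
    have coeff': "(LINT w|lborel. (F w * h' w) * cis (2 * pi * of_int l * w / P))
        = ?D (2 * l + 1) (int m) + (- s) * ?D (2 * l + 1) (- int m)" for l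
    proof -
      have c: "cis (2 * pi * \<beta> * w) * cis (2 * pi * \<beta> * of_int (2 * l) * w) = cis (2 * pi * \<beta> * of_int (2 * l + 1) * w)" for w
        unfolding cis_mult by (rule arg_cong[of _ _ cis]) (simp add: algebra_simps)
      have "(F w * h' w) * cis (2 * pi * of_int l * w / P)
          = F w * cis (2 * pi * \<beta> * of_int (2 * l + 1) * w) * (?p w + (- s) * ?q w)" for w
        unfolding freq h'_def c[symmetric] by (simp only: mult_ac)
      then have "(LINT w|lborel. (F w * h' w) * cis (2 * pi * of_int l * w / P))
          = (LINT w|lborel. F w * cis (2 * pi * \<beta> * of_int (2 * l + 1) * w) * ?p w
              + (- s) * (F w * cis (2 * pi * \<beta> * of_int (2 * l + 1) * w) * ?q w))"
        by (intro Bochner_Integration.integral_cong refl) (simp only: ring_distribs mult_ac)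
      also have "\<dots> = ?D (2 * l + 1) (int m) + (- s) * ?D (2 * l + 1) (- int m)"
        unfolding gabor_coeff_def using int[OF pq(1)] int[OF pq(2)]
        by (subst Bochner_Integration.integral_add) (auto simp del: of_int_minus of_int_mult of_int_add)
      finally show ?thesis .
    qed
    have per: "(\<Sum>k\<in>K. F (w + of_int k * P) * h (w + of_int k * P)) = S (int m) w + s * S (- int m) w" for w
      unfolding S g_def[symmetric] sum_distrib_left sum.distrib[symmetric]
    proof (rule sum.cong[OF refl])
      fix k assume "k \<in> K"
      show "F (w + of_int k * P) * h (w + of_int k * P)
          = F (w + of_int k * P) * cnj (fiber g \<alpha> P (int m) k w)
            + s * (F (w + of_int k * P) * cnj (fiber g \<alpha> P (- int m) k w))"
        using s_cases unfolding h_def fiber_def s'(1) s_def[symmetric] by (cases "even k") (auto simp: algebra_simps)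
    qed
    have per': "(\<Sum>k\<in>K. F (w + of_int k * P) * h' (w + of_int k * P))
        = cis (2 * pi * \<beta> * w) * (S (int m) w - s * S (- int m) w)" for w
      unfolding S g_def[symmetric] sum_distrib_left sum_subtractf[symmetric]
    proof (rule sum.cong[OF refl])
      fix k assume "k \<in> K"
      \<comment> \<open>Because \<open>\<beta> * P = 1 / 2\<close>, moving by \<open>k\<close> cells
        contributes the phase \<open>pi * k\<close>, that is, the sign
        \<open>(-1) powi k\<close>.\<close>
      have "cis (2 * pi * \<beta> * (w + of_int k * P)) = cis (2 * pi * \<beta> * w) * cis (pi * of_int k)"
        unfolding cis_mult using \<beta> by (intro arg_cong[of _ _ cis]) (simp add: P field_simps)
      then have "h' (w + of_int k * P)
          = cis (2 * pi * \<beta> * w) * ((- 1) powi k * (?p (w + of_int k * P) + (- s) * ?q (w + of_int k * P)))"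
        by (simp only: h'_def cis_pi_of_int mult.assoc)
      \<comment> \<open>For odd \<open>k\<close> the sign turns \<open>?p - s * ?q\<close> into
        \<open>s * ?q - ?p\<close>; as \<open>s * s = 1\<close>, this is again the difference formed
        from \<open>fiber\<close>, with the shifts interchanged.\<close>
      also have "(- 1) powi k * (?p (w + of_int k * P) + (- s) * ?q (w + of_int k * P))
          = cnj (fiber g \<alpha> P (int m) k w) - s * cnj (fiber g \<alpha> P (- int m) k w)"
        using s_cases unfolding fiber_def s'(1) s_def[symmetric] minus_one_powi[of k] by (cases "even k") (auto simp: algebra_simps)
      finally have e: "h' (w + of_int k * P)
          = cis (2 * pi * \<beta> * w) * (cnj (fiber g \<alpha> P (int m) k w) - s * cnj (fiber g \<alpha> P (- int m) k w))" .
      show "F (w + of_int k * P) * h' (w + of_int k * P)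
          = cis (2 * pi * \<beta> * w) * (F (w + of_int k * P) * cnj (fiber g \<alpha> P (int m) k w)
            - s * (F (w + of_int k * P) * cnj (fiber g \<alpha> P (- int m) k w)))"
        unfolding e by (simp only: right_diff_distrib mult_ac)
    qed
    have wilson_even: "(cmod (L2_inner (inverse_fourier_L1 F) (wilson \<phi> \<alpha> \<beta> (2 * l, m))))\<^sup>2
        = \<beta> * (cmod (?D (2 * l) (int m) + s * ?D (2 * l) (- int m)))\<^sup>2" for l
      using False \<beta> unfolding L2_inner_wilson[OF \<phi> F] g_def[symmetric] s'
      by (simp add: norm_mult power_mult_distrib)
    have wilson_odd: "(cmod (L2_inner (inverse_fourier_L1 F) (wilson \<phi> \<alpha> \<beta> (2 * l + 1, m))))\<^sup>2
        = \<beta> * (cmod (?D (2 * l + 1) (int m) + (- s) * ?D (2 * l + 1) (- int m)))\<^sup>2" for l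
      using False \<beta> unfolding L2_inner_wilson[OF \<phi> F] g_def[symmetric] s'
      by (simp add: norm_mult power_mult_distrib)
    have even: "(\<integral>\<^sup>+l. ennreal ((cmod (L2_inner (inverse_fourier_L1 F) (wilson \<phi> \<alpha> \<beta> (2 * l, m))))\<^sup>2) \<partial>count_space UNIV)
        = ennreal \<beta> * (ennreal P * (\<integral>\<^sup>+w. ennreal ((cmod (S (int m) w + s * S (- int m) w))\<^sup>2) * indicator {0..<P} w \<partial>lborel))"
      unfolding wilson_even period[OF h, unfolded coeff per, symmetric]
      using \<beta> by (simp add: ennreal_mult nn_integral_cmult)
    have odd: "(\<integral>\<^sup>+l. ennreal ((cmod (L2_inner (inverse_fourier_L1 F) (wilson \<phi> \<alpha> \<beta> (2 * l + 1, m))))\<^sup>2) \<partial>count_space UNIV)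
        = ennreal \<beta> * (ennreal P * (\<integral>\<^sup>+w. ennreal ((cmod (cis (2 * pi * \<beta> * w) * (S (int m) w - s * S (- int m) w)))\<^sup>2) * indicator {0..<P} w \<partial>lborel))"
      unfolding wilson_odd period[OF h', unfolded coeff' per', symmetric]
      using \<beta> by (simp add: ennreal_mult nn_integral_cmult)
    have "(\<integral>\<^sup>+j. ennreal ((cmod (L2_inner (inverse_fourier_L1 F) (wilson \<phi> \<alpha> \<beta> (j, m))))\<^sup>2) \<partial>count_space UNIV)
        = ennreal \<beta> * (ennreal P * (\<integral>\<^sup>+w. ennreal ((cmod (S (int m) w + s * S (- int m) w))\<^sup>2) * indicator {0..<P} w \<partial>lborel))
        + ennreal \<beta> * (ennreal P * (\<integral>\<^sup>+w. ennreal ((cmod (cis (2 * pi * \<beta> * w) * (S (int m) w - s * S (- int m) w)))\<^sup>2) * indicator {0..<P} w \<partial>lborel))"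
      by (subst nn_integral_count_space_int_parity) (simp only: even odd)
    also have "\<dots> = ennreal (1 / 2) * (\<integral>\<^sup>+w. ennreal ((cmod (S (int m) w + s * S (- int m) w))\<^sup>2) * indicator {0..<P} w \<partial>lborel)
        + ennreal (1 / 2) * (\<integral>\<^sup>+w. ennreal ((cmod (S (int m) w - s * S (- int m) w))\<^sup>2) * indicator {0..<P} w \<partial>lborel)"
    proof -
      have "ennreal \<beta> * ennreal P = ennreal (1 / 2)"
        using \<beta> by (subst ennreal_mult[symmetric]) (auto simp: P)
      then show ?thesis by (simp add: norm_mult flip: mult.assoc)
    qed
    also have "\<dots> = (\<integral>\<^sup>+w. ennreal (1 / 2) * (ennreal ((cmod (S (int m) w + s * S (- int m) w))\<^sup>2) * indicator {0..<P} w)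
        + ennreal (1 / 2) * (ennreal ((cmod (S (int m) w - s * S (- int m) w))\<^sup>2) * indicator {0..<P} w) \<partial>lborel)"
      by (simp add: nn_integral_cmult nn_integral_add)
    also have "\<dots> = (\<integral>\<^sup>+w. (ennreal ((cmod (S (int m) w))\<^sup>2) + ennreal ((cmod (S (- int m) w))\<^sup>2)) * indicator {0..<P} w \<partial>lborel)"
    proof (rule nn_integral_cong)
      fix w
      have n: "1 / 2 * (cmod (a + s * b))\<^sup>2 + 1 / 2 * (cmod (a - s * b))\<^sup>2 = (cmod a)\<^sup>2 + (cmod b)\<^sup>2" for a b
      proof -
        have "(cmod (a + b))\<^sup>2 + (cmod (a - b))\<^sup>2 = 2 * ((cmod a)\<^sup>2 + (cmod b)\<^sup>2)"
          unfolding cmod_power2 by (simp add: power2_eq_square algebra_simps)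
        then show ?thesis using s_cases by auto
      qed
      have e: "ennreal (1 / 2) * ennreal x + ennreal (1 / 2) * ennreal y = ennreal (1 / 2 * x + 1 / 2 * y)"
        if "0 \<le> x" "0 \<le> y" for x y
      proof -
        have "ennreal (1 / 2 * x + 1 / 2 * y) = ennreal (1 / 2 * x) + ennreal (1 / 2 * y)"
          using that by (intro ennreal_plus) auto
        also have "ennreal (1 / 2 * x) = ennreal (1 / 2) * ennreal x"
          using that by (intro ennreal_mult) auto
        also have "ennreal (1 / 2 * y) = ennreal (1 / 2) * ennreal y"
          using that by (intro ennreal_mult) auto
        finally show ?thesis ..
      qed
      have "ennreal (1 / 2) * ennreal ((cmod (S (int m) w + s * S (- int m) w))\<^sup>2)
          + ennreal (1 / 2) * ennreal ((cmod (S (int m) w - s * S (- int m) w))\<^sup>2)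
          = ennreal ((cmod (S (int m) w))\<^sup>2) + ennreal ((cmod (S (- int m) w))\<^sup>2)"
        by (subst e) (simp_all only: n zero_le_power2 ennreal_plus)
      then show "ennreal (1 / 2) * (ennreal ((cmod (S (int m) w + s * S (- int m) w))\<^sup>2) * indicator {0..<P} w)
          + ennreal (1 / 2) * (ennreal ((cmod (S (int m) w - s * S (- int m) w))\<^sup>2) * indicator {0..<P} w)
          = (ennreal ((cmod (S (int m) w))\<^sup>2) + ennreal ((cmod (S (- int m) w))\<^sup>2)) * indicator {0..<P} w"
        by (simp add: indicator_def)
    qed
    finally show ?thesis using False by simp
  qed
qed

text \<open>Grouping the double sum by \<open>m\<close>, Tonelli moves the frequency sum under the
  integral without prior summability; the paired terms for \<open>m\<close> and \<open>- m\<close>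
  reassemble into a sum over all integers.\<close>

lemma wilson_fiberization:
  assumes \<beta>: "\<beta> > 0" and P: "P = 1 / (2 * \<beta>)" and \<phi>: "\<phi> \<in> L2" and F: "F \<in> L2" "integrable lborel F"
    and bound: "\<And>x. cmod (F x) \<le> B" and K: "finite K" "\<And>x. F x \<noteq> 0 \<Longrightarrow> \<lfloor>x / P\<rfloor> \<in> K"
  shows "(\<integral>\<^sup>+jm. ennreal ((cmod (L2_inner (inverse_fourier_L1 F) (wilson \<phi> \<alpha> \<beta> jm)))\<^sup>2) \<partial>count_space UNIV)
    = (\<integral>\<^sup>+w. (\<integral>\<^sup>+m. ennreal ((cmod (\<Sum>k\<in>K. F (w + of_int k * P) * cnj (fiber (fourier \<phi>) \<alpha> P m k w)))\<^sup>2)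
        \<partial>count_space UNIV) * indicator {0..<P} w \<partial>lborel)"
proof -
  define S where "S = (\<lambda>m w. \<Sum>k\<in>K. F (w + of_int k * P) * cnj (fiber (fourier \<phi>) \<alpha> P m k w))"
  have [measurable]: "S m \<in> borel_measurable borel" for m
  proof -
    have [measurable]: "fourier \<phi> \<in> borel_measurable borel" "F \<in> borel_measurable borel"
      using fourier_L2[OF \<phi>] F by measurable
    have [measurable]: "(\<lambda>w. cnj (fiber (fourier \<phi>) \<alpha> P m k w)) \<in> borel_measurable borel" for k
      by (intro borel_measurable_continuous_on[OF continuous_on_cnj[OF continuous_on_id]]) measurable
    show ?thesis unfolding S_def by measurable
  qed
  have "(\<integral>\<^sup>+jm. ennreal ((cmod (L2_inner (inverse_fourier_L1 F) (wilson \<phi> \<alpha> \<beta> jm)))\<^sup>2) \<partial>count_space UNIV)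
      = (\<integral>\<^sup>+m. (\<integral>\<^sup>+j. ennreal ((cmod (L2_inner (inverse_fourier_L1 F) (wilson \<phi> \<alpha> \<beta> (j, m))))\<^sup>2) \<partial>count_space UNIV) \<partial>count_space UNIV)"
    by (rule nn_integral_snd_count_space[symmetric])
  also have "\<dots> = (\<integral>\<^sup>+m. (\<integral>\<^sup>+w. (ennreal ((cmod (S (int m) w))\<^sup>2) + (if m = 0 then 0 else ennreal ((cmod (S (- int m) w))\<^sup>2)))
        * indicator {0..<P} w \<partial>lborel) \<partial>count_space UNIV)"
    by (intro nn_integral_cong wilson_coefficients_fixed_frequency[OF assms] S_def)
  also have "\<dots> = (\<integral>\<^sup>+w. (\<integral>\<^sup>+m. (ennreal ((cmod (S (int m) w))\<^sup>2) + (if m = 0 then 0 else ennreal ((cmod (S (- int m) w))\<^sup>2)))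
        * indicator {0..<P} w \<partial>count_space UNIV) \<partial>lborel)"
    by (rule nn_integral_count_space_nn_integral[symmetric]) auto
  also have "\<dots> = (\<integral>\<^sup>+w. (\<integral>\<^sup>+m. ennreal ((cmod (S m w))\<^sup>2) \<partial>count_space UNIV) * indicator {0..<P} w \<partial>lborel)"
    unfolding nn_integral_count_space_int_nat by (intro nn_integral_cong) (simp add: nn_integral_multc)
  finally show ?thesis by (simp only: S_def)
qed

section \<open>Equivalence of the frame property with orthonormal fibers\<close>

lemma L2_norm_periodization:
  assumes P: "P > 0" and F: "F \<in> L2" and K: "finite K" "\<And>x. F x \<noteq> 0 \<Longrightarrow> \<lfloor>x / P\<rfloor> \<in> K"
  shows "ennreal ((L2_norm F)\<^sup>2)
    = (\<integral>\<^sup>+w. ennreal (\<Sum>k\<in>K. (cmod (F (w + of_int k * P)))\<^sup>2) * indicator {0..<P} w \<partial>lborel)"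
proof -
  have [measurable]: "F \<in> borel_measurable borel" using F by measurable
  have "ennreal ((L2_norm F)\<^sup>2) = (\<integral>\<^sup>+w. ennreal ((cmod (F w))\<^sup>2) \<partial>lborel)"
    by (rule L2_norm_square_nn_integral[OF F])
  also have "\<dots> = (\<integral>\<^sup>+w. (\<integral>\<^sup>+k. ennreal ((cmod (F (w + of_int k * P)))\<^sup>2) \<partial>count_space (UNIV :: int set))
      * indicator {0..<P} w \<partial>lborel)"
    by (rule nn_integral_periodization[OF P]) measurable
  also have "\<dots> = (\<integral>\<^sup>+w. ennreal (\<Sum>k\<in>K. (cmod (F (w + of_int k * P)))\<^sup>2) * indicator {0..<P} w \<partial>lborel)"
  proof (rule nn_integral_cong)
    fix w
    have "(\<integral>\<^sup>+k. ennreal ((cmod (F (w + of_int k * P)))\<^sup>2) \<partial>count_space (UNIV :: int set))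
        = ennreal (\<Sum>k\<in>K. (cmod (F (w + of_int k * P)))\<^sup>2)" if w: "w \<in> {0..<P}"
    proof -
      have "F (w + of_int k * P) = 0" if "k \<notin> K" for k
        using K(2)[of "w + of_int k * P"] floor_div_eq_iff[OF P, of "w + of_int k * P" k] w that by auto
      then show ?thesis
        using K(1) by (subst nn_integral_count_space'[where A = K]) auto
    qed
    then show "(\<integral>\<^sup>+k. ennreal ((cmod (F (w + of_int k * P)))\<^sup>2) \<partial>count_space (UNIV :: int set)) * indicator {0..<P} w
        = ennreal (\<Sum>k\<in>K. (cmod (F (w + of_int k * P)))\<^sup>2) * indicator {0..<P} w"
      by (cases "w \<in> {0..<P}") auto
  qed
  finally show ?thesis .
qed

text \<open>On the dense set \<open>D\<close> the frame sum and the squared norm both fold onto one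
  cell, and the Gram relations identify the two integrands almost everywhere.\<close>

lemma Parseval_wilson_from_Gram:
  assumes \<beta>: "\<beta> > 0" and P: "P = 1 / (2 * \<beta>)" and \<phi>: "\<phi> \<in> L2"
    and gram: "AE w in lborel. \<forall>k l. ((\<lambda>m. fiber (fourier \<phi>) \<alpha> P m k w * cnj (fiber (fourier \<phi>) \<alpha> P m l w))
      has_sum (if k = l then 1 else 0)) UNIV"
  shows "parseval_frame UNIV (wilson \<phi> \<alpha> \<beta>)"
proof -
  have P0: "P > 0" using \<beta> P by simp
  define D where "D = {inverse_fourier_L1 (clip F n) |F n. F \<in> L2}"
  have "((\<lambda>i. (cmod (L2_inner f (wilson \<phi> \<alpha> \<beta> i)))\<^sup>2) has_sum (L2_norm f)\<^sup>2) UNIV" if "f \<in> L2" for f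
  proof (rule Parseval_from_dense[where V = L2 and D = D])
    show "D \<subseteq> L2"
      using clip_L1 clip_L2(1) inverse_fourier_L1_L2(1) by (auto simp: D_def)
    show "\<exists>g\<in>D. L2_norm (\<lambda>x. f x - g x) < d" if "f \<in> L2" "d > 0" for f d
      using inverse_fourier_L1_clip_dense[OF that] by (auto simp: D_def)
    show "((\<lambda>i. (cmod (L2_inner f (wilson \<phi> \<alpha> \<beta> i)))\<^sup>2) has_sum (L2_norm f)\<^sup>2) UNIV" if f_D: "f \<in> D" for f
    proof -
      obtain F0 n where F0: "F0 \<in> L2" and f: "f = inverse_fourier_L1 (clip F0 n)"
        using f_D by (auto simp: D_def)
      define F where "F = clip F0 n"
      have F: "F \<in> L2" "integrable lborel F"
        unfolding F_def by (rule clip_L2(1)[OF F0], rule clip_L1[OF F0])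
      have bound: "cmod (F x) \<le> real n" for x by (simp add: F_def clip_def)
      \<comment> \<open>The cells meeting the interval from \<open>- n\<close> to \<open>n\<close>,
        which contains the support of \<open>F\<close>.\<close>
      define K where "K = {\<lfloor>- real n / P\<rfloor>..\<lfloor>real n / P\<rfloor>}"
      have K: "finite K" "\<And>x. F x \<noteq> 0 \<Longrightarrow> \<lfloor>x / P\<rfloor> \<in> K"
      proof -
        fix x assume "F x \<noteq> 0"
        then have "- real n \<le> x" "x \<le> real n" by (auto simp: F_def clip_def split: if_splits)
        then have "- real n / P \<le> x / P" "x / P \<le> real n / P"
          using P0 by (intro divide_right_mono; simp)+
        then show "\<lfloor>x / P\<rfloor> \<in> K" unfolding K_def by (auto intro: floor_mono)
      qed (simp add: K_def)
      have "(\<integral>\<^sup>+i. ennreal ((cmod (L2_inner f (wilson \<phi> \<alpha> \<beta> i)))\<^sup>2) \<partial>count_space UNIV)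
          = (\<integral>\<^sup>+w. (\<integral>\<^sup>+m. ennreal ((cmod (\<Sum>k\<in>K. F (w + of_int k * P) * cnj (fiber (fourier \<phi>) \<alpha> P m k w)))\<^sup>2)
            \<partial>count_space UNIV) * indicator {0..<P} w \<partial>lborel)"
        unfolding f F_def[symmetric] by (rule wilson_fiberization[OF \<beta> P \<phi> F bound K])
      also have "\<dots> = (\<integral>\<^sup>+w. ennreal (\<Sum>k\<in>K. (cmod (F (w + of_int k * P)))\<^sup>2) * indicator {0..<P} w \<partial>lborel)"
      proof (rule nn_integral_cong_AE, use gram in eventually_elim)
        case (elim w)
        then have "((\<lambda>m. (cmod (\<Sum>k\<in>K. F (w + of_int k * P) * cnj (fiber (fourier \<phi>) \<alpha> P m k w)))\<^sup>2)
            has_sum (\<Sum>k\<in>K. (cmod (F (w + of_int k * P)))\<^sup>2)) UNIV"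
          using K(1) by (intro Parseval_from_Gram) auto
        then show ?case
          by (subst (asm) has_sum_iff_nn_integral) (auto simp: sum_nonneg)
      qed
      also have "\<dots> = ennreal ((L2_norm f)\<^sup>2)"
        unfolding f F_def[symmetric] inverse_fourier_L1_L2(2)[OF F]
        by (rule L2_norm_periodization[OF P0 F(1) K, symmetric])
      finally show ?thesis
        by (subst has_sum_iff_nn_integral) auto
    qed
  qed (use that in \<open>auto simp: wilson_L2[OF \<phi>] L2_diff\<close>)
  then show ?thesis
    unfolding parseval_frame_def using wilson_L2[OF \<phi>] by auto
qed

lemma borel_measurable_nn_integral_count_space_int:
  assumes [measurable]: "\<And>m::int. f m \<in> borel_measurable M"
  shows "(\<lambda>w. \<integral>\<^sup>+m. f m w \<partial>count_space UNIV) \<in> borel_measurable M"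
proof -
  have "(\<integral>\<^sup>+m. f m w \<partial>count_space UNIV) = (\<Sum>n. f (int_decode n) w)" for w
    by (simp add: nn_integral_bij_count_space[OF bij_int_decode, symmetric] nn_integral_count_space_nat)
  then show ?thesis by simp
qed

text \<open>The frame identity is tested on functions whose fiber is the constant vector
  \<open>a\<close> over a Borel subset \<open>A\<close> of one cell. This equates the integrals of
  both sides over every \<open>A\<close>, so the integrands agree almost everywhere. The exceptional
  set depends on \<open>a\<close> and \<open>K\<close>.\<close>

lemma fiber_Parseval:
  assumes \<beta>: "\<beta> > 0" and P: "P = 1 / (2 * \<beta>)" and \<phi>: "\<phi> \<in> L2"
    and frame: "parseval_frame UNIV (wilson \<phi> \<alpha> \<beta>)" and K: "finite K"
  shows "AE w in lborel. w \<in> {0..<P} \<longrightarrow>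
    ((\<lambda>m. (cmod (\<Sum>k\<in>K. a k * cnj (fiber (fourier \<phi>) \<alpha> P m k w)))\<^sup>2) has_sum (\<Sum>k\<in>K. (cmod (a k))\<^sup>2)) UNIV"
proof -
  have P0: "P > 0" using \<beta> P by simp
  define T where "T w = (\<integral>\<^sup>+m. ennreal ((cmod (\<Sum>k\<in>K. a k * cnj (fiber (fourier \<phi>) \<alpha> P m k w)))\<^sup>2) \<partial>count_space UNIV)" for w
  define s where "s = ennreal (\<Sum>k\<in>K. (cmod (a k))\<^sup>2)"
  have [measurable]: "T \<in> borel_measurable borel"
  proof -
    have [measurable]: "fourier \<phi> \<in> borel_measurable borel" using fourier_L2[OF \<phi>] by measurable
    have [measurable]: "(\<lambda>w. cnj (fiber (fourier \<phi>) \<alpha> P m k w)) \<in> borel_measurable borel" for m k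
      by (intro borel_measurable_continuous_on[OF continuous_on_cnj[OF continuous_on_id]]) measurable
    show ?thesis
      unfolding T_def by (rule borel_measurable_nn_integral_count_space_int) measurable
  qed
  have test: "(\<integral>\<^sup>+w. T w * indicator A w \<partial>lborel) = (\<integral>\<^sup>+w. s * indicator A w \<partial>lborel)"
    if A: "A \<in> sets borel" "A \<subseteq> {0..<P}" for A
  proof -
    \<comment> \<open>Value \<open>a k\<close> on the copy of \<open>A\<close> in cell
      \<open>k\<close>; the copies are disjoint, so folding \<open>F\<close> recovers the vector
      \<open>a\<close> over \<open>A\<close>.\<close>
    define F where "F x = (\<Sum>k\<in>K. a k * indicator A (x - of_int k * P))" for x
    have "emeasure lborel A \<le> emeasure lborel {0..<P}"
      using A by (intro emeasure_mono) auto
    then have fin: "emeasure lborel A < \<infinity>"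
      using emeasure_lborel_Ico_lt_top[of 0 P] by (simp add: order_le_less_trans)
    have ind: "(\<lambda>x. indicator A x :: complex) \<in> L2"
      using L2_indicator_bounded[OF A(1) fin, of "\<lambda>x. 1" 1] by simp
    have "(\<lambda>x. indicator A (x - c) :: complex) \<in> L2" for c
      using L2_translate[OF ind, of "- c"] by simp
    then have F_L2: "F \<in> L2"
      unfolding F_def by (intro L2_sum L2_cmult)
    have "integrable lborel (\<lambda>x. indicator A x :: complex)"
      using A(2) by (intro L2_bounded_support_integrable[OF ind, where a = 0 and b = P]) (blast intro: indicator_simps(2))
    then have "integrable lborel (\<lambda>x. indicator A (- of_int k * P + 1 * x) :: complex)" for k :: int
      by (intro lborel_integrable_real_affine) simp_all
    then have F_L1: "integrable lborel F"
      unfolding F_def by (intro Bochner_Integration.integrable_sum integrable_mult_right) simp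
    have bound: "cmod (F x) \<le> (\<Sum>k\<in>K. cmod (a k))" for x
      unfolding F_def by (rule order_trans[OF norm_sum sum_mono]) (simp add: norm_mult indicator_def)
    have in_A: "\<lfloor>x / P\<rfloor> = k" if "x - of_int k * P \<in> A" for x and k :: int
      using that A(2) floor_div_eq_iff[OF P0, of x k] by blast
    have supp: "\<lfloor>x / P\<rfloor> \<in> K" if Fx: "F x \<noteq> 0" for x
    proof -
      obtain k where "k \<in> K" "a k * indicator A (x - of_int k * P) \<noteq> 0"
        using Fx unfolding F_def by (meson sum.neutral)
      then show ?thesis using in_A[of x k] by (auto simp: indicator_def split: if_splits)
    qed
    have F_eq: "F (w + of_int k * P) = a k * indicator A w" if "w \<in> {0..<P}" "k \<in> K" for w k
    proof -
      have "\<lfloor>(w + of_int k * P) / P\<rfloor> = k"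
        using floor_div_eq_iff[OF P0, of "w + of_int k * P" k] that(1) by simp
      then have "F (w + of_int k * P) = (\<Sum>l\<in>K. if l = k then a k * indicator A w else 0)"
        unfolding F_def using in_A[of "w + of_int k * P"] by (intro sum.cong) (auto simp: indicator_def)
      then show ?thesis using K that(2) by simp
    qed
    have inv: "inverse_fourier_L1 F \<in> L2" "L2_norm (inverse_fourier_L1 F) = L2_norm F"
      by (rule inverse_fourier_L1_L2[OF F_L2 F_L1])+
    have "((\<lambda>i. (cmod (L2_inner (inverse_fourier_L1 F) (wilson \<phi> \<alpha> \<beta> i)))\<^sup>2) has_sum (L2_norm F)\<^sup>2) UNIV"
      using frame inv unfolding parseval_frame_def by metis
    then have "(\<integral>\<^sup>+i. ennreal ((cmod (L2_inner (inverse_fourier_L1 F) (wilson \<phi> \<alpha> \<beta> i)))\<^sup>2) \<partial>count_space UNIV)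
        = ennreal ((L2_norm F)\<^sup>2)"
      by (subst (asm) has_sum_iff_nn_integral) auto
    also have "\<dots> = (\<integral>\<^sup>+w. ennreal (\<Sum>k\<in>K. (cmod (F (w + of_int k * P)))\<^sup>2) * indicator {0..<P} w \<partial>lborel)"
      by (rule L2_norm_periodization[OF P0 F_L2 K supp])
    also have "(\<integral>\<^sup>+i. ennreal ((cmod (L2_inner (inverse_fourier_L1 F) (wilson \<phi> \<alpha> \<beta> i)))\<^sup>2) \<partial>count_space UNIV)
        = (\<integral>\<^sup>+w. (\<integral>\<^sup>+m. ennreal ((cmod (\<Sum>k\<in>K. F (w + of_int k * P) * cnj (fiber (fourier \<phi>) \<alpha> P m k w)))\<^sup>2)
          \<partial>count_space UNIV) * indicator {0..<P} w \<partial>lborel)"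
      by (rule wilson_fiberization[OF \<beta> P \<phi> F_L2 F_L1 bound K supp])
    finally have eq: "(\<integral>\<^sup>+w. (\<integral>\<^sup>+m. ennreal ((cmod (\<Sum>k\<in>K. F (w + of_int k * P) * cnj (fiber (fourier \<phi>) \<alpha> P m k w)))\<^sup>2)
          \<partial>count_space UNIV) * indicator {0..<P} w \<partial>lborel)
        = (\<integral>\<^sup>+w. ennreal (\<Sum>k\<in>K. (cmod (F (w + of_int k * P)))\<^sup>2) * indicator {0..<P} w \<partial>lborel)" .
    have "(\<integral>\<^sup>+m. ennreal ((cmod (\<Sum>k\<in>K. F (w + of_int k * P) * cnj (fiber (fourier \<phi>) \<alpha> P m k w)))\<^sup>2)
          \<partial>count_space UNIV) * indicator {0..<P} w = T w * indicator A w" for w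
    proof (cases "w \<in> {0..<P}")
      case True
      then show ?thesis
        using A(2) by (cases "w \<in> A") (simp_all add: F_eq T_def cong: sum.cong)
    next
      case False
      then have "w \<notin> A" using A(2) by blast
      with False show ?thesis by simp
    qed
    moreover have "ennreal (\<Sum>k\<in>K. (cmod (F (w + of_int k * P)))\<^sup>2) * indicator {0..<P} w = s * indicator A w" for w
    proof (cases "w \<in> {0..<P}")
      case True
      then show ?thesis
        using A(2) by (cases "w \<in> A") (simp_all add: F_eq s_def cong: sum.cong)
    next
      case False
      then have "w \<notin> A" using A(2) by blast
      with False show ?thesis by simp
    qed
    ultimately show ?thesis using eq by simp
  qed
  \<comment> \<open>\<open>T\<close> may a priori be infinite at some points; comparing densities
    over a sigma-finite measure avoids any integrability assumption on it.\<close>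
  have "density lborel (\<lambda>w. T w * indicator {0..<P} w) = density lborel (\<lambda>w. s * indicator {0..<P} w)"
  proof (rule measure_eqI)
    fix A assume "A \<in> sets (density lborel (\<lambda>w. T w * indicator {0..<P} w))"
    then have A: "A \<in> sets borel" by simp
    have "T w * indicator {0..<P} w * indicator A w = T w * indicator (A \<inter> {0..<P}) w"
      "s * indicator {0..<P} w * indicator A w = s * indicator (A \<inter> {0..<P}) w" for w
      by (auto simp: indicator_def)
    then show "emeasure (density lborel (\<lambda>w. T w * indicator {0..<P} w)) A
        = emeasure (density lborel (\<lambda>w. s * indicator {0..<P} w)) A"
      using A test[of "A \<inter> {0..<P}"] by (simp add: emeasure_density)
  qed simp
  then have "AE w in lborel. T w * indicator {0..<P} w = s * indicator {0..<P} w"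
    by (intro sigma_finite_measure.density_unique[OF sigma_finite_lborel]) auto
  then show ?thesis
  proof eventually_elim
    case (elim w)
    show ?case
    proof
      assume "w \<in> {0..<P}"
      then have "T w = s" using elim by simp
      then show "((\<lambda>m. (cmod (\<Sum>k\<in>K. a k * cnj (fiber (fourier \<phi>) \<alpha> P m k w)))\<^sup>2) has_sum (\<Sum>k\<in>K. (cmod (a k))\<^sup>2)) UNIV"
        unfolding T_def s_def by (subst has_sum_iff_nn_integral) (auto simp: sum_nonneg)
    qed
  qed
qed

text \<open>Polarization uses unit vectors and the sums of two of them with coefficients 1 and 1 or
  1 and \<open>\<i>\<close>. These are countably many, so one null set serves all Gram relations at
  once.\<close>

lemma Gram_from_Parseval_wilson:
  assumes "\<beta> > 0" "P = 1 / (2 * \<beta>)" "\<phi> \<in> L2" "parseval_frame UNIV (wilson \<phi> \<alpha> \<beta>)"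
  shows "AE w in lborel. w \<in> {0..<P} \<longrightarrow> (\<forall>k l.
    ((\<lambda>m. fiber (fourier \<phi>) \<alpha> P m k w * cnj (fiber (fourier \<phi>) \<alpha> P m l w)) has_sum (if k = l then 1 else 0)) UNIV)"
proof -
  let ?G = "fiber (fourier \<phi>) \<alpha> P"
  note fiber = fiber_Parseval[OF assms]
  have diag: "AE w in lborel. \<forall>k. w \<in> {0..<P} \<longrightarrow> ((\<lambda>m. (cmod (cnj (?G m k w)))\<^sup>2) has_sum 1) UNIV"
  proof (subst AE_all_countable, rule allI)
    fix k
    show "AE w in lborel. w \<in> {0..<P} \<longrightarrow> ((\<lambda>m. (cmod (cnj (?G m k w)))\<^sup>2) has_sum 1) UNIV"
      using fiber[of "{k}" "\<lambda>_. 1"] by simp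
  qed
  have re: "AE w in lborel. \<forall>k l. k \<noteq> l \<longrightarrow> w \<in> {0..<P} \<longrightarrow>
      ((\<lambda>m. (cmod (cnj (?G m k w) + cnj (?G m l w)))\<^sup>2) has_sum 2) UNIV"
  proof (subst AE_all_countable, rule allI, subst AE_all_countable, rule allI)
    fix k l
    show "AE w in lborel. k \<noteq> l \<longrightarrow> w \<in> {0..<P} \<longrightarrow>
        ((\<lambda>m. (cmod (cnj (?G m k w) + cnj (?G m l w)))\<^sup>2) has_sum 2) UNIV"
      using fiber[of "{k, l}" "\<lambda>_. 1"] by (cases "k = l") simp_all
  qed
  have im: "AE w in lborel. \<forall>k l. k \<noteq> l \<longrightarrow> w \<in> {0..<P} \<longrightarrow>
      ((\<lambda>m. (cmod (cnj (?G m k w) + \<i> * cnj (?G m l w)))\<^sup>2) has_sum 2) UNIV"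
  proof (subst AE_all_countable, rule allI, subst AE_all_countable, rule allI)
    fix k l
    show "AE w in lborel. k \<noteq> l \<longrightarrow> w \<in> {0..<P} \<longrightarrow>
        ((\<lambda>m. (cmod (cnj (?G m k w) + \<i> * cnj (?G m l w)))\<^sup>2) has_sum 2) UNIV"
      using fiber[of "{k, l}" "\<lambda>j. if j = l then \<i> else 1"] by (cases "k = l") simp_all
  qed
  from diag re im show ?thesis
  proof eventually_elim
    case (elim w)
    show ?case
    proof (intro impI allI)
      fix k l assume w: "w \<in> {0..<P}"
      show "((\<lambda>m. ?G m k w * cnj (?G m l w)) has_sum (if k = l then 1 else 0)) UNIV"
      proof (cases "k = l")
        case True
        have "((\<lambda>m. complex_of_real ((cmod (cnj (?G m k w)))\<^sup>2)) has_sum of_real 1) UNIV"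
          unfolding has_sum_of_real_iff using elim(1) w by blast
        then show ?thesis using True by (simp add: complex_norm_square del: of_real_power)
      next
        case False
        have "((\<lambda>m. ?G m k w * cnj (?G m l w)) has_sum 0) UNIV"
          using elim w False by (intro Gram_from_Parseval) auto
        then show ?thesis using False by simp
      qed
    qed
  qed
qed

theorem theorem2p1:
  fixes \<alpha> \<beta> :: real and \<phi> :: "real \<Rightarrow> complex"
  assumes "\<alpha> > 0" and "\<beta> > 0" and "\<phi> \<in> L2"
  shows "parseval_frame UNIV (wilson \<phi> \<alpha> \<beta>) \<longleftrightarrow>
    (\<forall>k::int.
       (AE \<xi> in lborel. Phi \<phi> \<alpha> \<beta> k \<xi> = (if k = 0 then 1 else 0)) \<and>
       (AE \<xi> in lborel. Delta \<phi> \<alpha> \<beta> k \<xi> = 0))"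
proof
  define P where "P = 1 / (2 * \<beta>)"
  have P0: "P > 0" using assms(2) by (simp add: P_def)
  let ?G = "fiber (fourier \<phi>) \<alpha> P"
  note Phi = Phi_eq_Gram[OF assms(2) P_def] and Delta = Delta_eq_Gram[OF assms(2) P_def]
  {
    assume frame: "parseval_frame UNIV (wilson \<phi> \<alpha> \<beta>)"
    \<comment> \<open>The Gram relations hold on a single cell; countably many translates spread
      them over the line, and \<open>j\<close> will be the index of the cell containing
      \<open>\<xi>\<close>.\<close>
    have "AE \<xi> in lborel. \<forall>j. \<xi> + - of_int j * P \<in> {0..<P} \<longrightarrow> (\<forall>k l.
      ((\<lambda>m. ?G m k (\<xi> + - of_int j * P) * cnj (?G m l (\<xi> + - of_int j * P))) has_sum (if k = l then 1 else 0)) UNIV)"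
      unfolding AE_all_countable
      by (intro allI AE_lborel_translate Gram_from_Parseval_wilson[OF assms(2) P_def assms(3) frame])
    then have "AE \<xi> in lborel. \<forall>n. Phi \<phi> \<alpha> \<beta> n \<xi> = (if n = 0 then 1 else 0) \<and> Delta \<phi> \<alpha> \<beta> n \<xi> = 0"
    proof eventually_elim
      case (elim \<xi>)
      define j where "j = \<lfloor>\<xi> / P\<rfloor>"
      define w where "w = \<xi> + - of_int j * P"
      have "w \<in> {0..<P}"
        using floor_div_eq_iff[OF P0, of \<xi> j] by (simp add: j_def w_def)
      then have gram: "(\<Sum>\<^sub>\<infinity>m. ?G m k w * cnj (?G m l w)) = (if k = l then 1 else 0)" for k l
        using elim unfolding w_def by (intro infsumI) blast
      have \<xi>: "\<xi> = w + of_int j * P" by (simp add: w_def)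
      have "j \<noteq> j + 2 * n + 1" for n by presburger
      then show ?case
        unfolding \<xi> Phi Delta gram by auto
    qed
    then show "\<forall>k. (AE \<xi> in lborel. Phi \<phi> \<alpha> \<beta> k \<xi> = (if k = 0 then 1 else 0)) \<and> (AE \<xi> in lborel. Delta \<phi> \<alpha> \<beta> k \<xi> = 0)"
      by (simp add: AE_all_countable)
  }
  {
    assume "\<forall>k. (AE \<xi> in lborel. Phi \<phi> \<alpha> \<beta> k \<xi> = (if k = 0 then 1 else 0)) \<and> (AE \<xi> in lborel. Delta \<phi> \<alpha> \<beta> k \<xi> = 0)"
    then have "AE \<xi> in lborel. \<forall>n. Phi \<phi> \<alpha> \<beta> n \<xi> = (if n = 0 then 1 else 0) \<and> Delta \<phi> \<alpha> \<beta> n \<xi> = 0"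
      by (simp add: AE_all_countable)
    \<comment> \<open>The Gram row with index \<open>k\<close> at \<open>w\<close> needs the
      conditions at \<open>w + k * P\<close>, so they are required along the whole orbit of
      \<open>w\<close>, a countable intersection.\<close>
    then have "AE w in lborel. \<forall>k. \<forall>n. Phi \<phi> \<alpha> \<beta> n (w + of_int k * P) = (if n = 0 then 1 else 0)
        \<and> Delta \<phi> \<alpha> \<beta> n (w + of_int k * P) = 0"
      by (subst AE_all_countable) (intro allI AE_lborel_translate)
    then have "AE w in lborel. \<forall>k l. ((\<lambda>m. ?G m k w * cnj (?G m l w)) has_sum (if k = l then 1 else 0)) UNIV"
    proof eventually_elim
      case (elim w)
      then have gram: "(\<Sum>\<^sub>\<infinity>m. ?G m k w * cnj (?G m l w)) = (if k = l then 1 else 0)" for k l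
        by (intro Gram_from_Phi_Delta[OF assms(2) P_def]) auto
      show ?case
      proof (intro allI infsum_eq_imp_has_sum gram)
        fix k l
        \<comment> \<open>Both diagonal sums equal 1, so they cannot be default values of divergent
          series.\<close>
        show "(\<lambda>m. ?G m k w * cnj (?G m l w)) summable_on UNIV"
          by (rule summable_on_product_of_square_summable) (simp_all add: gram)
      qed
    qed
    then show "parseval_frame UNIV (wilson \<phi> \<alpha> \<beta>)"
      by (rule Parseval_wilson_from_Gram[OF assms(2) P_def assms(3)])
  }
qed

end
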